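(* Let $\phi(x,t)=\frac1p t^p+\frac1q a(x)t^q$ with $1<p<q<\infty$ and $a:\mathbb{R}^n\to[0,\infty)$ measurable. Then the following assertions are equivalent: (a) $\phi\in\mathcal{A}$. (b) There is a constant $C>0$ such that $\int_{\mathbb{R}^n}\phi(x,Mf(x))\,dx\le C\int_{\mathbb{R}^n}\phi(x,|f(x)|)\,dx$ for all $f\in L^\phi(\mathbb{R}^n)$ with $\|f\|_\phi\le1$. (c) The maximal operator $M$ is bounded on $L^\phi(\mathbb{R}^n)$. (d) There is a constant $C>0$ such that $\int_{\mathbb{R}^n}\phi^*(x,Mg(x))\,dx\le C\int_{\mathbb{R}^n}\phi^*(x,|g(x)|)\,dx$ for all $g\in L^{\phi^*}(\mathbb{R}^n)$ with $\|g\|_{\phi^*}\le1$. (e) The maximal operator $M$ is bounded on $L^{\phi^*}(\mathbb{R}^n)$. (f) There exists $0<s<1$ such that the maximal operator $M$ is bounded on $L^{\psi_{(s)}}(\mathbb{R}^n)$, where $\psi_{(s)}(x,t):=\phi(x,t^s)$.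
   Context: Cubes have sides parallel to the coordinate axes. The (uncentered) Hardy–Littlewood maximal operator is $Mf(x)=\sup_{Q\ni x}\frac{1}{|Q|}\int_Q|f(y)|\,dy$, the supremum being over all cubes $Q$ containing $x$ (with value $+\infty$ if some such integral is infinite). The conjugate function is $\phi^*(x,s)=\sup_{t\ge0}(st-\phi(x,t))$. For $\varphi\in\{\phi,\phi^*,\psi_{(s)}\}$ and measurable $f$ on $\mathbb{R}^n$, $\|f\|_\varphi=\inf\{\lambda>0:\int_{\mathbb{R}^n}\varphi(x,|f(x)|/\lambda)\,dx\le1\}$, and $L^\varphi(\mathbb{R}^n)$ is the set of measurable $f$ with $\|f\|_\varphi<\infty$. "$M$ is bounded on $L^\varphi(\mathbb{R}^n)$" means that there is a constant $C$ with $\|Mf\|_\varphi\le C\|f\|_\varphi$ for all $f\in L^\varphi(\mathbb{R}^n)$. We write $\phi\in\mathcal{A}$ if $$[\phi]_{\mathcal{A}}:=\sup_Q\frac{\|\mathbf{1}_Q\|_\phi\|\mathbf{1}_Q\|_{\phi^*}}{|Q|}<\infty,$$ the supremum being over all cubes $Q\subset\mathbb{R}^n$. *)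

theory Defs
  imports "HOL-Analysis.Analysis"
begin

text \<open>A function \<open>\<phi> x t\<close> matters only at arguments \<open>t \<ge> 0\<close>. Closed and open cubes give
  the same maximal function and the same class A.\<close>

definition cubes :: "(real ^ 'n) set set" where
  "cubes = {cbox c (\<chi> i. c $ i + l) | c l. 0 < l}"

definition maximal :: "(real ^ 'n \<Rightarrow> real) \<Rightarrow> real ^ 'n \<Rightarrow> ennreal" where
  "maximal f x = (SUP Q\<in>{Q \<in> cubes. x \<in> Q}.
     (\<integral>\<^sup>+y\<in>Q. ennreal \<bar>f y\<bar> \<partial>lebesgue) / emeasure lebesgue Q)"

text \<open>Subtraction on \<^typ>\<open>ennreal\<close> truncates at 0; this does not affect the supremum when
  \<open>\<phi> x 0 = 0\<close>, since then \<open>t = 0\<close> contributes the value 0.\<close>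

definition conjugate :: "('a \<Rightarrow> real \<Rightarrow> ennreal) \<Rightarrow> 'a \<Rightarrow> real \<Rightarrow> ennreal" where
  "conjugate \<phi> x s = (SUP t\<in>{0..}. ennreal (s * t) - \<phi> x t)"

text \<open>\<open>M f\<close> may be infinite, so \<open>\<phi> x\<close> is extended by its limit at infinity, which is \<open>\<infinity>\<close> for
  the double phase function, for its conjugate and for its power rescalings.\<close>

definition extend :: "('a \<Rightarrow> real \<Rightarrow> ennreal) \<Rightarrow> 'a \<Rightarrow> ennreal \<Rightarrow> ennreal" where
  "extend \<phi> x u = (if u = \<infinity> then \<infinity> else \<phi> x (enn2real u))"

text \<open>The modular and the norm take the absolute value \<open>u = |f|\<close> as argument.\<close>

definition modular :: "(real ^ 'n \<Rightarrow> real \<Rightarrow> ennreal) \<Rightarrow> (real ^ 'n \<Rightarrow> ennreal) \<Rightarrow> ennreal" where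
  "modular \<phi> u = (\<integral>\<^sup>+x. extend \<phi> x (u x) \<partial>lebesgue)"

definition lux_norm :: "(real ^ 'n \<Rightarrow> real \<Rightarrow> ennreal) \<Rightarrow> (real ^ 'n \<Rightarrow> ennreal) \<Rightarrow> ennreal" where
  "lux_norm \<phi> u = Inf {ennreal r | r. 0 < r \<and> modular \<phi> (\<lambda>x. u x / ennreal r) \<le> 1}"

definition L_space :: "(real ^ 'n \<Rightarrow> real \<Rightarrow> ennreal) \<Rightarrow> (real ^ 'n \<Rightarrow> real) set" where
  "L_space \<phi> = {f \<in> borel_measurable lebesgue. lux_norm \<phi> (\<lambda>x. ennreal \<bar>f x\<bar>) < \<infinity>}"

definition maximal_bounded :: "(real ^ 'n \<Rightarrow> real \<Rightarrow> ennreal) \<Rightarrow> bool" where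
  "maximal_bounded \<phi> \<longleftrightarrow> (\<exists>C::real. 0 \<le> C \<and> (\<forall>f\<in>L_space \<phi>.
     lux_norm \<phi> (maximal f) \<le> ennreal C * lux_norm \<phi> (\<lambda>x. ennreal \<bar>f x\<bar>)))"

definition maximal_modular_bounded :: "(real ^ 'n \<Rightarrow> real \<Rightarrow> ennreal) \<Rightarrow> bool" where
  "maximal_modular_bounded \<phi> \<longleftrightarrow> (\<exists>C::real. 0 < C \<and> (\<forall>f\<in>L_space \<phi>.
     lux_norm \<phi> (\<lambda>x. ennreal \<bar>f x\<bar>) \<le> 1 \<longrightarrow>
     modular \<phi> (maximal f) \<le> ennreal C * modular \<phi> (\<lambda>x. ennreal \<bar>f x\<bar>)))"

definition class_A_const :: "(real ^ 'n \<Rightarrow> real \<Rightarrow> ennreal) \<Rightarrow> ennreal" where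
  "class_A_const \<phi> = (SUP Q\<in>cubes.
     lux_norm \<phi> (indicator Q) * lux_norm (conjugate \<phi>) (indicator Q) / emeasure lebesgue Q)"

definition class_A :: "(real ^ 'n \<Rightarrow> real \<Rightarrow> ennreal) set" where
  "class_A = {\<phi>. class_A_const \<phi> < \<infinity>}"

definition double_phase ::
    "real \<Rightarrow> real \<Rightarrow> (real ^ 'n \<Rightarrow> real) \<Rightarrow> real ^ 'n \<Rightarrow> real \<Rightarrow> ennreal" where
  "double_phase p q a x t = ennreal (1 / p * t powr p + 1 / q * a x * t powr q)"

definition power_rescale :: "real \<Rightarrow> ('a \<Rightarrow> real \<Rightarrow> ennreal) \<Rightarrow> 'a \<Rightarrow> real \<Rightarrow> ennreal" where
  "power_rescale s \<phi> x t = \<phi> x (t powr s)"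

end

theory Submission
  imports Defs
begin

text \<open>
  Up to constants, the modular of \<open>\<phi>\<close> is that of \<open>t\<^sup>p + a(x) t\<^sup>q\<close> and, for \<open>s \<le> 1 / \<parallel>1\<^sub>Q\<parallel>\<close> (norm of the
  conjugate), class A says exactly that the truncated weight \<open>W = max a \<kappa>(s)\<close> satisfies the Muckenhoupt condition
  \<open>A\<^sub>q\<close> on \<open>Q\<close>, with a constant independent of \<open>Q\<close> and \<open>s\<close>; here \<open>\<kappa>(s)\<close> is the value of \<open>a\<close> at which the two
  terms balance. The same \<open>s\<close> is admissible on every subcube of \<open>Q\<close>, so the condition passes to subcubes, and \<open>W\<close>
  and its dual weight \<open>V\<close> satisfy a reverse Hoelder inequality on \<open>Q\<close>. This self-improvement shows that
  averages over single cubes are bounded in the modular sense not only for \<open>\<phi>\<close> and its conjugate but even for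
  \<open>\<phi>(x, t\<^sup>\<tau>)\<close> with some \<open>\<tau> < 1\<close>. A Vitali covering turns this into a weak type estimate, and the gain \<open>\<tau> < 1\<close>
  makes the sum over dyadic levels converge, which gives the strong type estimates. Conversely, testing the
  boundedness of \<open>M\<close> on extremals of Young's inequality gives class A.
\<close>

text \<open>Norm inequalities on single cubes do not add up over disjoint cubes, modular
  inequalities do. Hence boundedness is derived from class A through modulars: in the covering step
  each cube carries its own part of a total modular of at most 1, and the estimates for single cubes
  are summed. The restriction to modular at most 1 cannot be removed by scaling, since the two
  powers scale differently; it is what makes the mismatch of \<open>p\<close> and \<open>q\<close>
  harmless, through \<open>X powr (q / p) \<le> X\<close> for \<open>X \<le> 1\<close>. The
  truncation of the weight has a similar origin: where \<open>a\<close> is below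
  \<open>kap s\<close>, the first power decides the conjugate at slope \<open>s\<close>, and putting
  \<open>kap s\<close> in place of \<open>a\<close> keeps the dual weight bounded even where
  \<open>a\<close> vanishes. The maximal operator is not linear, and no duality between the two
  spaces is invoked: the function and its conjugate are treated separately, the former with the
  reverse Hoelder inequality of \<open>V\<close>, the latter with that of \<open>W\<close>. In the
  second case the constant whose modular is sought must itself serve as the parameter
  \<open>s\<close>, so its admissibility has to be proved along the way.\<close>

declare emeasure_completion [simp del]

section \<open>Dyadic cubes and reverse Hoelder inequality\<close>

text \<open>Half-open, so that the dyadic subcubes of one generation partition a cube exactly; the
  closed cubes of the statement differ from these only by a null set.\<close>

definition hcube :: "real ^ 'n \<Rightarrow> real \<Rightarrow> (real ^ 'n) set" where
  "hcube c l = {x. \<forall>i. c $ i \<le> x $ i \<and> x $ i < c $ i + l}"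

text \<open>For \<open>0 < l\<close> the half-open dyadic cube of side \<open>l / 2 ^ k\<close>
  through \<open>x\<close>, in the grid based at \<open>c\<close>. As an equivalence class it needs
  no index: cells of one generation with a common point are equal by definition.\<close>

definition cell :: "real ^ 'n \<Rightarrow> real \<Rightarrow> nat \<Rightarrow> real ^ 'n \<Rightarrow> (real ^ 'n) set" where
  "cell c l k x = {y. \<forall>i. \<lfloor>2 ^ k * (y $ i - c $ i) / l\<rfloor> = \<lfloor>2 ^ k * (x $ i - c $ i) / l\<rfloor>}"

lemma hcube_borel [measurable]: "hcube c l \<in> sets borel"
proof -
  have "hcube c l = (\<Inter>i. {x. c $ i \<le> x $ i} \<inter> {x. x $ i < c $ i + l})"
    by (auto simp: hcube_def)
  also have "\<dots> \<in> sets borel" by measurable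
  finally show ?thesis .
qed

lemma hcube_lebesgue [measurable]: "hcube c l \<in> sets lebesgue"
  using hcube_borel[of c l] by simp

lemma hcube_cbox_null:
  fixes c :: "real ^ 'n"
  shows "(cbox c (\<chi> i. c $ i + l) - hcube c l) \<union> (hcube c l - cbox c (\<chi> i. c $ i + l)) \<in> null_sets lebesgue"
proof -
  have "negligible (cbox c (\<chi> i. c $ i + l) - box c (\<chi> i. c $ i + l))"
    by (rule negligible_frontier_interval)
  moreover have "(cbox c (\<chi> i. c $ i + l) - hcube c l) \<union> (hcube c l - cbox c (\<chi> i. c $ i + l)) \<subseteq> cbox c (\<chi> i. c $ i + l) - box c (\<chi> i. c $ i + l)"
    by (auto simp: hcube_def mem_box_cart less_imp_le)
  ultimately show ?thesis
    by (metis negligible_subset negligible_iff_null_sets)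
qed

lemma nn_integral_hcube:
  assumes "f \<in> borel_measurable lebesgue"
  shows "(\<integral>\<^sup>+x\<in>hcube c l. f x \<partial>lebesgue) = (\<integral>\<^sup>+x\<in>cbox c (\<chi> i. c $ i + l). f x \<partial>lebesgue)"
  by (rule nn_integral_null_delta)
    (simp, simp, subst Un_commute, rule hcube_cbox_null)

lemma emeasure_cbox_cube:
  fixes c :: "real ^ 'n"
  assumes "0 \<le> l"
  shows "emeasure lebesgue (cbox c (\<chi> i. c $ i + l)) = ennreal (l ^ CARD('n))"
proof -
  have "emeasure lebesgue (cbox c (\<chi> i. c $ i + l)) = ennreal (measure lebesgue (cbox c (\<chi> i. c $ i + l)))"
    by (rule emeasure_eq_measure2) (rule lmeasurable_cbox)
  also have "measure lebesgue (cbox c (\<chi> i. c $ i + l)) = measure lborel (cbox c (\<chi> i. c $ i + l))"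
    by (rule measure_completion) simp
  also have "measure lborel (cbox c (\<chi> i. c $ i + l)) = l ^ CARD('n)"
    using assms by (subst content_cbox_cart) (auto simp: interval_ne_empty_cart(1))
  finally show ?thesis .
qed

lemma emeasure_hcube:
  fixes c :: "real ^ 'n"
  assumes "0 \<le> l"
  shows "emeasure lebesgue (hcube c l) = ennreal (l ^ CARD('n))"
proof -
  have "emeasure lebesgue (hcube c l) = (\<integral>\<^sup>+x\<in>hcube c l. 1 \<partial>lebesgue)"
    by (simp only: mult_1_left nn_integral_indicator hcube_lebesgue)
  also have "\<dots> = (\<integral>\<^sup>+x\<in>cbox c (\<chi> i. c $ i + l). 1 \<partial>lebesgue)"
    by (rule nn_integral_hcube) (rule measurable_const, simp only: space_borel UNIV_I)
  also have "\<dots> = emeasure lebesgue (cbox c (\<chi> i. c $ i + l))"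
    by (simp only: mult_1_left nn_integral_indicator lmeasurable_cbox fmeasurableD)
  also have "\<dots> = ennreal (l ^ CARD('n))"
    by (rule emeasure_cbox_cube[OF assms])
  finally show ?thesis .
qed

lemma self_in_cell: "x \<in> cell c l k x"
  by (simp add: cell_def)

lemma cell_eqI: "y \<in> cell c l k x \<Longrightarrow> cell c l k y = cell c l k x"
  by (auto simp: cell_def)

lemma cell_eq_hcube:
  fixes c :: "real ^ 'n"
  assumes "0 < l"
  shows "cell c l k x = hcube (\<chi> i. c $ i + l * of_int \<lfloor>2 ^ k * (x $ i - c $ i) / l\<rfloor> / 2 ^ k) (l / 2 ^ k)"
proof -
  have "\<lfloor>2 ^ k * (t - s) / l\<rfloor> = m \<longleftrightarrow> s + l * of_int m / 2 ^ k \<le> t \<and> t < s + l * of_int m / 2 ^ k + l / 2 ^ k"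
    for t s :: real and m :: int
    using assms by (simp add: floor_eq_iff field_simps)
  then show ?thesis unfolding cell_def hcube_def by simp
qed

text \<open>Halving the mesh doubles the integer coordinate: since
  \<open>\<lfloor>z\<rfloor> = \<lfloor>2 * z\<rfloor> div 2\<close>, the index of the finer cell
  determines that of the coarser one.\<close>

lemma cell_Suc_subset: "cell c l (Suc k) x \<subseteq> cell c l k x"
proof -
  have *: "\<lfloor>z\<rfloor> = \<lfloor>2 * z\<rfloor> div 2" for z :: real
    using floor_divide_real_eq_div[of 2 "2 * z"] by simp
  have "\<lfloor>2 ^ k * (y - u) / l\<rfloor> = \<lfloor>2 ^ Suc k * (y - u) / l\<rfloor> div 2" for y u
    using *[of "2 ^ k * (y - u) / l"] by (simp add: mult.assoc)
  then show ?thesis by (auto simp: cell_def)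
qed

lemma cell_antimono: "j \<le> k \<Longrightarrow> cell c l k x \<subseteq> cell c l j x"
  by (rule lift_Suc_antimono_le[of "\<lambda>k. cell c l k x"]) (rule cell_Suc_subset)

lemma cell_0: "0 < l \<Longrightarrow> x \<in> hcube c l \<Longrightarrow> cell c l 0 x = hcube c l"
proof -
  assume l: "0 < l" and x: "x \<in> hcube c l"
  have "\<lfloor>(x $ i - c $ i) / l\<rfloor> = 0" for i
    using x l by (auto simp: hcube_def floor_eq_iff field_simps)
  then show ?thesis
    using l by (simp add: cell_eq_hcube)
qed

lemma countable_cells:
  fixes c :: "real ^ 'n"
  shows "countable (range (cell c l k))"
proof -
  have "range (cell c l k) \<subseteq> range (\<lambda>m :: int ^ 'n. {y. \<forall>i. \<lfloor>2 ^ k * (y $ i - c $ i) / l\<rfloor> = m $ i})"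
  proof safe
    fix x
    show "cell c l k x \<in> range (\<lambda>m :: int ^ 'n. {y. \<forall>i. \<lfloor>2 ^ k * (y $ i - c $ i) / l\<rfloor> = m $ i})"
      by (rule range_eqI[where x="\<chi> i. \<lfloor>2 ^ k * (x $ i - c $ i) / l\<rfloor>"]) (simp add: cell_def)
  qed
  then show ?thesis by (rule countable_subset) simp
qed

text \<open>These are the coarsest cells with property \<open>P\<close>. Two of them through a point
  \<open>z\<close> are both the first one with \<open>P\<close> in the chain of cells at
  \<open>z\<close>, hence equal. The property stays abstract because it serves two purposes:
  averages that are too large, and cells inside an open set.\<close>

lemma stopping_cells:
  fixes P :: "(real ^ 'n) set \<Rightarrow> bool" and c :: "real ^ 'n" and l :: real
  defines "\<D> \<equiv> {cell c l k x | k x. P (cell c l k x) \<and> (\<forall>j<k. \<not> P (cell c l j x))}"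
  shows "countable \<D>" "disjoint \<D>" "\<Union>\<D> = {x. \<exists>k. P (cell c l k x)}"
proof -
  have "\<D> \<subseteq> (\<Union>k. range (cell c l k))" unfolding \<D>_def by blast
  then show "countable \<D>"
    by (rule countable_subset) (intro countable_UN countable_cells, simp)
  show "disjoint \<D>"
  proof (rule disjointI)
    fix A B assume A: "A \<in> \<D>" and B: "B \<in> \<D>" and "A \<noteq> B"
    show "A \<inter> B = {}"
    proof (rule ccontr)
      assume "A \<inter> B \<noteq> {}"
      then obtain z where zA: "z \<in> A" and zB: "z \<in> B" by blast
      have *: "\<exists>k. K = cell c l k z \<and> P (cell c l k z) \<and> (\<forall>j<k. \<not> P (cell c l j z))" if "K \<in> \<D>" "z \<in> K" for K
      proof -
        from that(1) obtain k x where kx: "K = cell c l k x" "P (cell c l k x)" "\<forall>j<k. \<not> P (cell c l j x)"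
          unfolding \<D>_def by blast
        have "cell c l j z = cell c l j x" if "j \<le> k" for j
          using cell_antimono[OF that, of c l x] \<open>z \<in> K\<close> kx(1) by (intro cell_eqI) auto
        then show ?thesis using kx by (intro exI[of _ k]) auto
      qed
      from *[OF A zA] *[OF B zB] obtain k k' where
        "A = cell c l k z" "P (cell c l k z)" "\<forall>j<k. \<not> P (cell c l j z)"
        "B = cell c l k' z" "P (cell c l k' z)" "\<forall>j<k'. \<not> P (cell c l j z)" by blast
      then show False using \<open>A \<noteq> B\<close> linorder_neqE_nat[of k k'] by blast
    qed
  qed
  show "\<Union>\<D> = {x. \<exists>k. P (cell c l k x)}"
  proof (intro subset_antisym subsetI)
    fix z assume "z \<in> \<Union>\<D>"
    then obtain k x where "z \<in> cell c l k x" "P (cell c l k x)" unfolding \<D>_def by blast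
    then have "P (cell c l k z)" using cell_eqI[of z c l k x] by simp
    then show "z \<in> {x. \<exists>k. P (cell c l k x)}" by blast
  next
    fix z assume "z \<in> {x. \<exists>k. P (cell c l k x)}"
    then have "\<exists>k. P (cell c l k z)" by simp
    then obtain k where "P (cell c l k z)" "\<forall>j<k. \<not> P (cell c l j z)"
      using exists_least_iff[of "\<lambda>k. P (cell c l k z)"] by blast
    then have "cell c l k z \<in> \<D>" unfolding \<D>_def by blast
    then show "z \<in> \<Union>\<D>" using self_in_cell by blast
  qed
qed

section \<open>Calderon-Zygmund decomposition and reverse Hoelder inequality\<close>

lemma small_cell:
  fixes x :: "real ^ 'n"
  assumes "0 < l" "open U" "x \<in> U"
  shows "\<exists>k. cell c l k x \<subseteq> U"
proof -
  obtain e where e: "e > 0" "ball x e \<subseteq> U" using openE[OF assms(2,3)] .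
  have "(\<lambda>k. real CARD('n) * l * (1 / 2) ^ k) \<longlonglongrightarrow> real CARD('n) * l * 0"
    by (intro tendsto_mult tendsto_const LIMSEQ_power_zero) simp
  then have "(\<lambda>k. real CARD('n) * (l / 2 ^ k)) \<longlonglongrightarrow> 0"
    by (simp add: power_divide)
  from order_tendstoD(2)[OF this e(1)]
  obtain k where k: "real CARD('n) * (l / 2 ^ k) < e"
    unfolding eventually_sequentially by blast
  have "cell c l k x \<subseteq> ball x e"
  proof
    fix y assume y: "y \<in> cell c l k x"
    define d where "d = (\<chi> i. c $ i + l * of_int \<lfloor>2 ^ k * (x $ i - c $ i) / l\<rfloor> / 2 ^ k)"
    have "y \<in> hcube d (l / 2 ^ k)" "x \<in> hcube d (l / 2 ^ k)"
      using y self_in_cell[of x c l k] cell_eq_hcube[OF assms(1), of c k x] by (simp_all add: d_def)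
    then have "d $ i \<le> x $ i" "x $ i < d $ i + l / 2 ^ k" "d $ i \<le> y $ i" "y $ i < d $ i + l / 2 ^ k" for i
      by (simp_all add: hcube_def)
    then have *: "\<bar>(x - y) $ i\<bar> \<le> l / 2 ^ k" for i
      unfolding vector_minus_component abs_le_iff by (smt (verit, best))
    have "norm (x - y) \<le> (\<Sum>i\<in>UNIV. \<bar>(x - y) $ i\<bar>)" by (rule norm_le_l1_cart)
    also have "\<dots> \<le> (\<Sum>i::'n\<in>UNIV. l / 2 ^ k)" by (rule sum_mono) (rule *)
    finally show "y \<in> ball x e" using k by (simp add: dist_norm)
  qed
  then show ?thesis using e(2) by blast
qed

text \<open>The selected cubes are the coarsest dyadic cells whose average exceeds \<open>t\<close>.
  The bound off their union is obtained by a covering instead of a differentiation theorem: a subset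
  \<open>S\<close> of the remainder is covered by cells that meet it, all of average at most
  \<open>t\<close>, so its mass is at most \<open>t\<close> times its measure.\<close>

lemma cz_decomposition:
  fixes c :: "real ^ 'n" and w :: "real ^ 'n \<Rightarrow> real"
  defines "\<nu> \<equiv> density lebesgue (\<lambda>x. ennreal (w x))"
  assumes w [measurable]: "w \<in> borel_measurable lebesgue" and l: "0 < l" and lam: "0 < t"
    and avg: "emeasure \<nu> (hcube c l) \<le> ennreal t * emeasure lebesgue (hcube c l)"
  obtains \<D> where "countable \<D>" "disjoint \<D>"
    "\<And>K. K \<in> \<D> \<Longrightarrow> \<exists>d m. 0 < m \<and> K = hcube d m \<and> K \<subseteq> hcube c l"
    "\<And>K. K \<in> \<D> \<Longrightarrow> ennreal t * emeasure lebesgue K \<le> emeasure \<nu> K"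
    "\<And>K. K \<in> \<D> \<Longrightarrow> emeasure \<nu> K \<le> ennreal (2 ^ CARD('n) * t) * emeasure lebesgue K"
    "AE x in lebesgue. x \<in> hcube c l - \<Union>\<D> \<longrightarrow> w x \<le> t"
proof -
  let ?Q = "hcube c l"
  define P where "P K \<longleftrightarrow> ennreal t * emeasure lebesgue K < emeasure \<nu> K \<and> K \<subseteq> ?Q" for K :: "(real ^ 'n) set"
  define \<D> where "\<D> = {cell c l k x | k x. P (cell c l k x) \<and> (\<forall>j<k. \<not> P (cell c l j x))}"
  note st = stopping_cells[where P=P and c=c and l=l, folded \<D>_def]
  have cell_meas [measurable]: "cell c l k x \<in> sets lebesgue" for k x
    by (subst cell_eq_hcube[OF l]) (rule hcube_lebesgue)
  have nu_sets: "sets \<nu> = sets lebesgue" by (simp add: \<nu>_def)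
  have D: "\<exists>k x. x \<in> ?Q \<and> K = cell c l (Suc k) x \<and> P K \<and> \<not> P (cell c l k x) \<and> cell c l k x \<subseteq> ?Q" if K: "K \<in> \<D>" for K
  proof -
    obtain k x where kx: "K = cell c l k x" "P (cell c l k x)" "\<forall>j<k. \<not> P (cell c l j x)"
      using K unfolding \<D>_def by blast
    have xQ: "x \<in> ?Q" using kx(2) self_in_cell[of x c l k] unfolding P_def by blast
    \<comment> \<open>The assumption on the average rules out generation 0, so a selected cell has a
      parent inside the cube, and this parent violates \<open>P\<close>.\<close>
    have "\<not> P (cell c l 0 x)"
      using avg unfolding cell_0[OF l xQ] P_def by (simp add: not_less)
    then obtain j where j: "k = Suc j" using kx(2) by (cases k) auto
    have "cell c l j x \<subseteq> ?Q" using cell_antimono[of 0 j c l x] cell_0[OF l xQ] by simp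
    then show ?thesis using kx xQ j by blast
  qed
  have 1: "\<exists>d m. 0 < m \<and> K = hcube d m \<and> K \<subseteq> ?Q" if "K \<in> \<D>" for K
  proof -
    obtain k x where "K = cell c l (Suc k) x" "P K" using D[OF \<open>K \<in> \<D>\<close>] by blast
    moreover have "0 < l / 2 ^ Suc k" using l by simp
    ultimately show ?thesis using cell_eq_hcube[OF l, of c "Suc k" x] unfolding P_def by blast
  qed
  have 2: "ennreal t * emeasure lebesgue K \<le> emeasure \<nu> K" if "K \<in> \<D>" for K
    using D[OF that] unfolding P_def by (auto intro: less_imp_le)
  have cell_size: "emeasure lebesgue (cell c l k x) = ennreal ((l / 2 ^ k) ^ CARD('n))" for k x
    unfolding cell_eq_hcube[OF l] using l by (subst emeasure_hcube) auto
  \<comment> \<open>Pass to the parent, whose volume is \<open>2 ^ CARD('n)\<close> times that of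
    \<open>K\<close>.\<close>
  have 3: "emeasure \<nu> K \<le> ennreal (2 ^ CARD('n) * t) * emeasure lebesgue K" if "K \<in> \<D>" for K
  proof -
    obtain k x where kx: "K = cell c l (Suc k) x" "\<not> P (cell c l k x)" "cell c l k x \<subseteq> ?Q"
      using D[OF \<open>K \<in> \<D>\<close>] by blast
    have "emeasure \<nu> K \<le> emeasure \<nu> (cell c l k x)"
      unfolding kx(1) using cell_Suc_subset by (rule emeasure_mono) (simp add: nu_sets)
    also have "\<dots> \<le> ennreal t * emeasure lebesgue (cell c l k x)"
      using kx(2,3) unfolding P_def by (simp add: not_less)
    also have "\<dots> = ennreal (2 ^ CARD('n) * t) * emeasure lebesgue K"
    proof -
      have "t * (l / 2 ^ k) ^ CARD('n) = t * (2 * (l / 2 ^ Suc k)) ^ CARD('n)" by simp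
      also have "\<dots> = 2 ^ CARD('n) * t * (l / 2 ^ Suc k) ^ CARD('n)"
        by (simp only: power_mult_distrib mult_ac)
      finally have eq: "t * (l / 2 ^ k) ^ CARD('n) = 2 ^ CARD('n) * t * (l / 2 ^ Suc k) ^ CARD('n)" .
      have p: "0 \<le> (l / 2 ^ j) ^ CARD('n)" for j using l by simp
      show ?thesis
        unfolding kx(1) cell_size by (simp only: ennreal_mult''[OF p, symmetric] eq)
    qed
    finally show ?thesis .
  qed
  have Dm [measurable]: "\<Union>\<D> \<in> sets lebesgue"
  proof (rule sets.countable_Union[OF st(1)])
    show "\<D> \<subseteq> sets lebesgue" using 1 hcube_lebesgue by blast
  qed
  define F where "F = ?Q - \<Union>\<D>"
  have F [measurable]: "F \<in> sets lebesgue" unfolding F_def by measurable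
  have cell_F: "emeasure \<nu> (cell c l k x) \<le> ennreal t * emeasure lebesgue (cell c l k x)" if "x \<in> F" for k x
  proof -
    have xQ: "x \<in> ?Q" using that by (simp add: F_def)
    have "\<not> P (cell c l k x)" using that st(3) unfolding F_def by blast
    moreover have "cell c l k x \<subseteq> ?Q" using cell_antimono[of 0 k c l x] cell_0[OF l xQ] by simp
    ultimately show ?thesis unfolding P_def by (simp add: not_less)
  qed
  have nuS: "emeasure \<nu> S \<le> ennreal t * emeasure lebesgue S" if S: "S \<subseteq> F" and Sm [measurable]: "S \<in> sets lebesgue" for S
  proof -
    \<comment> \<open>Outer regularity provides an open \<open>U\<close> slightly larger than
      \<open>S\<close>. The coarsest cells that lie in \<open>U\<close> and meet \<open>S\<close>
      are disjoint and cover \<open>S\<close>; each is the cell of one of its points in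
      \<open>F\<close>, so \<open>cell_F\<close> applies to it.\<close>
    have *: "emeasure \<nu> S \<le> ennreal t * (emeasure lebesgue S + ennreal e)" if e: "e > 0" for e
    proof -
      obtain U where U: "open U" "S \<subseteq> U" "(U - S) \<in> lmeasurable" "emeasure lebesgue (U - S) < ennreal e"
        using sets_lebesgue_outer_open[OF Sm e] .
      define R where "R K \<longleftrightarrow> K \<subseteq> U \<and> K \<inter> S \<noteq> {}" for K :: "(real ^ 'n) set"
      define \<E> where "\<E> = {cell c l k x | k x. R (cell c l k x) \<and> (\<forall>j<k. \<not> R (cell c l j x))}"
      note st' = stopping_cells[where P=R and c=c and l=l, folded \<E>_def]
      have E: "K \<subseteq> U \<and> K \<in> sets lebesgue \<and> emeasure \<nu> K \<le> ennreal t * emeasure lebesgue K" if K: "K \<in> \<E>" for K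
      proof -
        obtain k x where kx: "K = cell c l k x" "R K" using K unfolding \<E>_def by blast
        then obtain z where z: "z \<in> cell c l k x" "z \<in> S" unfolding R_def by blast
        then have "K = cell c l k z" using kx(1) cell_eqI by blast
        then show ?thesis using cell_F[of z k] z(2) S kx(2) unfolding R_def by auto
      qed
      have "S \<subseteq> \<Union>\<E>"
      proof
        fix x assume x: "x \<in> S"
        then obtain k where "cell c l k x \<subseteq> U" using small_cell[OF l U(1)] U(2) by blast
        then have "R (cell c l k x)" unfolding R_def using x self_in_cell by blast
        then show "x \<in> \<Union>\<E>" using st'(3) by blast
      qed
      have Em: "\<Union>\<E> \<in> sets lebesgue"
        by (rule sets.countable_Union[OF st'(1)]) (use E in auto)
      have dj: "disjoint_family_on (\<lambda>K. K) \<E>"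
        using st'(2) by (simp add: disjoint_family_on_def disjoint_def)
      have "emeasure \<nu> S \<le> emeasure \<nu> (\<Union>\<E>)"
        using \<open>S \<subseteq> \<Union>\<E>\<close> by (rule emeasure_mono) (use Em nu_sets in simp)
      also have "\<dots> = (\<integral>\<^sup>+K. emeasure \<nu> K \<partial>count_space \<E>)"
        using emeasure_UN_countable[of \<E> "\<lambda>K. K" \<nu>, OF _ st'(1) dj] E nu_sets by simp
      also have "\<dots> \<le> (\<integral>\<^sup>+K. ennreal t * emeasure lebesgue K \<partial>count_space \<E>)"
        by (rule nn_integral_mono) (use E in simp)
      also have "\<dots> = ennreal t * (\<integral>\<^sup>+K. emeasure lebesgue K \<partial>count_space \<E>)"
        by (rule nn_integral_cmult) simp
      also have "(\<integral>\<^sup>+K. emeasure lebesgue K \<partial>count_space \<E>) = emeasure lebesgue (\<Union>\<E>)"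
        using emeasure_UN_countable[of \<E> "\<lambda>K. K" lebesgue, OF _ st'(1) dj] E by simp
      also have "emeasure lebesgue (\<Union>\<E>) \<le> emeasure lebesgue U"
        by (rule emeasure_mono) (use E U(1) in auto)
      also have "emeasure lebesgue U \<le> emeasure lebesgue S + emeasure lebesgue (U - S)"
      proof -
        have "U = S \<union> (U - S)" using U(2) by blast
        then show ?thesis using emeasure_subadditive[of S lebesgue "U - S"] Sm U(3) by auto
      qed
      also have "\<dots> \<le> emeasure lebesgue S + ennreal e"
        using U(4) by (intro add_left_mono) simp
      finally show ?thesis by (simp add: mult_left_mono)
    qed
    show ?thesis
    proof (rule ennreal_le_epsilon)
      fix e :: real assume "0 < e"
      then show "emeasure \<nu> S \<le> ennreal t * emeasure lebesgue S + ennreal e"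
        using *[of "e / t"] lam by (simp add: distrib_left ennreal_mult[symmetric])
    qed
  qed
  \<comment> \<open>The exceptional set is split according to the gap \<open>1 / Suc m\<close>: on
    each piece the lower bound for \<open>w\<close> is compatible with \<open>nuS\<close> only if
    the measure, which is finite, vanishes.\<close>
  have null: "{x \<in> F. t + 1 / real (Suc m) \<le> w x} \<in> null_sets lebesgue" for m
  proof -
    let ?S = "{x \<in> F. t + 1 / real (Suc m) \<le> w x}"
    have Sm [measurable]: "?S \<in> sets lebesgue"
    proof -
      have "?S = F \<inter> {x \<in> space lebesgue. t + 1 / real (Suc m) \<le> w x}" by auto
      also have "\<dots> \<in> sets lebesgue" by measurable
      finally show ?thesis .
    qed
    have fin: "emeasure lebesgue ?S < \<infinity>"
    proof -
      have "emeasure lebesgue ?S \<le> emeasure lebesgue ?Q" by (rule emeasure_mono) (auto simp: F_def)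
      also have "\<dots> < \<infinity>" using l by (simp add: emeasure_hcube)
      finally show ?thesis .
    qed
    have "ennreal (t + 1 / real (Suc m)) * emeasure lebesgue ?S = (\<integral>\<^sup>+x\<in>?S. ennreal (t + 1 / real (Suc m)) \<partial>lebesgue)"
      using Sm by (simp add: nn_integral_cmult_indicator)
    also have "\<dots> \<le> (\<integral>\<^sup>+x\<in>?S. ennreal (w x) \<partial>lebesgue)"
      by (rule nn_integral_mono) (auto simp: indicator_def intro: ennreal_leI)
    also have "\<dots> = emeasure \<nu> ?S"
      unfolding \<nu>_def by (rule emeasure_density[symmetric]) (use Sm in auto)
    also have "\<dots> \<le> ennreal t * emeasure lebesgue ?S"
      by (rule nuS[OF _ Sm]) auto
    finally have le: "ennreal (t + 1 / real (Suc m)) * emeasure lebesgue ?S \<le> ennreal t * emeasure lebesgue ?S" .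
    obtain r where r: "0 \<le> r" "emeasure lebesgue ?S = ennreal r"
      using fin by (cases "emeasure lebesgue ?S") auto
    have "ennreal ((t + 1 / real (Suc m)) * r) \<le> ennreal (t * r)"
      using le unfolding r(2) by (simp only: ennreal_mult''[OF r(1)])
    moreover have "0 \<le> t * r" using lam r(1) by simp
    ultimately have "(t + 1 / real (Suc m)) * r \<le> t * r" by (simp only: ennreal_le_iff)
    then have "1 / real (Suc m) * r \<le> 0" unfolding distrib_right by linarith
    then have "r \<le> 0" by (simp only: mult_le_0_iff) auto
    then have "r = 0" using r(1) by linarith
    then show ?thesis using Sm r(2) by (simp add: null_setsI)
  qed
  have "AE x in lebesgue. x \<in> F \<longrightarrow> w x \<le> t"
  proof (rule AE_I')
    show "(\<Union>m. {x \<in> F. t + 1 / real (Suc m) \<le> w x}) \<in> null_sets lebesgue"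
      using null by (rule null_sets_UN)
    show "{x \<in> space lebesgue. \<not> (x \<in> F \<longrightarrow> w x \<le> t)} \<subseteq> (\<Union>m. {x \<in> F. t + 1 / real (Suc m) \<le> w x})"
    proof clarsimp
      fix x assume "x \<in> F" "\<not> w x \<le> t"
      then obtain m where "inverse (real (Suc m)) < w x - t" using reals_Archimedean[of "w x - t"] by auto
      then show "\<exists>m. t + 1 / (1 + real m) \<le> w x"
        by (intro exI[of _ m]) (simp add: inverse_eq_divide)
    qed
  qed
  then show thesis using that[OF st(1,2) 1 2 3] unfolding F_def by blast
qed

text \<open>Induction on the truncation level: on a stopping cube of level \<open>2 t\<close> the average is at most a multiple of \<open>2 t\<close>,
  so there the truncation level drops relative to the average; and the stopping cubes carry only a fraction of
  the mass.\<close>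

lemma reverse_holder_truncated:
  fixes w :: "real ^ 'n \<Rightarrow> real" and Q0 :: "(real ^ 'n) set"
  defines "\<nu> \<equiv> density lebesgue (\<lambda>x. ennreal (w x))"
  assumes w [measurable]: "w \<in> borel_measurable lebesgue" and wnn: "\<And>x. 0 \<le> w x"
    and \<delta>: "0 < \<delta>" "\<delta> < 1"
    and sub: "\<And>d m E. 0 < m \<Longrightarrow> hcube d m \<subseteq> Q0 \<Longrightarrow> E \<in> sets lebesgue \<Longrightarrow> E \<subseteq> hcube d m \<Longrightarrow>
      emeasure lebesgue (hcube d m) \<le> 2 * emeasure lebesgue E \<Longrightarrow>
      ennreal \<delta> * emeasure \<nu> (hcube d m) \<le> emeasure \<nu> E"
    and \<epsilon>: "0 < \<epsilon>" and A: "1 \<le> A" "2 powr \<epsilon> + A * (2 ^ (CARD('n) + 1)) powr \<epsilon> * (1 - \<delta>) \<le> A"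
  shows "0 < m \<Longrightarrow> hcube d m \<subseteq> Q0 \<Longrightarrow> 0 < t \<Longrightarrow>
    emeasure \<nu> (hcube d m) \<le> ennreal t * emeasure lebesgue (hcube d m) \<Longrightarrow>
    (\<integral>\<^sup>+x\<in>hcube d m. ennreal (min (w x) (2 ^ k * t) powr \<epsilon> * w x) \<partial>lebesgue)
      \<le> ennreal (A * t powr \<epsilon>) * emeasure \<nu> (hcube d m)"
proof (induction k arbitrary: d m t)
  case 0
  have "(\<integral>\<^sup>+x\<in>hcube d m. ennreal (min (w x) (2 ^ 0 * t) powr \<epsilon> * w x) \<partial>lebesgue)
    \<le> (\<integral>\<^sup>+x. ennreal (A * t powr \<epsilon>) * (ennreal (w x) * indicator (hcube d m) x) \<partial>lebesgue)"
  proof (rule nn_integral_mono)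
    fix x
    have "min (w x) t powr \<epsilon> \<le> 1 * t powr \<epsilon>"
      using wnn[of x] 0 \<epsilon> by (auto intro!: powr_mono2)
    also have "\<dots> \<le> A * t powr \<epsilon>" using A by (intro mult_right_mono) auto
    finally have "min (w x) t powr \<epsilon> * w x \<le> A * t powr \<epsilon> * w x"
      using wnn[of x] by (rule mult_right_mono)
    then have "ennreal (min (w x) (2 ^ 0 * t) powr \<epsilon> * w x) \<le> ennreal (A * t powr \<epsilon>) * ennreal (w x)"
      unfolding ennreal_mult''[OF wnn, symmetric] by (simp add: ennreal_leI)
    then show "ennreal (min (w x) (2 ^ 0 * t) powr \<epsilon> * w x) * indicator (hcube d m) x
      \<le> ennreal (A * t powr \<epsilon>) * (ennreal (w x) * indicator (hcube d m) x)"
      by (simp add: indicator_def)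
  qed
  also have "\<dots> = ennreal (A * t powr \<epsilon>) * emeasure \<nu> (hcube d m)"
    unfolding \<nu>_def by (subst nn_integral_cmult) (simp_all add: emeasure_density)
  finally show ?case .
next
  case (Suc k)
  let ?Q = "hcube d m"
  have nu_sets: "sets \<nu> = sets lebesgue" by (simp add: \<nu>_def)
  \<comment> \<open>Stopping at \<open>2 * t\<close>, twice the bound for the average, forces
    \<open>2 * t * vU \<le> nU \<le> nQ \<le> t * vQ\<close>. The stopping cubes therefore fill at
    most half of the cube, and \<open>sub\<close> applies to the rest.\<close>
  have "emeasure \<nu> ?Q \<le> ennreal (2 * t) * emeasure lebesgue ?Q"
    using Suc.prems(4) by (rule order_trans) (use Suc.prems(3) in \<open>auto intro!: mult_right_mono ennreal_leI\<close>)
  from cz_decomposition[OF w Suc.prems(1) _ this[unfolded \<nu>_def]] Suc.prems(3)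
  obtain \<D> where D: "countable \<D>" "disjoint \<D>"
    "\<And>K. K \<in> \<D> \<Longrightarrow> \<exists>d m. 0 < m \<and> K = hcube d m \<and> K \<subseteq> ?Q"
    "\<And>K. K \<in> \<D> \<Longrightarrow> ennreal (2 * t) * emeasure lebesgue K \<le> emeasure \<nu> K"
    "\<And>K. K \<in> \<D> \<Longrightarrow> emeasure \<nu> K \<le> ennreal (2 ^ CARD('n) * (2 * t)) * emeasure lebesgue K"
    "AE x in lebesgue. x \<in> ?Q - \<Union>\<D> \<longrightarrow> w x \<le> 2 * t"
    unfolding \<nu>_def by auto
  have Ds: "K \<in> sets lebesgue" if "K \<in> \<D>" for K
    using D(3)[OF that] hcube_lebesgue by blast
  define U where "U = \<Union>\<D>"
  define F where "F = ?Q - U"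
  have U [measurable]: "U \<in> sets lebesgue"
    unfolding U_def by (rule sets.countable_Union[OF D(1)]) (use Ds in blast)
  have F [measurable]: "F \<in> sets lebesgue" unfolding F_def by measurable
  have UQ: "U \<subseteq> ?Q" unfolding U_def using D(3) by blast
  have QFU: "?Q = F \<union> U" "F \<inter> U = {}" unfolding F_def using UQ by blast+
  have dj: "disjoint_family_on (\<lambda>K. K) \<D>"
    using D(2) by (simp add: disjoint_family_on_def disjoint_def)
  have sum_D: "emeasure M U = (\<integral>\<^sup>+K. emeasure M K \<partial>count_space \<D>)" if "sets M = sets lebesgue" for M
    using emeasure_UN_countable[of \<D> "\<lambda>K. K" M, OF _ D(1) dj] Ds that unfolding U_def by simp
  obtain vQ where vQ: "0 \<le> vQ" "emeasure lebesgue ?Q = ennreal vQ"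
    using emeasure_hcube[of m d] Suc.prems(1) by (metis less_imp_le zero_le_power)
  have "emeasure \<nu> ?Q < \<infinity>"
    using Suc.prems(4) unfolding vQ(2) by (rule order.strict_trans1) (simp add: ennreal_mult_less_top)
  then obtain nQ where nQ: "0 \<le> nQ" "emeasure \<nu> ?Q = ennreal nQ" by (cases "emeasure \<nu> ?Q") auto
  have "emeasure \<nu> U \<le> ennreal nQ" unfolding nQ(2)[symmetric] using UQ by (rule emeasure_mono) (simp add: nu_sets)
  then obtain nU where nU: "0 \<le> nU" "emeasure \<nu> U = ennreal nU" "nU \<le> nQ"
    using nQ(1) by (cases "emeasure \<nu> U") (auto simp: ennreal_le_iff top_unique)
  have "emeasure \<nu> F \<le> ennreal nQ" unfolding nQ(2)[symmetric] by (rule emeasure_mono) (auto simp: nu_sets F_def)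
  then obtain nF where nF: "0 \<le> nF" "emeasure \<nu> F = ennreal nF" "nF \<le> nQ"
    using nQ(1) by (cases "emeasure \<nu> F") (auto simp: ennreal_le_iff top_unique)
  have "emeasure lebesgue U \<le> ennreal vQ" unfolding vQ(2)[symmetric] using UQ by (rule emeasure_mono) simp
  then obtain vU where vU: "0 \<le> vU" "emeasure lebesgue U = ennreal vU"
    using vQ(1) by (cases "emeasure lebesgue U") (auto simp: top_unique)
  have "emeasure lebesgue F \<le> ennreal vQ" unfolding vQ(2)[symmetric] by (rule emeasure_mono) (auto simp: F_def)
  then obtain vF where vF: "0 \<le> vF" "emeasure lebesgue F = ennreal vF"
    using vQ(1) by (cases "emeasure lebesgue F") (auto simp: top_unique)
  have nsum: "nQ = nF + nU"
  proof -
    have "emeasure \<nu> ?Q = emeasure \<nu> F + emeasure \<nu> U"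
      by (subst QFU(1), rule plus_emeasure[symmetric]) (simp_all add: nu_sets QFU(2))
    then show ?thesis unfolding nQ(2) nF(2) nU(2) using nF(1) nU(1) nQ(1) by (simp add: ennreal_plus[symmetric] del: ennreal_plus)
  qed
  have vsum: "vQ = vF + vU"
  proof -
    have "emeasure lebesgue ?Q = emeasure lebesgue F + emeasure lebesgue U"
      by (subst QFU(1), rule plus_emeasure[symmetric]) (simp_all add: QFU(2))
    then show ?thesis unfolding vQ(2) vF(2) vU(2) using vF(1) vU(1) vQ(1) by (simp add: ennreal_plus[symmetric] del: ennreal_plus)
  qed
  have "ennreal (2 * t) * emeasure lebesgue U \<le> emeasure \<nu> U"
  proof -
    have "ennreal (2 * t) * emeasure lebesgue U = (\<integral>\<^sup>+K. ennreal (2 * t) * emeasure lebesgue K \<partial>count_space \<D>)"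
      by (subst sum_D[OF refl], rule nn_integral_cmult[symmetric]) simp
    also have "\<dots> \<le> (\<integral>\<^sup>+K. emeasure \<nu> K \<partial>count_space \<D>)"
      by (rule nn_integral_mono) (use D(4) in simp)
    also have "\<dots> = emeasure \<nu> U" by (rule sum_D[OF nu_sets, symmetric])
    finally show ?thesis .
  qed
  then have "2 * t * vU \<le> nU"
    unfolding vU(2) nU(2) ennreal_mult''[OF vU(1), symmetric] using nU(1) by (simp only: ennreal_le_iff)
  moreover have "nQ \<le> t * vQ"
    using Suc.prems(3,4) vQ(1) unfolding vQ(2) nQ(2) ennreal_mult''[OF vQ(1), symmetric] by (simp add: ennreal_le_iff)
  ultimately have "t * (2 * vU) \<le> t * vQ" using nU(3) by (simp add: mult_ac)
  then have "2 * vU \<le> vQ" using Suc.prems(3) by simp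
  then have "vQ \<le> 2 * vF" using vsum by linarith
  then have "emeasure lebesgue ?Q \<le> 2 * emeasure lebesgue F"
    unfolding vQ(2) vF(2) using ennreal_leI[of vQ "2 * vF"] ennreal_mult''[OF vF(1), of 2]
    by (simp only: ennreal_numeral)
  then have "ennreal \<delta> * emeasure \<nu> ?Q \<le> emeasure \<nu> F"
    by (intro sub[OF Suc.prems(1,2)]) (auto simp: F_def)
  then have dn: "\<delta> * nQ \<le> nF"
    unfolding nQ(2) nF(2) ennreal_mult''[OF nQ(1), symmetric] using nF(1) by (simp only: ennreal_le_iff)
  define g where "g x = ennreal (min (w x) (2 ^ Suc k * t) powr \<epsilon> * w x)" for x
  have g [measurable]: "g \<in> borel_measurable lebesgue" unfolding g_def by measurable
  define \<mu> where "\<mu> = density lebesgue g"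
  have mu_sets: "sets \<mu> = sets lebesgue" by (simp add: \<mu>_def)
  have mu: "emeasure \<mu> S = (\<integral>\<^sup>+x\<in>S. g x \<partial>lebesgue)" if "S \<in> sets lebesgue" for S
    unfolding \<mu>_def using that by (simp add: emeasure_density)
  \<comment> \<open>The induction hypothesis on \<open>K\<close> is used with the level
    \<open>2 ^ CARD('n) * (2 * t)\<close>, which bounds the average there. With one truncation step
    less it still cuts no lower, since
    \<open>2 ^ Suc k * t \<le> 2 ^ k * (2 ^ CARD('n) * (2 * t))\<close>.\<close>
  let ?c = "A * (2 ^ CARD('n) * (2 * t)) powr \<epsilon>"
  have mu_K: "emeasure \<mu> K \<le> ennreal ?c * emeasure \<nu> K" if K: "K \<in> \<D>" for K
  proof -
    obtain d' m' where K': "0 < m'" "K = hcube d' m'" "K \<subseteq> ?Q" using D(3)[OF K] by blast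
    have "emeasure \<mu> K \<le> (\<integral>\<^sup>+x\<in>K. ennreal (min (w x) (2 ^ k * (2 ^ CARD('n) * (2 * t))) powr \<epsilon> * w x) \<partial>lebesgue)"
      unfolding mu[OF Ds[OF K]]
    proof (rule nn_integral_mono)
      fix x
      have "2 ^ Suc k * t * 1 \<le> 2 ^ Suc k * t * 2 ^ CARD('n)"
        using Suc.prems(3) by (intro mult_left_mono) auto
      then have "2 ^ Suc k * t \<le> 2 ^ k * (2 ^ CARD('n) * (2 * t))" by (simp add: mult_ac)
      then have le: "min (w x) (2 ^ Suc k * t) \<le> min (w x) (2 ^ k * (2 ^ CARD('n) * (2 * t)))"
        by (rule min.mono[OF order_refl])
      have "0 \<le> min (w x) (2 ^ Suc k * t)" using wnn[of x] Suc.prems(3) by simp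
      then have "min (w x) (2 ^ Suc k * t) powr \<epsilon> * w x \<le> min (w x) (2 ^ k * (2 ^ CARD('n) * (2 * t))) powr \<epsilon> * w x"
        using le by (rule mult_right_mono[OF powr_mono2[OF less_imp_le[OF \<epsilon>]] wnn])
      then show "g x * indicator K x \<le> ennreal (min (w x) (2 ^ k * (2 ^ CARD('n) * (2 * t))) powr \<epsilon> * w x) * indicator K x"
        unfolding g_def by (rule mult_right_mono[OF ennreal_leI]) simp
    qed
    also have "\<dots> \<le> ennreal ?c * emeasure \<nu> K"
      unfolding K'(2) by (rule Suc.IH) (use K' Suc.prems D(5)[OF K] in auto)
    finally show ?thesis .
  qed
  have c: "0 \<le> ?c" using A by simp
  have "emeasure \<mu> U = (\<integral>\<^sup>+K. emeasure \<mu> K \<partial>count_space \<D>)" by (rule sum_D[OF mu_sets])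
  also have "\<dots> \<le> (\<integral>\<^sup>+K. ennreal ?c * emeasure \<nu> K \<partial>count_space \<D>)"
    by (rule nn_integral_mono) (use mu_K in simp)
  also have "\<dots> = ennreal ?c * emeasure \<nu> U"
    by (subst sum_D[OF nu_sets], rule nn_integral_cmult) simp
  also have "\<dots> = ennreal (?c * nU)" unfolding nU(2) by (rule ennreal_mult''[OF nU(1), symmetric])
  finally have muU: "emeasure \<mu> U \<le> ennreal (?c * nU)" .
  have "emeasure \<mu> F \<le> (\<integral>\<^sup>+x. ennreal ((2 * t) powr \<epsilon>) * (ennreal (w x) * indicator F x) \<partial>lebesgue)"
    unfolding mu[OF F]
  proof (rule nn_integral_mono_AE)
    show "AE x in lebesgue. g x * indicator F x \<le> ennreal ((2 * t) powr \<epsilon>) * (ennreal (w x) * indicator F x)"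
      using D(6)
    proof eventually_elim
      case (elim x)
      show ?case
      proof (cases "x \<in> F")
        case True
        then have "w x \<le> 2 * t" using elim by (simp add: F_def U_def)
        then have "min (w x) (2 ^ Suc k * t) powr \<epsilon> * w x \<le> (2 * t) powr \<epsilon> * w x"
          using wnn[of x] Suc.prems(3) \<epsilon> by (intro mult_right_mono powr_mono2) auto
        then show ?thesis using True unfolding g_def ennreal_mult''[OF wnn, symmetric] by (simp add: ennreal_leI ennreal_mult''[OF wnn, symmetric])
      qed simp
    qed
  qed
  also have "\<dots> = ennreal ((2 * t) powr \<epsilon>) * emeasure \<nu> F"
    unfolding \<nu>_def by (subst nn_integral_cmult) (simp_all add: emeasure_density)
  also have "\<dots> \<le> ennreal ((2 * t) powr \<epsilon> * nQ)"
    unfolding nF(2) ennreal_mult''[OF nF(1), symmetric] using nF(3) by (intro ennreal_leI mult_left_mono) auto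
  finally have muF: "emeasure \<mu> F \<le> ennreal ((2 * t) powr \<epsilon> * nQ)" .
  have "(\<integral>\<^sup>+x\<in>?Q. g x \<partial>lebesgue) = emeasure \<mu> ?Q" by (rule mu[symmetric]) simp
  also have "\<dots> = emeasure \<mu> F + emeasure \<mu> U"
    by (subst QFU(1), rule plus_emeasure[symmetric]) (simp_all add: mu_sets QFU(2))
  also have "\<dots> \<le> ennreal ((2 * t) powr \<epsilon> * nQ) + ennreal (?c * nU)" by (rule add_mono[OF muF muU])
  also have "\<dots> = ennreal ((2 * t) powr \<epsilon> * nQ + ?c * nU)"
    using nQ(1) nU(1) c by (intro ennreal_plus[symmetric]) auto
  also have "\<dots> \<le> ennreal (A * t powr \<epsilon> * nQ)"
  proof (rule ennreal_leI)
    \<comment> \<open>The factor \<open>1 - \<delta>\<close> lets the constant reproduce itself: the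
      total becomes \<open>t powr \<epsilon> * nQ\<close> times the left side of the second
      hypothesis on \<open>A\<close>.\<close>
    have "nU \<le> (1 - \<delta>) * nQ" using dn nsum by (simp add: left_diff_distrib)
    then have le: "?c * nU \<le> ?c * ((1 - \<delta>) * nQ)" using c by (rule mult_left_mono)
    have ceq: "?c = t powr \<epsilon> * (A * (2 ^ (CARD('n) + 1)) powr \<epsilon>)"
    proof -
      have "2 ^ CARD('n) * (2 * t) = t * 2 ^ (CARD('n) + 1)" by simp
      then show ?thesis using Suc.prems(3) by (simp only: powr_mult) (simp only: mult_ac)
    qed
    have "(2 * t) powr \<epsilon> * nQ + ?c * nU \<le> (2 * t) powr \<epsilon> * nQ + t powr \<epsilon> * (A * (2 ^ (CARD('n) + 1)) powr \<epsilon>) * ((1 - \<delta>) * nQ)"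
      using le unfolding ceq by (rule add_left_mono)
    also have "\<dots> = t powr \<epsilon> * nQ * (2 powr \<epsilon> + A * (2 ^ (CARD('n) + 1)) powr \<epsilon> * (1 - \<delta>))"
      using Suc.prems(3) by (simp add: powr_mult algebra_simps)
    also have "\<dots> \<le> t powr \<epsilon> * nQ * A" using A(2) nQ(1) by (intro mult_left_mono) auto
    finally show "(2 * t) powr \<epsilon> * nQ + ?c * nU \<le> A * t powr \<epsilon> * nQ" by (simp add: mult_ac)
  qed
  also have "\<dots> = ennreal (A * t powr \<epsilon>) * emeasure \<nu> ?Q"
    unfolding nQ(2) by (rule ennreal_mult''[OF nQ(1)])
  finally show ?case unfolding g_def .
qed

text \<open>The truncation is removed by monotone convergence. \<open>\<epsilon>0\<close> and
  \<open>A\<close> depend only on \<open>\<delta>\<close> and the dimension, hence are common to all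
  weights and cubes. \<open>B\<close> may be any bound of the mass, and
  \<open>B / l ^ CARD('n)\<close> then bounds the average.\<close>

lemma reverse_holder:
  assumes \<delta>: "0 < \<delta>" "\<delta> < 1"
  obtains \<epsilon>0 A where "0 < \<epsilon>0" "0 < A"
    "\<And>(w :: real ^ 'n \<Rightarrow> real) c l B \<epsilon>. \<lbrakk>w \<in> borel_measurable lebesgue; \<And>x. 0 \<le> w x; 0 < l; 0 < B; 0 < \<epsilon>; \<epsilon> \<le> \<epsilon>0;
      (\<integral>\<^sup>+x\<in>hcube c l. ennreal (w x) \<partial>lebesgue) \<le> ennreal B;
      \<And>d m E. \<lbrakk>0 < m; hcube d m \<subseteq> hcube c l; E \<in> sets lebesgue; E \<subseteq> hcube d m;
        emeasure lebesgue (hcube d m) \<le> 2 * emeasure lebesgue E\<rbrakk> \<Longrightarrow>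
        ennreal \<delta> * (\<integral>\<^sup>+x\<in>hcube d m. ennreal (w x) \<partial>lebesgue) \<le> (\<integral>\<^sup>+x\<in>E. ennreal (w x) \<partial>lebesgue)\<rbrakk> \<Longrightarrow>
      (\<integral>\<^sup>+x\<in>hcube c l. ennreal (w x powr (1 + \<epsilon>)) \<partial>lebesgue) \<le> ennreal (A * (B / l ^ CARD('n)) powr \<epsilon> * B)"
proof -
  define N :: real where "N = 2 ^ (CARD('n) + 1)"
  have N: "1 < N" unfolding N_def by (rule one_less_power) auto
  \<comment> \<open>Chosen so that
    \<open>N powr \<epsilon>0 * (1 - \<delta>) = 1 - \<delta> / 2\<close>. The remaining
    \<open>A * (\<delta> / 2)\<close> has to pay for \<open>2 powr \<epsilon>\<close>, which fixes
    \<open>A\<close>.\<close>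
  define \<rho> where "\<rho> = (1 - \<delta> / 2) / (1 - \<delta>)"
  have \<rho>: "1 < \<rho>" using \<delta> by (simp add: \<rho>_def)
  define \<epsilon>0 where "\<epsilon>0 = log N \<rho>"
  have \<epsilon>0: "0 < \<epsilon>0" using N \<rho> by (simp add: \<epsilon>0_def)
  define A where "A = 2 * 2 powr \<epsilon>0 / \<delta>"
  have "1 \<le> 2 powr \<epsilon>0" using \<epsilon>0 by (simp add: ge_one_powr_ge_zero)
  then have A: "1 \<le> A" using \<delta> by (simp add: A_def field_simps)
  have small: "2 powr \<epsilon> + A * N powr \<epsilon> * (1 - \<delta>) \<le> A" if "0 < \<epsilon>" "\<epsilon> \<le> \<epsilon>0" for \<epsilon>
  proof -
    have "N powr \<epsilon> \<le> N powr \<epsilon>0" using N that by (intro powr_mono) auto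
    also have "\<dots> = \<rho>" using N \<rho> by (simp add: \<epsilon>0_def)
    finally have "N powr \<epsilon> * (1 - \<delta>) \<le> \<rho> * (1 - \<delta>)" using \<delta> by (intro mult_right_mono) auto
    also have "\<dots> = 1 - \<delta> / 2" using \<delta> by (simp add: \<rho>_def)
    finally have "A * (N powr \<epsilon> * (1 - \<delta>)) \<le> A * (1 - \<delta> / 2)" using A by (intro mult_left_mono) auto
    moreover have "2 powr \<epsilon> \<le> 2 powr \<epsilon>0" using that by simp
    moreover have "2 powr \<epsilon>0 = A * (\<delta> / 2)" using \<delta> by (simp add: A_def)
    ultimately show ?thesis by (simp add: algebra_simps)
  qed
  show thesis
  proof (rule that[OF \<epsilon>0, of A])
    show "0 < A" using A by simp
    fix w :: "real ^ 'n \<Rightarrow> real" and c :: "real ^ 'n" and l B \<epsilon> :: real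
    assume w [measurable]: "w \<in> borel_measurable lebesgue" and wnn: "\<And>x. 0 \<le> w x" and l: "0 < l" and B: "0 < B"
      and eps: "0 < \<epsilon>" "\<epsilon> \<le> \<epsilon>0"
      and bd: "(\<integral>\<^sup>+x\<in>hcube c l. ennreal (w x) \<partial>lebesgue) \<le> ennreal B"
      and sub: "\<And>d m E. \<lbrakk>0 < m; hcube d m \<subseteq> hcube c l; E \<in> sets lebesgue; E \<subseteq> hcube d m;
        emeasure lebesgue (hcube d m) \<le> 2 * emeasure lebesgue E\<rbrakk> \<Longrightarrow>
        ennreal \<delta> * (\<integral>\<^sup>+x\<in>hcube d m. ennreal (w x) \<partial>lebesgue) \<le> (\<integral>\<^sup>+x\<in>E. ennreal (w x) \<partial>lebesgue)"
    let ?Q = "hcube c l"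
    define t where "t = B / l ^ CARD('n)"
    have t: "0 < t" using B l by (simp add: t_def)
    define g where "g k x = ennreal (min (w x) (2 ^ k * t) powr \<epsilon> * w x) * indicator ?Q x" for k x
    have [measurable]: "g k \<in> borel_measurable lebesgue" for k unfolding g_def by measurable
    have dens: "emeasure (density lebesgue (\<lambda>x. ennreal (w x))) S = (\<integral>\<^sup>+x\<in>S. ennreal (w x) \<partial>lebesgue)" if "S \<in> sets lebesgue" for S
      using that by (simp add: emeasure_density)
    have tQ: "ennreal t * emeasure lebesgue ?Q = ennreal B"
      using l t by (simp add: emeasure_hcube ennreal_mult[symmetric]) (simp add: t_def)
    have step: "(\<integral>\<^sup>+x. g k x \<partial>lebesgue) \<le> ennreal (A * t powr \<epsilon> * B)" for k
    proof -
      have "(\<integral>\<^sup>+x. g k x \<partial>lebesgue) \<le> ennreal (A * t powr \<epsilon>) * emeasure (density lebesgue (\<lambda>x. ennreal (w x))) ?Q"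
        unfolding g_def
      proof (rule reverse_holder_truncated[OF w wnn \<delta> _ eps(1) A small[OF eps, unfolded N_def] l order_refl t])
        show "emeasure (density lebesgue (\<lambda>x. ennreal (w x))) ?Q \<le> ennreal t * emeasure lebesgue ?Q"
          unfolding tQ using bd by (simp add: dens)
      next
        fix d m E
        assume h: "0 < m" "hcube d m \<subseteq> ?Q" "E \<in> sets lebesgue" "E \<subseteq> hcube d m"
          "emeasure lebesgue (hcube d m) \<le> 2 * emeasure lebesgue E"
        show "ennreal \<delta> * emeasure (density lebesgue (\<lambda>x. ennreal (w x))) (hcube d m)
          \<le> emeasure (density lebesgue (\<lambda>x. ennreal (w x))) E"
          using sub[OF h] h(3) by (simp add: dens)
      qed
      also have "\<dots> \<le> ennreal (A * t powr \<epsilon>) * ennreal B"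
        using bd by (intro mult_left_mono) (auto simp: dens)
      also have "\<dots> = ennreal (A * t powr \<epsilon> * B)" using B by (intro ennreal_mult''[symmetric]) simp
      finally show ?thesis .
    qed
    have inc: "incseq g"
      unfolding incseq_def le_fun_def g_def
    proof (intro allI impI mult_right_mono ennreal_leI powr_mono2)
      fix m n :: nat and x assume "m \<le> n"
      then have "2 ^ m * t \<le> 2 ^ n * t" using t by (intro mult_right_mono power_increasing) auto
      then show "min (w x) (2 ^ m * t) \<le> min (w x) (2 ^ n * t)" by (intro min.mono) auto
    qed (use eps wnn t in auto)
    have "(\<integral>\<^sup>+x\<in>?Q. ennreal (w x powr (1 + \<epsilon>)) \<partial>lebesgue) \<le> (\<integral>\<^sup>+x. (SUP k. g k x) \<partial>lebesgue)"
    proof (rule nn_integral_mono)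
      fix x
      obtain k where "w x / t < 2 ^ k" using real_arch_pow[of 2 "w x / t"] by auto
      then have "w x \<le> 2 ^ k * t" using t by (simp add: field_simps)
      then have "ennreal (w x powr (1 + \<epsilon>)) * indicator ?Q x = g k x"
        unfolding g_def using wnn[of x] by (simp add: powr_add powr_one mult_ac min_absorb1)
      also have "\<dots> \<le> (SUP k. g k x)" by (rule SUP_upper) simp
      finally show "ennreal (w x powr (1 + \<epsilon>)) * indicator ?Q x \<le> (SUP k. g k x)" .
    qed
    also have "\<dots> = (SUP k. \<integral>\<^sup>+x. g k x \<partial>lebesgue)"
      by (rule nn_integral_monotone_convergence_SUP[OF inc]) simp
    also have "\<dots> \<le> ennreal (A * t powr \<epsilon> * B)" by (rule SUP_least) (rule step)
    finally show "(\<integral>\<^sup>+x\<in>?Q. ennreal (w x powr (1 + \<epsilon>)) \<partial>lebesgue) \<le> ennreal (A * (B / l ^ CARD('n)) powr \<epsilon> * B)"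
      unfolding t_def .
  qed
qed

section \<open>From averages over cubes to the maximal operator\<close>

definition cube :: "real ^ 'n \<Rightarrow> real \<Rightarrow> (real ^ 'n) set" where
  "cube c l = cbox c (\<chi> i. c $ i + l)"

text \<open>In other terms, \<open>\<Phi> x t / t powr c\<close> increases and
  \<open>\<Phi> x t / t powr d\<close> decreases in \<open>t\<close>; the form with
  \<open>\<theta>\<close> avoids dividing at 0, and \<open>\<theta> = 0\<close> contains
  \<open>\<Phi> x 0 = 0\<close>.\<close>

definition growth :: "('a \<Rightarrow> real \<Rightarrow> real) \<Rightarrow> real \<Rightarrow> real \<Rightarrow> bool" where
  "growth \<Phi> c d \<longleftrightarrow> 0 < c \<and> 0 < d \<and> (\<forall>x t. 0 \<le> t \<longrightarrow> 0 \<le> \<Phi> x t) \<and> (\<forall>x. 0 < \<Phi> x 1) \<and>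
    (\<forall>x t \<theta>. 0 \<le> t \<longrightarrow> 0 \<le> \<theta> \<longrightarrow> \<theta> \<le> 1 \<longrightarrow>
      \<Phi> x (\<theta> * t) \<le> \<theta> powr c * \<Phi> x t \<and> \<theta> powr d * \<Phi> x t \<le> \<Phi> x (\<theta> * t))"

text \<open>The consequence of the classical Caratheodory conditions that matters here:
  superposition with a nonnegative measurable function stays measurable.\<close>

definition caratheodory :: "(real ^ 'n \<Rightarrow> real \<Rightarrow> real) \<Rightarrow> bool" where
  "caratheodory \<Phi> \<longleftrightarrow> (\<forall>u\<in>borel_measurable lebesgue. (\<forall>x. 0 \<le> u x) \<longrightarrow> (\<lambda>x. \<Phi> x (u x)) \<in> borel_measurable lebesgue)"

text \<open>\<open>A\<close> is the average of \<open>h\<close> over the cube; its existence also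
  asserts that the integral is finite. The estimate is Jensen's inequality up to a constant, for an
  integrand that varies with \<open>x\<close>.\<close>

definition averaging :: "(real ^ 'n \<Rightarrow> real \<Rightarrow> real) \<Rightarrow> real \<Rightarrow> bool" where
  "averaging \<Phi> C \<longleftrightarrow> (\<forall>c l. \<forall>h\<in>borel_measurable lebesgue. 0 < l \<longrightarrow> (\<forall>x. 0 \<le> h x) \<longrightarrow>
    (\<integral>\<^sup>+x\<in>cube c l. ennreal (\<Phi> x (h x)) \<partial>lebesgue) \<le> 1 \<longrightarrow>
    (\<exists>A\<ge>0. (\<integral>\<^sup>+x\<in>cube c l. ennreal (h x) \<partial>lebesgue) = ennreal (A * l ^ CARD('n)) \<and>
      (\<integral>\<^sup>+x\<in>cube c l. ennreal (\<Phi> x A) \<partial>lebesgue) \<le> ennreal C * (\<integral>\<^sup>+x\<in>cube c l. ennreal (\<Phi> x (h x)) \<partial>lebesgue)))"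

section \<open>Closed cubes and elementary consequences of the growth condition\<close>

lemma cube_lebesgue [measurable]: "cube c l \<in> sets lebesgue"
  by (simp add: cube_def)

lemma mem_cube: "x \<in> cube c l \<longleftrightarrow> (\<forall>i. c $ i \<le> x $ i \<and> x $ i \<le> c $ i + l)"
  by (simp add: cube_def mem_box_cart)

lemma emeasure_cube: "0 \<le> l \<Longrightarrow> emeasure lebesgue (cube (c :: real ^ 'n) l) = ennreal (l ^ CARD('n))"
  unfolding cube_def by (rule emeasure_cbox_cube)

lemma cubes_eq: "cubes = {cube c l | c l. 0 < l}"
  by (simp add: cubes_def cube_def)

lemma growth_nonneg: "growth \<Phi> c d \<Longrightarrow> 0 \<le> t \<Longrightarrow> 0 \<le> \<Phi> x t"
  by (simp add: growth_def)

lemma growth_lower: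
  assumes "growth \<Phi> c d" "0 \<le> t" "0 \<le> \<theta>" "\<theta> \<le> 1"
  shows "\<Phi> x (\<theta> * t) \<le> \<theta> powr c * \<Phi> x t" "\<theta> powr d * \<Phi> x t \<le> \<Phi> x (\<theta> * t)"
  using assms by (simp_all add: growth_def)

lemma growth_zero:
  assumes "growth \<Phi> c d" shows "\<Phi> x 0 = 0"
  using growth_lower(1)[OF assms, of 0 0 x] growth_nonneg[OF assms, of 0 x] by simp

lemma growth_mono:
  assumes g: "growth \<Phi> c d" and st: "0 \<le> s" "s \<le> t"
  shows "\<Phi> x s \<le> \<Phi> x t"
proof (cases "t = 0")
  case False
  then have t: "0 < t" using st by simp
  have "\<Phi> x (s / t * t) \<le> (s / t) powr c * \<Phi> x t"
    using st t by (intro growth_lower(1)[OF g]) auto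
  also have "\<dots> \<le> 1 * \<Phi> x t"
    using st t g by (intro mult_right_mono powr_le1) (auto simp: growth_def)
  finally show ?thesis using t by simp
qed (use st in simp)

lemma growth_upper:
  assumes g: "growth \<Phi> c d" and "0 \<le> t" and K: "1 \<le> K"
  shows "\<Phi> x (K * t) \<le> K powr d * \<Phi> x t" "K powr c * \<Phi> x t \<le> \<Phi> x (K * t)"
proof -
  have K1: "(1 / K) powr e = 1 / K powr e" for e using K by (simp add: powr_divide)
  have *: "0 \<le> K * t" "0 \<le> 1 / K" "1 / K \<le> 1" using assms by auto
  have e: "1 / K * (K * t) = t" using K by simp
  have p: "0 < K powr e" for e using K by simp
  show "\<Phi> x (K * t) \<le> K powr d * \<Phi> x t"
    using growth_lower(2)[OF g *, of x] p[of d] unfolding e K1 by (simp add: field_simps)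
  show "K powr c * \<Phi> x t \<le> \<Phi> x (K * t)"
    using growth_lower(1)[OF g *, of x] p[of c] unfolding e K1 by (simp add: field_simps)
qed

lemma caratheodoryD:
  "caratheodory \<Phi> \<Longrightarrow> u \<in> borel_measurable lebesgue \<Longrightarrow> (\<And>x. 0 \<le> u x) \<Longrightarrow> (\<lambda>x. \<Phi> x (u x)) \<in> borel_measurable lebesgue"
  unfolding caratheodory_def by blast

section \<open>Level sets and measurability of the maximal function\<close>

lemma less_divide_cube_iff:
  fixes c :: "real ^ 'n"
  assumes "0 < l" "0 \<le> t"
  shows "ennreal t < I / emeasure lebesgue (cube c l) \<longleftrightarrow> ennreal (t * l ^ CARD('n)) < I"
proof -
  have p: "0 < l ^ CARD('n)" using assms by simp
  show ?thesis
  proof (cases I)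
    case (real r)
    then show ?thesis using assms p
      by (simp add: emeasure_cube divide_ennreal ennreal_less_iff field_simps)
  next
    case top
    then show ?thesis using assms p
      by (simp add: emeasure_cube ennreal_top_divide)
  qed
qed

lemma less_maximal_iff:
  fixes f :: "real ^ 'n \<Rightarrow> real"
  assumes "0 \<le> t"
  shows "ennreal t < maximal f x \<longleftrightarrow>
    (\<exists>c l. 0 < l \<and> x \<in> cube c l \<and> ennreal (t * l ^ CARD('n)) < (\<integral>\<^sup>+y\<in>cube c l. ennreal \<bar>f y\<bar> \<partial>lebesgue))"
proof -
  have "ennreal t < maximal f x \<longleftrightarrow> (\<exists>Q\<in>{Q \<in> cubes. x \<in> Q}. ennreal t < (\<integral>\<^sup>+y\<in>Q. ennreal \<bar>f y\<bar> \<partial>lebesgue) / emeasure lebesgue Q)"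
    unfolding maximal_def by (rule less_SUP_iff)
  also have "\<dots> \<longleftrightarrow> (\<exists>c l. 0 < l \<and> x \<in> cube c l \<and> ennreal t < (\<integral>\<^sup>+y\<in>cube c l. ennreal \<bar>f y\<bar> \<partial>lebesgue) / emeasure lebesgue (cube c l))"
    unfolding cubes_eq by blast
  finally show ?thesis using less_divide_cube_iff[OF _ assms] by (metis (no_types, lifting))
qed

text \<open>Superlevel set of the maximal function over cubes of side below \<open>B\<close>.
  Vitali's lemma asks for bounded radii; the unrestricted set is the increasing union over
  \<open>B\<close>.\<close>

definition level :: "(real ^ 'n \<Rightarrow> real) \<Rightarrow> real \<Rightarrow> real \<Rightarrow> (real ^ 'n) set" where
  "level h t B = {x. \<exists>c l. 0 < l \<and> l < B \<and> x \<in> cube c l \<and> ennreal (t * l ^ CARD('n)) < (\<integral>\<^sup>+y\<in>cube c l. ennreal \<bar>h y\<bar> \<partial>lebesgue)}"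

text \<open>The inequality is strict, so the cube may be enlarged by a small \<open>e\<close> on
  every side without losing it, and the enlarged cube contains the ball of radius \<open>e\<close>
  around \<open>x\<close>.\<close>

lemma open_level:
  fixes h :: "real ^ 'n \<Rightarrow> real"
  assumes t: "0 \<le> t"
  shows "open (level h t B)"
proof (rule openI)
  fix x assume "x \<in> level h t B"
  then obtain c l where cl: "0 < l" "l < B" "x \<in> cube c l"
    "ennreal (t * l ^ CARD('n)) < (\<integral>\<^sup>+y\<in>cube c l. ennreal \<bar>h y\<bar> \<partial>lebesgue)" unfolding level_def by blast
  obtain z where z: "ennreal (t * l ^ CARD('n)) < z" "z < (\<integral>\<^sup>+y\<in>cube c l. ennreal \<bar>h y\<bar> \<partial>lebesgue)"
    using dense[OF cl(4)] by blast
  then obtain r where r: "z = ennreal r" "0 \<le> r" by (cases z) auto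
  have "t * l ^ CARD('n) < r" using z(1) r t cl(1) by (simp add: ennreal_less_iff)
  have "((\<lambda>e. t * (l + 2 * e) ^ CARD('n)) \<longlongrightarrow> t * (l + 2 * 0) ^ CARD('n)) (at_right 0)"
    by (intro tendsto_intros)
  moreover have "((\<lambda>e. l + 2 * e) \<longlongrightarrow> l + 2 * 0) (at_right 0)" by (intro tendsto_intros)
  ultimately have "eventually (\<lambda>e. t * (l + 2 * e) ^ CARD('n) < r) (at_right 0)" "eventually (\<lambda>e. l + 2 * e < B) (at_right 0)"
    using \<open>t * l ^ CARD('n) < r\<close> cl(2) by (auto intro: order_tendstoD(2))
  moreover have "eventually (\<lambda>e. 0 < e) (at_right (0::real))" by (rule eventually_at_right_less)
  ultimately have "eventually (\<lambda>e. t * (l + 2 * e) ^ CARD('n) < r \<and> l + 2 * e < B \<and> 0 < e) (at_right 0)"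
    by eventually_elim auto
  then obtain e where e: "t * (l + 2 * e) ^ CARD('n) < r" "l + 2 * e < B" "0 < e"
    using eventually_happens'[OF trivial_limit_at_right_real] by blast
  define c' where "c' = (\<chi> i. c $ i - e)"
  have sub: "cube c l \<subseteq> cube c' (l + 2 * e)"
  proof
    fix y assume "y \<in> cube c l"
    then have "c $ i \<le> y $ i" "y $ i \<le> c $ i + l" for i by (simp_all add: mem_cube)
    then show "y \<in> cube c' (l + 2 * e)" using e(3) unfolding mem_cube c'_def by (simp add: add_increasing2) (smt (verit))
  qed
  have "ennreal (t * (l + 2 * e) ^ CARD('n)) \<le> z" using e(1) unfolding r(1) by (simp add: ennreal_leI)
  also have "z < (\<integral>\<^sup>+y\<in>cube c l. ennreal \<bar>h y\<bar> \<partial>lebesgue)" by (rule z(2))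
  also have "\<dots> \<le> (\<integral>\<^sup>+y\<in>cube c' (l + 2 * e). ennreal \<bar>h y\<bar> \<partial>lebesgue)"
    by (rule nn_integral_mono) (use sub in \<open>auto simp: indicator_def\<close>)
  finally have big: "ennreal (t * (l + 2 * e) ^ CARD('n)) < (\<integral>\<^sup>+y\<in>cube c' (l + 2 * e). ennreal \<bar>h y\<bar> \<partial>lebesgue)" .
  have "ball x e \<subseteq> level h t B"
  proof
    fix y assume "y \<in> ball x e"
    then have "norm (x - y) < e" by (simp add: dist_norm)
    then have "\<bar>(x - y) $ i\<bar> < e" for i using component_le_norm_cart[of "x - y" i] by linarith
    moreover have "c $ i \<le> x $ i" "x $ i \<le> c $ i + l" for i using cl(3) by (simp_all add: mem_cube)
    ultimately have "y \<in> cube c' (l + 2 * e)" unfolding mem_cube c'_def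
      by (simp add: abs_less_iff) (smt (verit, ccfv_SIG))
    then show "y \<in> level h t B" using big e cl(1) unfolding level_def
      by (intro CollectI exI[of _ c'] exI[of _ "l + 2 * e"]) auto
  qed
  then show "\<exists>e>0. ball x e \<subseteq> level h t B" using e(3) by blast
qed

lemma maximal_level:
  fixes h :: "real ^ 'n \<Rightarrow> real"
  assumes t: "0 \<le> t"
  shows "{x. ennreal t < maximal h x} = (\<Union>m::nat. level h t (real m))"
proof -
  have "\<exists>m::nat. l < real m" for l by (rule reals_Archimedean2)
  then show ?thesis unfolding level_def less_maximal_iff[OF t] by blast
qed

lemma borel_measurable_maximal [measurable]: "maximal f \<in> borel_measurable lebesgue"
proof (rule borel_measurableI_greater)
  fix y :: ennreal
  show "{x \<in> space lebesgue. y < maximal f x} \<in> sets lebesgue"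
  proof (cases y)
    case (real r)
    have "open {x. ennreal r < maximal f x}"
      unfolding maximal_level[OF real(1)] using open_level[OF real(1)] by blast
    then show ?thesis using real by simp
  qed simp
qed

section \<open>Weak type estimate by a Vitali covering\<close>

lemma growth_pos:
  assumes g: "growth \<Phi> c d" and t: "0 < t"
  shows "0 < \<Phi> x t"
proof (cases "t \<le> 1")
  case True
  have "0 < t powr d * \<Phi> x 1" using g t by (simp add: growth_def)
  also have "\<dots> \<le> \<Phi> x t" using growth_lower(2)[OF g, of 1 t x] t True by simp
  finally show ?thesis .
next
  case False
  have "0 < \<Phi> x 1" using g by (simp add: growth_def)
  also have "\<dots> \<le> \<Phi> x t" using growth_mono[OF g, of 1 t x] False by simp
  finally show ?thesis .
qed

text \<open>The cubes with average above \<open>t\<close> are thinned out to disjoint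
  \<open>Q j\<close> whose enlargements \<open>Q' j\<close> cover the level set. Over
  \<open>Q' j\<close> the average of \<open>h\<close> restricted to \<open>Q j\<close> is still at
  least \<open>t / \<eta>\<close>, with \<open>\<eta>\<close> the ratio of the volumes. Averaging
  and growth bound the modular of the constant \<open>t\<close> on \<open>Q' j\<close> by that of
  \<open>h\<close> on \<open>Q j\<close>, and the latter add up.\<close>

lemma weak_type:
  fixes \<Phi> :: "real ^ 'n \<Rightarrow> real \<Rightarrow> real"
  assumes g: "growth \<Phi> c d" and car: "caratheodory \<Phi>" and avg: "averaging \<Phi> C"
    and h [measurable]: "h \<in> borel_measurable lebesgue" and hnn: "\<And>x. 0 \<le> h x" and t: "0 < t"
    and mod: "(\<integral>\<^sup>+x. ennreal (\<Phi> x (h x)) \<partial>lebesgue) \<le> 1"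
  shows "(\<integral>\<^sup>+x\<in>{x. ennreal t < maximal h x}. ennreal (\<Phi> x t) \<partial>lebesgue)
    \<le> ennreal (((10 * real CARD('n)) ^ CARD('n)) powr d * C) * (\<integral>\<^sup>+x. ennreal (\<Phi> x (h x)) \<partial>lebesgue)"
proof -
  let ?n = "real CARD('n)"
  define \<eta> where "\<eta> = (10 * ?n) ^ CARD('n)"
  have n1: "1 \<le> ?n" by (simp add: Suc_leI)
  have \<eta>: "1 \<le> \<eta>" unfolding \<eta>_def by (rule one_le_power) (use n1 in linarith)
  have [measurable]: "(\<lambda>x. \<Phi> x (h x)) \<in> borel_measurable lebesgue" "(\<lambda>x. \<Phi> x t) \<in> borel_measurable lebesgue"
    using caratheodoryD[OF car h hnn] caratheodoryD[OF car, of "\<lambda>_. t"] t by simp_all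
  have bounded: "(\<integral>\<^sup>+x\<in>level h t B. ennreal (\<Phi> x t) \<partial>lebesgue)
    \<le> ennreal (\<eta> powr d * C) * (\<integral>\<^sup>+x. ennreal (\<Phi> x (h x)) \<partial>lebesgue)" for B
  proof -
    \<comment> \<open>Vitali's lemma speaks of balls. A cube with corner \<open>a\<close> and side
      \<open>l\<close> lies in the ball around \<open>a\<close> of radius \<open>?n * l\<close>, by
      the bound of the norm through the sum of the coordinates, and five times that ball lies in a
      cube of side \<open>10 * ?n * l\<close>; this is the origin of \<open>\<eta>\<close>.\<close>
    define K where "K = {(a :: real ^ 'n, l). 0 < l \<and> l < B \<and> ennreal (t * l ^ CARD('n)) < (\<integral>\<^sup>+y\<in>cube a l. ennreal \<bar>h y\<bar> \<partial>lebesgue)}"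
    have rad: "0 < ?n * snd i \<and> ?n * snd i \<le> ?n * B" if "i \<in> K" for i
      using that by (auto simp: K_def)
    obtain Z where Z: "countable Z" "Z \<subseteq> K"
      "pairwise (\<lambda>i j. disjnt (cball (fst i) (?n * snd i)) (cball (fst j) (?n * snd j))) Z"
      "\<And>i. i \<in> K \<Longrightarrow> \<exists>j. j \<in> Z \<and> \<not> disjnt (cball (fst i) (?n * snd i)) (cball (fst j) (?n * snd j)) \<and>
        cball (fst i) (?n * snd i) \<subseteq> ball (fst j) (5 * (?n * snd j))"
    proof (rule Vitali_covering_lemma_cballs_balls[of K "\<lambda>i. ?n * snd i" "?n * B" fst, OF rad])
      fix C
      assume "countable C" "C \<subseteq> K"
        "pairwise (\<lambda>i j. disjnt (cball (fst i) (?n * snd i)) (cball (fst j) (?n * snd j))) C"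
        "\<And>i. i \<in> K \<Longrightarrow> \<exists>j. j \<in> C \<and> \<not> disjnt (cball (fst i) (?n * snd i)) (cball (fst j) (?n * snd j)) \<and>
          cball (fst i) (?n * snd i) \<subseteq> ball (fst j) (5 * (?n * snd j))"
      then show thesis by (rule that)
    qed
    define Q where "Q i = cube (fst i) (snd i)" for i :: "(real ^ 'n) \<times> real"
    define Q' where "Q' i = cube (\<chi> k. fst i $ k - 5 * (?n * snd i)) (10 * (?n * snd i))" for i :: "(real ^ 'n) \<times> real"
    have [measurable]: "Q i \<in> sets lebesgue" "Q' i \<in> sets lebesgue" for i by (simp_all add: Q_def Q'_def)
    have QB: "Q i \<subseteq> cball (fst i) (?n * snd i)" for i
    proof
      fix x assume "x \<in> Q i"
      then have "fst i $ k \<le> x $ k" "x $ k \<le> fst i $ k + snd i" for k by (simp_all add: Q_def mem_cube)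
      then have "\<bar>(fst i - x) $ k\<bar> \<le> snd i" for k by (simp add: abs_le_iff) (smt (verit))
      then have "(\<Sum>k\<in>UNIV. \<bar>(fst i - x) $ k\<bar>) \<le> (\<Sum>k::'n\<in>UNIV. snd i)" by (intro sum_mono)
      then show "x \<in> cball (fst i) (?n * snd i)"
        using norm_le_l1_cart[of "fst i - x"] by (simp add: dist_norm)
    qed
    have BQ': "ball (fst i) (5 * (?n * snd i)) \<subseteq> Q' i" for i
    proof
      fix x assume "x \<in> ball (fst i) (5 * (?n * snd i))"
      then have "norm (fst i - x) < 5 * (?n * snd i)" by (simp add: dist_norm)
      then have k: "\<bar>(fst i - x) $ k\<bar> < 5 * (?n * snd i)" for k
        using component_le_norm_cart[of "fst i - x" k] by linarith
      have "fst i $ k - 5 * (?n * snd i) \<le> x $ k \<and> x $ k \<le> fst i $ k - 5 * (?n * snd i) + 10 * (?n * snd i)" for k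
        using k[of k] unfolding vector_minus_component by linarith
      then show "x \<in> Q' i" unfolding Q'_def mem_cube by simp
    qed
    have cover: "\<exists>j\<in>Z. x \<in> Q' j" if x: "x \<in> level h t B" for x
    proof -
      obtain a l where "(a, l) \<in> K" "x \<in> Q (a, l)"
        using x unfolding level_def K_def Q_def by auto
      moreover obtain j where "j \<in> Z" "cball (fst (a, l)) (?n * snd (a, l)) \<subseteq> ball (fst j) (5 * (?n * snd j))"
        using Z(4)[OF \<open>(a, l) \<in> K\<close>] by blast
      ultimately show ?thesis using QB[of "(a, l)"] BQ'[of j] by blast
    qed
    have local: "(\<integral>\<^sup>+x\<in>Q' j. ennreal (\<Phi> x t) \<partial>lebesgue) \<le> ennreal (\<eta> powr d * C) * (\<integral>\<^sup>+x\<in>Q j. ennreal (\<Phi> x (h x)) \<partial>lebesgue)"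
      if j: "j \<in> Z" for j
    proof -
      have l: "0 < snd j" and big: "ennreal (t * snd j ^ CARD('n)) < (\<integral>\<^sup>+y\<in>Q j. ennreal (h y) \<partial>lebesgue)"
        using j Z(2) hnn unfolding K_def Q_def by auto
      \<comment> \<open>Cutting \<open>h\<close> down to \<open>Q j\<close> keeps the large average
        and leaves only an integral over \<open>Q j\<close> on the right; the \<open>Q' j\<close>
        may overlap, the \<open>Q j\<close> do not.\<close>
      define hj where "hj x = h x * indicator (Q j) x" for x
      have [measurable]: "hj \<in> borel_measurable lebesgue" unfolding hj_def by measurable
      have L: "0 < 10 * (?n * snd j)" using l n1 by simp
      have hj: "ennreal (\<Phi> x (hj x)) = ennreal (\<Phi> x (h x)) * indicator (Q j) x" for x
        by (simp add: hj_def indicator_def growth_zero[OF g])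
      have "cball (fst j) (?n * snd j) \<subseteq> ball (fst j) (5 * (?n * snd j))"
        using l by (simp add: cball_subset_ball_iff)
      then have QQ': "Q j \<subseteq> Q' j" using QB[of j] BQ'[of j] by blast
      have int_hj: "(\<integral>\<^sup>+x\<in>Q' j. ennreal (\<Phi> x (hj x)) \<partial>lebesgue) = (\<integral>\<^sup>+x\<in>Q j. ennreal (\<Phi> x (h x)) \<partial>lebesgue)"
        unfolding hj by (rule nn_integral_cong) (use QQ' in \<open>auto simp: indicator_def\<close>)
      have "(\<integral>\<^sup>+x\<in>Q j. ennreal (\<Phi> x (h x)) \<partial>lebesgue) \<le> (\<integral>\<^sup>+x. ennreal (\<Phi> x (h x)) \<partial>lebesgue)"
        by (rule nn_integral_mono) (simp add: indicator_def)
      then have le1: "(\<integral>\<^sup>+x\<in>Q' j. ennreal (\<Phi> x (hj x)) \<partial>lebesgue) \<le> 1"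
        unfolding int_hj using mod by (rule order_trans)
      obtain A where A: "0 \<le> A" "(\<integral>\<^sup>+x\<in>Q' j. ennreal (hj x) \<partial>lebesgue) = ennreal (A * (10 * (?n * snd j)) ^ CARD('n))"
        "(\<integral>\<^sup>+x\<in>Q' j. ennreal (\<Phi> x A) \<partial>lebesgue) \<le> ennreal C * (\<integral>\<^sup>+x\<in>Q' j. ennreal (\<Phi> x (hj x)) \<partial>lebesgue)"
        using avg[unfolded averaging_def, rule_format, OF _ L _ le1[unfolded Q'_def]] hnn
        unfolding Q'_def by (auto simp: hj_def)
      have "(\<integral>\<^sup>+x\<in>Q' j. ennreal (hj x) \<partial>lebesgue) = (\<integral>\<^sup>+x\<in>Q j. ennreal (h x) \<partial>lebesgue)"
        by (rule nn_integral_cong) (use QQ' in \<open>auto simp: indicator_def hj_def\<close>)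
      then have "ennreal (t * snd j ^ CARD('n)) < ennreal (A * (10 * (?n * snd j)) ^ CARD('n))"
        using big A(2) by simp
      then have "t * snd j ^ CARD('n) \<le> A * (10 * (?n * snd j)) ^ CARD('n)"
        using t l by (simp add: ennreal_less_iff)
      also have "10 * (?n * snd j) = 10 * ?n * snd j" by simp
      also have "A * (10 * ?n * snd j) ^ CARD('n) = \<eta> * A * snd j ^ CARD('n)"
        by (simp add: \<eta>_def power_mult_distrib)
      finally have tA: "t \<le> \<eta> * A" using l by simp
      have "ennreal (\<Phi> x t) \<le> ennreal (\<eta> powr d) * ennreal (\<Phi> x A)" for x
      proof -
        have "\<Phi> x t \<le> \<Phi> x (\<eta> * A)" using t tA by (intro growth_mono[OF g]) auto
        also have "\<dots> \<le> \<eta> powr d * \<Phi> x A" by (rule growth_upper(1)[OF g A(1) \<eta>])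
        finally show ?thesis using growth_nonneg[OF g A(1)] by (simp add: ennreal_mult''[symmetric] ennreal_leI)
      qed
      then have "(\<integral>\<^sup>+x\<in>Q' j. ennreal (\<Phi> x t) \<partial>lebesgue) \<le> (\<integral>\<^sup>+x. ennreal (\<eta> powr d) * (ennreal (\<Phi> x A) * indicator (Q' j) x) \<partial>lebesgue)"
        by (intro nn_integral_mono) (auto simp: indicator_def)
      also have "\<dots> = ennreal (\<eta> powr d) * (\<integral>\<^sup>+x\<in>Q' j. ennreal (\<Phi> x A) \<partial>lebesgue)"
      proof (rule nn_integral_cmult)
        have [measurable]: "(\<lambda>x. \<Phi> x A) \<in> borel_measurable lebesgue"
          using caratheodoryD[OF car, of "\<lambda>_. A"] A(1) by simp
        show "(\<lambda>x. ennreal (\<Phi> x A) * indicator (Q' j) x) \<in> borel_measurable lebesgue" by measurable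
      qed
      also have "\<dots> \<le> ennreal (\<eta> powr d) * (ennreal C * (\<integral>\<^sup>+x\<in>Q' j. ennreal (\<Phi> x (hj x)) \<partial>lebesgue))"
        by (intro mult_left_mono A(3)) simp
      finally show ?thesis unfolding int_hj by (simp add: ennreal_mult' mult.assoc)
    qed
    define \<mu> where "\<mu> = density lebesgue (\<lambda>x. ennreal (\<Phi> x (h x)))"
    have disj: "disjoint_family_on Q Z"
      unfolding disjoint_family_on_def
    proof (intro ballI impI)
      fix i j assume ij: "i \<in> Z" "j \<in> Z" "i \<noteq> j"
      then have "disjnt (cball (fst i) (?n * snd i)) (cball (fst j) (?n * snd j))"
        using Z(3) unfolding pairwise_def by blast
      then show "Q i \<inter> Q j = {}" using QB[of i] QB[of j] unfolding disjnt_def by blast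
    qed
    have "(\<integral>\<^sup>+x\<in>level h t B. ennreal (\<Phi> x t) \<partial>lebesgue)
      \<le> (\<integral>\<^sup>+x. \<integral>\<^sup>+j. ennreal (\<Phi> x t) * indicator (Q' j) x \<partial>count_space Z \<partial>lebesgue)"
    proof (rule nn_integral_mono)
      fix x
      show "ennreal (\<Phi> x t) * indicator (level h t B) x \<le> (\<integral>\<^sup>+j. ennreal (\<Phi> x t) * indicator (Q' j) x \<partial>count_space Z)"
      proof (cases "x \<in> level h t B")
        case True
        then obtain j where j: "j \<in> Z" "x \<in> Q' j" using cover by blast
        have "(\<integral>\<^sup>+i. ennreal (\<Phi> x t) * indicator {j} i \<partial>count_space Z) \<le> (\<integral>\<^sup>+i. ennreal (\<Phi> x t) * indicator (Q' i) x \<partial>count_space Z)"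
          by (rule nn_integral_mono) (use j in \<open>auto simp: indicator_def\<close>)
        then show ?thesis using True j by (simp add: nn_integral_cmult_indicator)
      qed simp
    qed
    also have "\<dots> = (\<integral>\<^sup>+j. (\<integral>\<^sup>+x\<in>Q' j. ennreal (\<Phi> x t) \<partial>lebesgue) \<partial>count_space Z)"
      by (rule nn_integral_count_space_nn_integral[OF Z(1)]) measurable
    also have "\<dots> \<le> (\<integral>\<^sup>+j. ennreal (\<eta> powr d * C) * emeasure \<mu> (Q j) \<partial>count_space Z)"
      by (rule nn_integral_mono) (use local in \<open>simp add: \<mu>_def emeasure_density\<close>)
    also have "\<dots> = ennreal (\<eta> powr d * C) * (\<integral>\<^sup>+j. emeasure \<mu> (Q j) \<partial>count_space Z)"
      by (rule nn_integral_cmult) simp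
    also have "(\<integral>\<^sup>+j. emeasure \<mu> (Q j) \<partial>count_space Z) = emeasure \<mu> (\<Union>(Q ` Z))"
      by (rule emeasure_UN_countable[symmetric]) (use disj Z(1) in \<open>auto simp: \<mu>_def\<close>)
    also have "\<dots> \<le> emeasure \<mu> UNIV"
      by (rule emeasure_mono) (auto simp: \<mu>_def)
    also have "\<dots> = (\<integral>\<^sup>+x. ennreal (\<Phi> x (h x)) \<partial>lebesgue)"
      by (simp add: \<mu>_def emeasure_density)
    finally show ?thesis by (simp add: mult_left_mono)
  qed
  have "(\<integral>\<^sup>+x\<in>{x. ennreal t < maximal h x}. ennreal (\<Phi> x t) \<partial>lebesgue)
    = (\<integral>\<^sup>+x. (SUP m. ennreal (\<Phi> x t) * indicator (level h t (real m)) x) \<partial>lebesgue)"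
  proof (rule nn_integral_cong)
    fix x
    show "ennreal (\<Phi> x t) * indicator {x. ennreal t < maximal h x} x = (SUP m. ennreal (\<Phi> x t) * indicator (level h t (real m)) x)"
    proof (cases "\<exists>m. x \<in> level h t (real m)")
      case True
      then obtain m where m: "x \<in> level h t (real m)" by blast
      have "(SUP m. ennreal (\<Phi> x t) * indicator (level h t (real m)) x) = ennreal (\<Phi> x t)"
      proof (rule antisym)
        show "(SUP m. ennreal (\<Phi> x t) * indicator (level h t (real m)) x) \<le> ennreal (\<Phi> x t)"
          by (rule SUP_least) (simp add: indicator_def)
        show "ennreal (\<Phi> x t) \<le> (SUP m. ennreal (\<Phi> x t) * indicator (level h t (real m)) x)"
          by (rule SUP_upper2[of m]) (use m in auto)
      qed
      then show ?thesis using True t by (simp add: maximal_level)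
    next
      case False
      then show ?thesis using t by (simp add: maximal_level)
    qed
  qed
  also have "\<dots> = (SUP m. \<integral>\<^sup>+x\<in>level h t (real m). ennreal (\<Phi> x t) \<partial>lebesgue)"
  proof (rule nn_integral_monotone_convergence_SUP)
    show "incseq (\<lambda>m x. ennreal (\<Phi> x t) * indicator (level h t (real m)) x)"
      unfolding incseq_def le_fun_def
    proof (intro allI impI mult_left_mono)
      fix m n :: nat and x assume "m \<le> n"
      then have "level h t (real m) \<subseteq> level h t (real n)" unfolding level_def by fastforce
      then show "indicator (level h t (real m)) x \<le> (indicator (level h t (real n)) x :: ennreal)"
        by (auto simp: indicator_def)
    qed simp
    fix m
    have "level h t (real m) \<in> sets borel" using open_level[of t h "real m"] t by simp
    then have [measurable]: "level h t (real m) \<in> sets lebesgue" by simp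
    show "(\<lambda>x. ennreal (\<Phi> x t) * indicator (level h t (real m)) x) \<in> borel_measurable lebesgue" by measurable
  qed
  also have "\<dots> \<le> ennreal (\<eta> powr d * C) * (\<integral>\<^sup>+x. ennreal (\<Phi> x (h x)) \<partial>lebesgue)"
    by (rule SUP_least) (rule bounded)
  finally show ?thesis unfolding \<eta>_def .
qed

section \<open>Strong type estimate by summation over dyadic levels\<close>

lemma geometric_int_bound:
  fixes r :: real
  assumes r: "0 < r" and f: "0 < f"
  shows "(\<integral>\<^sup>+k. ennreal ((2 powr real_of_int k / f) powr r) * indicator {k. 2 powr real_of_int k < f} k \<partial>count_space UNIV)
    \<le> ennreal (1 / (1 - 2 powr - r))"
proof -
  \<comment> \<open>The largest exponent that can occur. Descending from it by \<open>j\<close>, the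
    terms are at most \<open>\<beta> ^ j\<close>, so the bound does not depend on
    \<open>f\<close>.\<close>
  define K where "K = \<lfloor>log 2 f\<rfloor>"
  define \<beta> where "\<beta> = 2 powr - r"
  have \<beta>: "0 \<le> \<beta>" "\<beta> < 1" using r by (auto simp: \<beta>_def powr_less_one)
  have inj: "inj_on (\<lambda>j::nat. K - int j) UNIV" by (simp add: inj_on_def)
  have sub: "{k. 2 powr real_of_int k < f} \<subseteq> range (\<lambda>j::nat. K - int j)"
  proof
    fix k assume "k \<in> {k. 2 powr real_of_int k < f}"
    then have "real_of_int k < log 2 f" using f by (simp add: less_log_iff)
    then have "k \<le> K" unfolding K_def by (simp add: le_floor_iff)
    then show "k \<in> range (\<lambda>j::nat. K - int j)" by (intro range_eqI[of _ _ "nat (K - k)"]) simp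
  qed
  have "2 powr real_of_int K \<le> f"
    using f by (simp add: K_def powr_le_iff)
  then have geo: "(2 powr real_of_int (K - int j) / f) powr r \<le> \<beta> ^ j" for j
  proof -
    have "2 powr real_of_int (K - int j) / f = 2 powr real_of_int K / f * 2 powr - real j"
      by (simp add: powr_diff powr_minus divide_inverse)
    also have "\<dots> \<le> 1 * 2 powr - real j"
      using \<open>2 powr real_of_int K \<le> f\<close> f by (intro mult_right_mono) auto
    finally have "(2 powr real_of_int (K - int j) / f) powr r \<le> (2 powr - real j) powr r"
      using r f by (intro powr_mono2) auto
    also have "\<dots> = \<beta> ^ j"
      unfolding \<beta>_def by (simp add: powr_powr powr_realpow[symmetric] mult.commute)
    finally show ?thesis .
  qed
  have "(\<integral>\<^sup>+k. ennreal ((2 powr real_of_int k / f) powr r) * indicator {k. 2 powr real_of_int k < f} k \<partial>count_space UNIV)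
    \<le> (\<integral>\<^sup>+k\<in>range (\<lambda>j::nat. K - int j). ennreal ((2 powr real_of_int k / f) powr r) \<partial>count_space UNIV)"
    by (rule nn_integral_mono) (use sub in \<open>auto simp: indicator_def\<close>)
  also have "\<dots> = (\<integral>\<^sup>+k. ennreal ((2 powr real_of_int k / f) powr r) \<partial>count_space (range (\<lambda>j::nat. K - int j)))"
    by (subst nn_integral_count_space_indicator) simp_all
  also have "\<dots> = (\<integral>\<^sup>+j. ennreal ((2 powr real_of_int (K - int j) / f) powr r) \<partial>count_space UNIV)"
    by (rule nn_integral_bij_count_space[symmetric]) (rule inj_on_imp_bij_betw[OF inj])
  also have "\<dots> \<le> (\<integral>\<^sup>+j. ennreal (\<beta> ^ j) \<partial>count_space UNIV)"
    by (rule nn_integral_mono) (rule ennreal_leI[OF geo])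
  also have "\<dots> = (\<Sum>j. ennreal (\<beta> ^ j))" by (rule nn_integral_count_space_nat)
  also have "\<dots> = ennreal (\<Sum>j. \<beta> ^ j)"
    using \<beta> by (intro suminf_ennreal2) (auto intro!: summable_geometric)
  also have "(\<Sum>j. \<beta> ^ j) = 1 / (1 - \<beta>)" using \<beta> by (intro suminf_geometric) simp
  finally show ?thesis unfolding \<beta>_def .
qed

lemma growth_powr:
  assumes g: "growth \<Phi> c d" and s: "0 < s"
  shows "growth (\<lambda>x t. \<Phi> x (t powr s)) (c * s) (d * s)"
proof -
  have "\<Phi> x ((\<theta> * t) powr s) \<le> \<theta> powr (c * s) * \<Phi> x (t powr s) \<and> \<theta> powr (d * s) * \<Phi> x (t powr s) \<le> \<Phi> x ((\<theta> * t) powr s)"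
    if "0 \<le> t" "0 \<le> \<theta>" "\<theta> \<le> 1" for x t \<theta>
  proof -
    have "\<theta> powr s \<le> 1" using that s by (intro powr_le1) auto
    then show ?thesis
      using growth_lower[OF g, of "t powr s" "\<theta> powr s" x] that by (simp add: powr_mult powr_powr mult.commute)
  qed
  then show ?thesis using g s unfolding growth_def by auto
qed

lemma caratheodory_powr:
  assumes "caratheodory \<Phi>"
  shows "caratheodory (\<lambda>x t. \<Phi> x (t powr s))"
  unfolding caratheodory_def
proof (intro ballI impI)
  fix u :: "real ^ 'a \<Rightarrow> real" assume [measurable]: "u \<in> borel_measurable lebesgue"
  show "(\<lambda>x. \<Phi> x (u x powr s)) \<in> borel_measurable lebesgue"
    by (rule caratheodoryD[OF assms]) simp_all
qed

text \<open>For a finite positive value one summand suffices, with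
  \<open>2 * 2 powr k < u \<le> 4 * 2 powr k\<close>; for an infinite one every
  \<open>k \<ge> 0\<close> contributes at least \<open>\<Phi> x 1 > 0\<close> and the sum diverges.
  The factor 2 in the index set leaves room for splitting off the part of a function below the
  level.\<close>

lemma extend_le_dyadic_sum:
  assumes g: "growth \<Phi> c d"
  shows "extend (\<lambda>x t. ennreal (\<Phi> x t)) x u \<le> ennreal (4 powr d) *
    (\<integral>\<^sup>+k. ennreal (\<Phi> x (2 powr real_of_int k)) * indicator {k. ennreal (2 * 2 powr real_of_int k) < u} k \<partial>count_space UNIV)"
proof (cases u)
  case (real r)
  show ?thesis
  proof (cases "r = 0")
    case True
    then show ?thesis using real growth_zero[OF g] by (simp add: extend_def)
  next
    case False
    then have r: "0 < r" using real by simp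
    \<comment> \<open>Ceiling rather than floor, because the lower of the two inequalities must be
      strict.\<close>
    define k where "k = \<lceil>log 2 r\<rceil> - 2"
    have "real_of_int (k + 1) < log 2 r" "log 2 r \<le> real_of_int (k + 2)" unfolding k_def by linarith+
    then have "2 powr real_of_int (k + 1) < r" "r \<le> 2 powr real_of_int (k + 2)"
      using r by (simp_all only: less_log_iff log_le_iff)
    then have k: "2 * 2 powr real_of_int k < r" "r \<le> 4 * 2 powr real_of_int k"
      by (simp_all add: powr_add mult.commute)
    have "\<Phi> x r \<le> \<Phi> x (4 * 2 powr real_of_int k)" using r k by (intro growth_mono[OF g]) auto
    also have "\<dots> \<le> 4 powr d * \<Phi> x (2 powr real_of_int k)" by (rule growth_upper(1)[OF g]) auto
    finally have "ennreal (\<Phi> x r) \<le> ennreal (4 powr d) * ennreal (\<Phi> x (2 powr real_of_int k))"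
      using growth_nonneg[OF g] by (simp add: ennreal_mult''[symmetric] ennreal_leI)
    also have "ennreal (\<Phi> x (2 powr real_of_int k)) = (\<integral>\<^sup>+j. ennreal (\<Phi> x (2 powr real_of_int k)) * indicator {k} j \<partial>count_space UNIV)"
      by (simp add: nn_integral_cmult_indicator)
    also have "\<dots> \<le> (\<integral>\<^sup>+k. ennreal (\<Phi> x (2 powr real_of_int k)) * indicator {k. ennreal (2 * 2 powr real_of_int k) < u} k \<partial>count_space UNIV)"
      by (rule nn_integral_mono) (use k real in \<open>auto simp: indicator_def ennreal_less_iff\<close>)
    finally show ?thesis using real by (simp add: extend_def mult_left_mono)
  qed
next
  case top
  have "ennreal (\<Phi> x 1) * \<infinity> = (\<integral>\<^sup>+k. ennreal (\<Phi> x 1) * indicator {0..} k \<partial>count_space (UNIV :: int set))"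
    by (simp add: nn_integral_cmult_indicator infinite_Ici)
  also have "\<dots> \<le> (\<integral>\<^sup>+k. ennreal (\<Phi> x (2 powr real_of_int k)) * indicator {k. ennreal (2 * 2 powr real_of_int k) < u} k \<partial>count_space UNIV)"
  proof (rule nn_integral_mono)
    fix k :: int
    show "ennreal (\<Phi> x 1) * indicator {0..} k \<le> ennreal (\<Phi> x (2 powr real_of_int k)) * indicator {k. ennreal (2 * 2 powr real_of_int k) < u} k"
    proof (cases "0 \<le> k")
      case True
      then have "1 \<le> 2 powr real_of_int k" by (simp add: ge_one_powr_ge_zero)
      then have "\<Phi> x 1 \<le> \<Phi> x (2 powr real_of_int k)" by (intro growth_mono[OF g]) auto
      then show ?thesis using True top by (simp add: ennreal_leI)
    qed simp
  qed
  finally have "(\<integral>\<^sup>+k. ennreal (\<Phi> x (2 powr real_of_int k)) * indicator {k. ennreal (2 * 2 powr real_of_int k) < u} k \<partial>count_space UNIV) = \<infinity>"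
    using growth_pos[OF g, of 1 x] by (simp add: ennreal_mult_top top_unique)
  then show ?thesis by (simp add: ennreal_mult_top)
qed

text \<open>At level \<open>T\<close> the weak type estimate is applied to \<open>h\<close> with \<open>h\<^sup>\<tau> = f\<^sup>\<tau> T\<^sup>1\<^sup>-\<^sup>\<tau>\<close> on \<open>{f > T}\<close>, which is at most \<open>f\<close>.\<close>

lemma maximal_strong_type:
  fixes \<Phi> :: "real ^ 'n \<Rightarrow> real \<Rightarrow> real"
  assumes g: "growth \<Phi> c d" and car: "caratheodory \<Phi>" and \<tau>: "0 < \<tau>" "\<tau> < 1"
    and avg: "averaging (\<lambda>x t. \<Phi> x (t powr \<tau>)) C" and C: "0 \<le> C"
  shows "\<exists>C'>0. \<forall>f\<in>borel_measurable lebesgue. (\<integral>\<^sup>+x. ennreal (\<Phi> x \<bar>f x\<bar>) \<partial>lebesgue) \<le> 1 \<longrightarrow>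
    (\<integral>\<^sup>+x. extend (\<lambda>x t. ennreal (\<Phi> x t)) x (maximal f x) \<partial>lebesgue) \<le> ennreal C' * (\<integral>\<^sup>+x. ennreal (\<Phi> x \<bar>f x\<bar>) \<partial>lebesgue)"
proof -
  \<comment> \<open>The gain: where \<open>T < \<bar>f x\<bar>\<close>, the integrand at level
    \<open>T\<close> is at most
    \<open>(T / \<bar>f x\<bar>) powr r * \<Phi> x \<bar>f x\<bar>\<close>, which is summable over
    dyadic \<open>T\<close> because \<open>\<tau> < 1\<close> makes \<open>r\<close>
    positive.\<close>
  define r where "r = (1 - \<tau>) * c"
  have r: "0 < r" using \<tau> g by (simp add: r_def growth_def)
  define C1 where "C1 = ((10 * real CARD('n)) ^ CARD('n)) powr (d * \<tau>) * C"
  have C1: "0 \<le> C1" using C by (simp add: C1_def)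
  define C2 where "C2 = 1 / (1 - 2 powr - r)"
  have C2: "0 < C2" using r by (auto simp: C2_def powr_less_one)
  define C3 where "C3 = 4 powr d * (C1 * C2)"
  have C3: "0 \<le> C3" using C1 C2 by (simp add: C3_def)
  show ?thesis
  proof (intro exI[of _ "C3 + 1"] conjI ballI impI)
    show "0 < C3 + 1" using C3 by simp
    fix f :: "real ^ 'n \<Rightarrow> real"
    assume f [measurable]: "f \<in> borel_measurable lebesgue" and le1: "(\<integral>\<^sup>+x. ennreal (\<Phi> x \<bar>f x\<bar>) \<partial>lebesgue) \<le> 1"
    have [measurable]: "(\<lambda>x. \<Phi> x \<bar>f x\<bar>) \<in> borel_measurable lebesgue"
      by (rule caratheodoryD[OF car]) simp_all
    define T where "T k = 2 powr real_of_int k" for k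
    have T: "0 < T k" for k by (simp add: T_def)
    define fk where "fk k x = (if T k < \<bar>f x\<bar> then \<bar>f x\<bar> else 0)" for k x
    have [measurable]: "fk k \<in> borel_measurable lebesgue" for k unfolding fk_def by measurable
    define h where "h k x = fk k x * T k powr (1 / \<tau> - 1)" for k x
    have h_meas [measurable]: "h k \<in> borel_measurable lebesgue" for k unfolding h_def by measurable
    have hnn: "0 \<le> h k x" for k x by (simp add: h_def fk_def)
    have hpow: "\<Phi> x (h k x powr \<tau>) \<le> (if T k < \<bar>f x\<bar> then (T k / \<bar>f x\<bar>) powr r * \<Phi> x \<bar>f x\<bar> else 0)" for k x
    proof (cases "T k < \<bar>f x\<bar>")
      case True
      then have fx: "0 < \<bar>f x\<bar>" using T[of k] by linarith
      have "h k x powr \<tau> = \<bar>f x\<bar> powr \<tau> * T k powr ((1 / \<tau> - 1) * \<tau>)"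
        using True T[of k] by (simp add: h_def fk_def powr_mult powr_powr)
      also have "(1 / \<tau> - 1) * \<tau> = 1 - \<tau>" using \<tau> by (simp add: field_simps)
      also have "\<bar>f x\<bar> powr \<tau> * T k powr (1 - \<tau>) = (T k / \<bar>f x\<bar>) powr (1 - \<tau>) * \<bar>f x\<bar>"
        using fx T[of k] by (simp add: powr_divide powr_diff)
      finally have eq: "h k x powr \<tau> = (T k / \<bar>f x\<bar>) powr (1 - \<tau>) * \<bar>f x\<bar>" .
      have "(T k / \<bar>f x\<bar>) powr (1 - \<tau>) \<le> 1" using True T[of k] fx \<tau> by (intro powr_le1) auto
      then have "\<Phi> x (h k x powr \<tau>) \<le> ((T k / \<bar>f x\<bar>) powr (1 - \<tau>)) powr c * \<Phi> x \<bar>f x\<bar>"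
        unfolding eq by (intro growth_lower(1)[OF g]) auto
      then show ?thesis using True by (simp add: powr_powr r_def)
    next
      case False
      then show ?thesis using growth_zero[OF g] by (simp add: h_def fk_def)
    qed
    have hle: "\<Phi> x (h k x powr \<tau>) \<le> \<Phi> x \<bar>f x\<bar>" for k x
    proof (cases "T k < \<bar>f x\<bar>")
      case True
      then have "(T k / \<bar>f x\<bar>) powr r \<le> 1" using T[of k] r by (intro powr_le1) auto
      then have "(T k / \<bar>f x\<bar>) powr r * \<Phi> x \<bar>f x\<bar> \<le> 1 * \<Phi> x \<bar>f x\<bar>"
        using growth_nonneg[OF g, of "\<bar>f x\<bar>" x] by (intro mult_right_mono) auto
      then show ?thesis using hpow[of x k] True by simp
    next
      case False
      then show ?thesis using hpow[of x k] growth_nonneg[OF g, of "\<bar>f x\<bar>" x] by simp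
    qed
    have mod_h: "(\<integral>\<^sup>+x. ennreal (\<Phi> x (h k x powr \<tau>)) \<partial>lebesgue) \<le> 1" for k
      using le1 by (rule order_trans[rotated]) (intro nn_integral_mono ennreal_leI hle)
    \<comment> \<open>The part of \<open>f\<close> at or below \<open>T\<close> adds at most
      \<open>T\<close> to any average, so an average of \<open>f\<close> above \<open>2 * T\<close>
      leaves one of \<open>fk\<close> above \<open>T\<close>. Multiplication by the constant
      \<open>T powr (1 / \<tau> - 1)\<close> turns it into an average of \<open>h\<close> above
      \<open>T powr (1 / \<tau>)\<close>.\<close>
    have incl: "{x. ennreal (2 * T k) < maximal f x} \<subseteq> {x. ennreal (T k powr (1 / \<tau>)) < maximal (h k) x}" for k
    proof
      fix x assume "x \<in> {x. ennreal (2 * T k) < maximal f x}"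
      then obtain a l where al: "0 < l" "x \<in> cube a l"
        "ennreal (2 * T k * l ^ CARD('n)) < (\<integral>\<^sup>+y\<in>cube a l. ennreal \<bar>f y\<bar> \<partial>lebesgue)"
        using less_maximal_iff[of "2 * T k" f x] T[of k] by auto
      have p: "0 < T k * l ^ CARD('n)" using T[of k] al(1) by simp
      have "(\<integral>\<^sup>+y\<in>cube a l. ennreal \<bar>f y\<bar> \<partial>lebesgue) \<le> (\<integral>\<^sup>+y. ennreal (fk k y) * indicator (cube a l) y + ennreal (T k) * indicator (cube a l) y \<partial>lebesgue)"
      proof (rule nn_integral_mono)
        fix y
        have "\<bar>f y\<bar> \<le> fk k y + T k" using T[of k] by (simp add: fk_def)
        then have "ennreal \<bar>f y\<bar> \<le> ennreal (fk k y) + ennreal (T k)"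
          using T[of k] by (subst ennreal_plus[symmetric]) (auto simp: fk_def intro: ennreal_leI)
        then show "ennreal \<bar>f y\<bar> * indicator (cube a l) y \<le> ennreal (fk k y) * indicator (cube a l) y + ennreal (T k) * indicator (cube a l) y"
          by (simp add: indicator_def)
      qed
      also have "\<dots> = (\<integral>\<^sup>+y\<in>cube a l. ennreal (fk k y) \<partial>lebesgue) + ennreal (T k * l ^ CARD('n))"
        using al(1) T[of k] by (subst nn_integral_add) (simp_all add: nn_integral_cmult_indicator emeasure_cube ennreal_mult)
      finally have lt2: "ennreal (2 * T k * l ^ CARD('n)) < (\<integral>\<^sup>+y\<in>cube a l. ennreal (fk k y) \<partial>lebesgue) + ennreal (T k * l ^ CARD('n))"
        using al(3) by (rule order.strict_trans2[rotated])
      have lt: "ennreal (T k * l ^ CARD('n)) < (\<integral>\<^sup>+y\<in>cube a l. ennreal (fk k y) \<partial>lebesgue)"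
      proof (cases "\<integral>\<^sup>+y\<in>cube a l. ennreal (fk k y) \<partial>lebesgue")
        case (real R)
        then show ?thesis using p lt2
          by (simp add: ennreal_plus[symmetric] ennreal_less_iff del: ennreal_plus)
      qed simp
      have q: "0 < T k powr (1 / \<tau> - 1)" using T[of k] by simp
      have Teq: "T k powr (1 / \<tau>) = T k * T k powr (1 / \<tau> - 1)"
        using T[of k] by (simp add: powr_diff)
      have "T k powr (1 / \<tau>) * l ^ CARD('n) = T k powr (1 / \<tau> - 1) * (T k * l ^ CARD('n))"
        unfolding Teq by (simp only: mult_ac)
      then have "ennreal (T k powr (1 / \<tau>) * l ^ CARD('n)) = ennreal (T k powr (1 / \<tau> - 1)) * ennreal (T k * l ^ CARD('n))"
        using p by (simp only: ennreal_mult''[OF less_imp_le])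
      also have "\<dots> < ennreal (T k powr (1 / \<tau> - 1)) * (\<integral>\<^sup>+y\<in>cube a l. ennreal (fk k y) \<partial>lebesgue)"
        by (rule ennreal_mult_strict_left_mono[OF lt]) (use q in auto)
      also have "\<dots> = (\<integral>\<^sup>+y\<in>cube a l. ennreal \<bar>h k y\<bar> \<partial>lebesgue)"
      proof -
        have "ennreal \<bar>h k y\<bar> = ennreal (T k powr (1 / \<tau> - 1)) * ennreal (fk k y)" for y
          using hnn[of k y] by (simp add: h_def ennreal_mult[symmetric] fk_def mult.commute)
        then show ?thesis by (simp add: mult.assoc nn_integral_cmult)
      qed
      finally have "ennreal (T k powr (1 / \<tau>)) < maximal (h k) x"
        using al(1,2) by (subst less_maximal_iff) auto
      then show "x \<in> {x. ennreal (T k powr (1 / \<tau>)) < maximal (h k) x}" by simp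
    qed
    have weak: "(\<integral>\<^sup>+x\<in>{x. ennreal (2 * T k) < maximal f x}. ennreal (\<Phi> x (T k)) \<partial>lebesgue) \<le> ennreal C1 * (\<integral>\<^sup>+x. ennreal (\<Phi> x (h k x powr \<tau>)) \<partial>lebesgue)" for k
    proof -
      have "(\<integral>\<^sup>+x\<in>{x. ennreal (2 * T k) < maximal f x}. ennreal (\<Phi> x (T k)) \<partial>lebesgue)
        \<le> (\<integral>\<^sup>+x\<in>{x. ennreal (T k powr (1 / \<tau>)) < maximal (h k) x}. ennreal (\<Phi> x ((T k powr (1 / \<tau>)) powr \<tau>)) \<partial>lebesgue)"
        by (rule nn_integral_mono) (use incl[of k] \<tau> T[of k] in \<open>auto simp: indicator_def powr_powr\<close>)
      also have "\<dots> \<le> ennreal C1 * (\<integral>\<^sup>+x. ennreal (\<Phi> x (h k x powr \<tau>)) \<partial>lebesgue)"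
        unfolding C1_def
        by (rule weak_type[OF growth_powr[OF g \<tau>(1)] caratheodory_powr[OF car] avg h_meas hnn _ mod_h]) (use T[of k] in simp)
      finally show ?thesis .
    qed
    have TPhi [measurable]: "(\<lambda>x. \<Phi> x (T k)) \<in> borel_measurable lebesgue" for k
      by (rule caratheodoryD[OF car]) (use T in \<open>simp_all add: less_imp_le\<close>)
    have hPhi [measurable]: "(\<lambda>x. \<Phi> x (h k x powr \<tau>)) \<in> borel_measurable lebesgue" for k
      by (rule caratheodoryD[OF car]) simp_all
    have "(\<integral>\<^sup>+x. extend (\<lambda>x t. ennreal (\<Phi> x t)) x (maximal f x) \<partial>lebesgue)
      \<le> (\<integral>\<^sup>+x. ennreal (4 powr d) * (\<integral>\<^sup>+k. ennreal (\<Phi> x (T k)) * indicator {x. ennreal (2 * T k) < maximal f x} x \<partial>count_space UNIV) \<partial>lebesgue)"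
    proof (rule nn_integral_mono)
      fix x
      have "indicator {k. ennreal (2 * T k) < maximal f x} k = (indicator {x. ennreal (2 * T k) < maximal f x} x :: ennreal)" for k
        by (simp add: indicator_def)
      then show "extend (\<lambda>x t. ennreal (\<Phi> x t)) x (maximal f x) \<le> ennreal (4 powr d) * (\<integral>\<^sup>+k. ennreal (\<Phi> x (T k)) * indicator {x. ennreal (2 * T k) < maximal f x} x \<partial>count_space UNIV)"
        using extend_le_dyadic_sum[OF g, of x "maximal f x"] unfolding T_def[symmetric] by simp
    qed
    also have "\<dots> = (\<integral>\<^sup>+x. (\<integral>\<^sup>+k. ennreal (4 powr d) * (ennreal (\<Phi> x (T k)) * indicator {x. ennreal (2 * T k) < maximal f x} x) \<partial>count_space UNIV) \<partial>lebesgue)"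
      by (simp add: nn_integral_cmult)
    also have "\<dots> = (\<integral>\<^sup>+k. (\<integral>\<^sup>+x. ennreal (4 powr d) * (ennreal (\<Phi> x (T k)) * indicator {x. ennreal (2 * T k) < maximal f x} x) \<partial>lebesgue) \<partial>count_space UNIV)"
      by (rule nn_integral_count_space_nn_integral) measurable
    also have "\<dots> = (\<integral>\<^sup>+k. ennreal (4 powr d) * (\<integral>\<^sup>+x\<in>{x. ennreal (2 * T k) < maximal f x}. ennreal (\<Phi> x (T k)) \<partial>lebesgue) \<partial>count_space UNIV)"
      by (intro nn_integral_cong nn_integral_cmult) measurable
    also have "\<dots> = ennreal (4 powr d) * (\<integral>\<^sup>+k. (\<integral>\<^sup>+x\<in>{x. ennreal (2 * T k) < maximal f x}. ennreal (\<Phi> x (T k)) \<partial>lebesgue) \<partial>count_space UNIV)"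
      by (rule nn_integral_cmult) simp
    also have "(\<integral>\<^sup>+k. (\<integral>\<^sup>+x\<in>{x. ennreal (2 * T k) < maximal f x}. ennreal (\<Phi> x (T k)) \<partial>lebesgue) \<partial>count_space UNIV)
      \<le> (\<integral>\<^sup>+k. ennreal C1 * (\<integral>\<^sup>+x. ennreal (\<Phi> x (h k x powr \<tau>)) \<partial>lebesgue) \<partial>count_space UNIV)"
      by (rule nn_integral_mono) (rule weak)
    also have "\<dots> = ennreal C1 * (\<integral>\<^sup>+k. (\<integral>\<^sup>+x. ennreal (\<Phi> x (h k x powr \<tau>)) \<partial>lebesgue) \<partial>count_space UNIV)"
      by (rule nn_integral_cmult) simp
    also have "(\<integral>\<^sup>+k. (\<integral>\<^sup>+x. ennreal (\<Phi> x (h k x powr \<tau>)) \<partial>lebesgue) \<partial>count_space UNIV)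
      = (\<integral>\<^sup>+x. (\<integral>\<^sup>+k. ennreal (\<Phi> x (h k x powr \<tau>)) \<partial>count_space UNIV) \<partial>lebesgue)"
      by (rule nn_integral_count_space_nn_integral[symmetric]) measurable
    also have "\<dots> \<le> (\<integral>\<^sup>+x. ennreal C2 * ennreal (\<Phi> x \<bar>f x\<bar>) \<partial>lebesgue)"
    proof (rule nn_integral_mono)
      fix x
      have \<Phi>f: "0 \<le> \<Phi> x \<bar>f x\<bar>" by (rule growth_nonneg[OF g]) simp
      show "(\<integral>\<^sup>+k. ennreal (\<Phi> x (h k x powr \<tau>)) \<partial>count_space UNIV) \<le> ennreal C2 * ennreal (\<Phi> x \<bar>f x\<bar>)"
      proof (cases "f x = 0")
        case True
        then have "h k x = 0" for k by (simp add: h_def fk_def)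
        then show ?thesis using growth_zero[OF g] by simp
      next
        case False
        have "(\<integral>\<^sup>+k. ennreal (\<Phi> x (h k x powr \<tau>)) \<partial>count_space UNIV)
          \<le> (\<integral>\<^sup>+k. (ennreal ((T k / \<bar>f x\<bar>) powr r) * indicator {k. T k < \<bar>f x\<bar>} k) * ennreal (\<Phi> x \<bar>f x\<bar>) \<partial>count_space UNIV)"
        proof (rule nn_integral_mono)
          fix k
          show "ennreal (\<Phi> x (h k x powr \<tau>)) \<le> (ennreal ((T k / \<bar>f x\<bar>) powr r) * indicator {k. T k < \<bar>f x\<bar>} k) * ennreal (\<Phi> x \<bar>f x\<bar>)"
            using hpow[of x k] unfolding ennreal_mult''[OF \<Phi>f, symmetric]
            by (cases "T k < \<bar>f x\<bar>") (simp_all add: ennreal_mult''[OF \<Phi>f, symmetric] ennreal_leI ennreal_neg)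
        qed
        also have "\<dots> = (\<integral>\<^sup>+k. ennreal ((T k / \<bar>f x\<bar>) powr r) * indicator {k. T k < \<bar>f x\<bar>} k \<partial>count_space UNIV) * ennreal (\<Phi> x \<bar>f x\<bar>)"
          by (rule nn_integral_multc) simp
        also have "\<dots> \<le> ennreal C2 * ennreal (\<Phi> x \<bar>f x\<bar>)"
          unfolding C2_def T_def by (rule mult_right_mono[OF geometric_int_bound[OF r]]) (use False in auto)
        finally show ?thesis .
      qed
    qed
    also have "\<dots> = ennreal C2 * (\<integral>\<^sup>+x. ennreal (\<Phi> x \<bar>f x\<bar>) \<partial>lebesgue)"
      by (rule nn_integral_cmult) simp
    finally have "(\<integral>\<^sup>+x. extend (\<lambda>x t. ennreal (\<Phi> x t)) x (maximal f x) \<partial>lebesgue)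
      \<le> ennreal (4 powr d) * (ennreal C1 * (ennreal C2 * (\<integral>\<^sup>+x. ennreal (\<Phi> x \<bar>f x\<bar>) \<partial>lebesgue)))"
      by (simp add: mult_left_mono)
    also have "\<dots> = ennreal C3 * (\<integral>\<^sup>+x. ennreal (\<Phi> x \<bar>f x\<bar>) \<partial>lebesgue)"
      using C1 C2 by (simp add: C3_def ennreal_mult mult.assoc)
    also have "\<dots> \<le> ennreal (C3 + 1) * (\<integral>\<^sup>+x. ennreal (\<Phi> x \<bar>f x\<bar>) \<partial>lebesgue)"
      by (intro mult_right_mono ennreal_leI) auto
    finally show "(\<integral>\<^sup>+x. extend (\<lambda>x t. ennreal (\<Phi> x t)) x (maximal f x) \<partial>lebesgue) \<le> ennreal (C3 + 1) * (\<integral>\<^sup>+x. ennreal (\<Phi> x \<bar>f x\<bar>) \<partial>lebesgue)" .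
  qed
qed

section \<open>The Muckenhoupt weights of a double phase function\<close>

text \<open>The weighted Young inequality for \<open>F / \<alpha>\<close> and
  \<open>G / \<beta>\<close> is integrated. Bounds replace the integrals themselves so that upper
  estimates can be inserted directly; a vanishing bound is treated first since the normalisation
  divides by it.\<close>

lemma holder_nn_integral:
  fixes F G :: "'a \<Rightarrow> real"
  assumes [measurable]: "F \<in> borel_measurable M" "G \<in> borel_measurable M" "S \<in> sets M"
    and FG: "\<And>x. x \<in> S \<Longrightarrow> 0 \<le> F x" "\<And>x. x \<in> S \<Longrightarrow> 0 \<le> G x"
    and \<theta>: "0 < \<theta>" "\<theta> < 1" and \<alpha>\<beta>: "0 \<le> \<alpha>" "0 \<le> \<beta>"
    and F: "(\<integral>\<^sup>+x\<in>S. ennreal (F x) \<partial>M) \<le> ennreal \<alpha>" and G: "(\<integral>\<^sup>+x\<in>S. ennreal (G x) \<partial>M) \<le> ennreal \<beta>"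
  shows "(\<integral>\<^sup>+x\<in>S. ennreal (F x powr \<theta> * G x powr (1 - \<theta>)) \<partial>M) \<le> ennreal (\<alpha> powr \<theta> * \<beta> powr (1 - \<theta>))"
proof (cases "\<alpha> = 0 \<or> \<beta> = 0")
  case True
  have "(\<integral>\<^sup>+x\<in>S. ennreal (F x powr \<theta> * G x powr (1 - \<theta>)) \<partial>M) = 0"
    using True
  proof
    assume "\<alpha> = 0"
    then have "AE x in M. ennreal (F x) * indicator S x = 0"
      using F by (subst nn_integral_0_iff_AE[symmetric]) auto
    then have "AE x in M. ennreal (F x powr \<theta> * G x powr (1 - \<theta>)) * indicator S x = 0"
    proof eventually_elim
      case (elim x)
      show ?case
      proof (cases "x \<in> S")
        case True
        then have "F x = 0" using elim FG(1)[OF True] by (simp add: ennreal_eq_0_iff)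
        then show ?thesis by simp
      qed simp
    qed
    then show ?thesis by (subst nn_integral_0_iff_AE) auto
  next
    assume "\<beta> = 0"
    then have "AE x in M. ennreal (G x) * indicator S x = 0"
      using G by (subst nn_integral_0_iff_AE[symmetric]) auto
    then have "AE x in M. ennreal (F x powr \<theta> * G x powr (1 - \<theta>)) * indicator S x = 0"
    proof eventually_elim
      case (elim x)
      show ?case
      proof (cases "x \<in> S")
        case True
        then have "G x = 0" using elim FG(2)[OF True] by (simp add: ennreal_eq_0_iff)
        then show ?thesis by simp
      qed simp
    qed
    then show ?thesis by (subst nn_integral_0_iff_AE) auto
  qed
  then show ?thesis by simp
next
  case False
  then have pos: "0 < \<alpha>" "0 < \<beta>" using \<alpha>\<beta> by auto
  define c where "c = \<alpha> powr \<theta> * \<beta> powr (1 - \<theta>)"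
  have c: "0 < c" using pos by (simp add: c_def)
  have pw: "F x powr \<theta> * G x powr (1 - \<theta>) \<le> c * (\<theta> / \<alpha>) * F x + c * ((1 - \<theta>) / \<beta>) * G x" if "x \<in> S" for x
  proof (cases "F x = 0 \<or> G x = 0")
    case True
    then show ?thesis using FG[OF that] c pos \<theta> by auto
  next
    case nz: False
    then have fg: "0 < F x / \<alpha>" "0 < G x / \<beta>" using FG[OF that] pos by auto
    have "F x powr \<theta> * G x powr (1 - \<theta>) = c * ((F x / \<alpha>) powr \<theta> * (G x / \<beta>) powr (1 - \<theta>))"
      using pos FG[OF that] by (simp add: c_def powr_divide)
    also have "\<dots> \<le> c * (\<theta> * (F x / \<alpha>) + (1 - \<theta>) * (G x / \<beta>))"
      using \<theta> c fg by (intro mult_left_mono Youngs_inequality_0) auto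
    finally show ?thesis by (simp add: algebra_simps)
  qed
  have "(\<integral>\<^sup>+x\<in>S. ennreal (F x powr \<theta> * G x powr (1 - \<theta>)) \<partial>M)
    \<le> (\<integral>\<^sup>+x. ennreal (c * (\<theta> / \<alpha>)) * (ennreal (F x) * indicator S x) + ennreal (c * ((1 - \<theta>) / \<beta>)) * (ennreal (G x) * indicator S x) \<partial>M)"
  proof (rule nn_integral_mono)
    fix x
    show "ennreal (F x powr \<theta> * G x powr (1 - \<theta>)) * indicator S x
      \<le> ennreal (c * (\<theta> / \<alpha>)) * (ennreal (F x) * indicator S x) + ennreal (c * ((1 - \<theta>) / \<beta>)) * (ennreal (G x) * indicator S x)"
    proof (cases "x \<in> S")
      case True
      have n: "0 \<le> c * (\<theta> / \<alpha>)" "0 \<le> c * ((1 - \<theta>) / \<beta>)" using c pos \<theta> by auto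
      have "ennreal (F x powr \<theta> * G x powr (1 - \<theta>)) \<le> ennreal (c * (\<theta> / \<alpha>) * F x + c * ((1 - \<theta>) / \<beta>) * G x)"
        by (rule ennreal_leI[OF pw[OF True]])
      also have "\<dots> = ennreal (c * (\<theta> / \<alpha>) * F x) + ennreal (c * ((1 - \<theta>) / \<beta>) * G x)"
        by (rule ennreal_plus[OF mult_nonneg_nonneg[OF n(1) FG(1)[OF True]] mult_nonneg_nonneg[OF n(2) FG(2)[OF True]]])
      also have "\<dots> = ennreal (c * (\<theta> / \<alpha>)) * ennreal (F x) + ennreal (c * ((1 - \<theta>) / \<beta>)) * ennreal (G x)"
        by (simp only: ennreal_mult''[OF FG(1)[OF True]] ennreal_mult''[OF FG(2)[OF True]])
      finally show ?thesis using True by simp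
    qed simp
  qed
  also have "\<dots> = ennreal (c * (\<theta> / \<alpha>)) * (\<integral>\<^sup>+x\<in>S. ennreal (F x) \<partial>M) + ennreal (c * ((1 - \<theta>) / \<beta>)) * (\<integral>\<^sup>+x\<in>S. ennreal (G x) \<partial>M)"
    by (subst nn_integral_add) (simp_all add: nn_integral_cmult)
  also have "\<dots> \<le> ennreal (c * (\<theta> / \<alpha>)) * ennreal \<alpha> + ennreal (c * ((1 - \<theta>) / \<beta>)) * ennreal \<beta>"
    by (intro add_mono mult_left_mono F G) auto
  also have "\<dots> = ennreal (c * (\<theta> / \<alpha>) * \<alpha> + c * ((1 - \<theta>) / \<beta>) * \<beta>)"
    using pos \<theta> c by (simp add: ennreal_mult''[symmetric] ennreal_plus[symmetric] del: ennreal_plus)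
  also have "c * (\<theta> / \<alpha>) * \<alpha> + c * ((1 - \<theta>) / \<beta>) * \<beta> = c" using pos by (simp add: field_simps)
  finally show ?thesis unfolding c_def .
qed

text \<open>Since \<open>w powr (1 / r) * v powr (1 - 1 / r) = 1\<close>, Hoelder bounds the measure
  of \<open>E\<close> by the mass of \<open>w\<close> on \<open>E\<close> to the power
  \<open>1 / r\<close> times \<open>\<beta> powr (1 - 1 / r)\<close>. The \<open>r\<close>-th power
  of this is compared with the condition on \<open>Q\<close>, and
  \<open>\<beta> powr (r - 1)\<close> cancels. So half of a cube carries a fixed share of the
  weight, which is what the reverse Hoelder inequality starts from.\<close>

lemma muckenhoupt_subset:
  fixes w v :: "'a \<Rightarrow> real"
  assumes [measurable]: "w \<in> borel_measurable M" "v \<in> borel_measurable M" "Q \<in> sets M" "E \<in> sets M"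
    and w: "\<And>x. 0 < w x" and v: "\<And>x. v x = w x powr (- (1 / (r - 1)))" and r: "1 < r"
    and A: "(\<integral>\<^sup>+x\<in>Q. ennreal (w x) \<partial>M) \<le> ennreal \<alpha>" "(\<integral>\<^sup>+x\<in>Q. ennreal (v x) \<partial>M) \<le> ennreal \<beta>"
      "\<alpha> * \<beta> powr (r - 1) \<le> C * m powr r" "0 \<le> \<alpha>" "0 \<le> \<beta>" "0 \<le> C"
    and m: "emeasure M Q = ennreal m" "0 < m"
    and E: "E \<subseteq> Q" "emeasure M Q \<le> 2 * emeasure M E"
  shows "(\<integral>\<^sup>+x\<in>Q. ennreal (w x) \<partial>M) \<le> ennreal (C * 2 powr r) * (\<integral>\<^sup>+x\<in>E. ennreal (w x) \<partial>M)"
proof -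
  have "(\<integral>\<^sup>+x\<in>E. ennreal (w x) \<partial>M) \<le> (\<integral>\<^sup>+x\<in>Q. ennreal (w x) \<partial>M)"
    by (rule nn_integral_mono) (use E in \<open>auto simp: indicator_def\<close>)
  also note A(1)
  finally obtain e where e: "(\<integral>\<^sup>+x\<in>E. ennreal (w x) \<partial>M) = ennreal e" "0 \<le> e"
    by (cases "\<integral>\<^sup>+x\<in>E. ennreal (w x) \<partial>M") (auto simp: top_unique)
  have "(\<integral>\<^sup>+x\<in>E. ennreal (v x) \<partial>M) \<le> (\<integral>\<^sup>+x\<in>Q. ennreal (v x) \<partial>M)"
    by (rule nn_integral_mono) (use E in \<open>auto simp: indicator_def\<close>)
  also note A(2)
  finally have vE: "(\<integral>\<^sup>+x\<in>E. ennreal (v x) \<partial>M) \<le> ennreal \<beta>" .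
  have "emeasure M E \<le> emeasure M Q" using E(1) by (rule emeasure_mono) simp
  then obtain \<mu> where \<mu>: "emeasure M E = ennreal \<mu>" "0 \<le> \<mu>"
    unfolding m(1) by (cases "emeasure M E") (auto simp: top_unique)
  have "ennreal m \<le> ennreal (2 * \<mu>)"
    using E(2) ennreal_mult''[OF \<mu>(2), of 2] unfolding m(1) \<mu>(1) by (simp only: ennreal_numeral)
  then have m\<mu>: "m \<le> 2 * \<mu>" using \<mu>(2) by (simp add: ennreal_le_iff)
  have one: "w x powr (1 / r) * v x powr (1 - 1 / r) = 1" for x
  proof -
    have "- (1 / (r - 1)) * (1 - 1 / r) = - (1 / r)" using r by (simp add: divide_simps)
    then have "v x powr (1 - 1 / r) = w x powr (- (1 / r))" by (simp only: v powr_powr)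
    then show ?thesis using w[of x] by (simp add: powr_minus)
  qed
  have "ennreal \<mu> = (\<integral>\<^sup>+x\<in>E. ennreal (w x powr (1 / r) * v x powr (1 - 1 / r)) \<partial>M)"
    unfolding one \<mu>(1)[symmetric] by simp
  also have "\<dots> \<le> ennreal (e powr (1 / r) * \<beta> powr (1 - 1 / r))"
    by (rule holder_nn_integral) (use w v r e vE A in \<open>auto simp: less_imp_le\<close>)
  finally have "\<mu> \<le> e powr (1 / r) * \<beta> powr (1 - 1 / r)" by (simp add: ennreal_le_iff)
  then have "\<mu> powr r \<le> (e powr (1 / r) * \<beta> powr (1 - 1 / r)) powr r"
    using \<mu>(2) r by (intro powr_mono2) auto
  also have "\<dots> = e * \<beta> powr (r - 1)"
  proof -
    have "(1 - 1 / r) * r = r - 1" using r by (simp add: field_simps)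
    then show ?thesis using e(2) r by (simp add: powr_mult powr_powr)
  qed
  finally have \<mu>r: "\<mu> powr r \<le> e * \<beta> powr (r - 1)" .
  have "m powr r \<le> (2 * \<mu>) powr r" using m\<mu> m(2) r by (intro powr_mono2) auto
  also have "\<dots> = 2 powr r * \<mu> powr r" using \<mu>(2) by (simp add: powr_mult)
  also have "\<dots> \<le> 2 powr r * (e * \<beta> powr (r - 1))" by (rule mult_left_mono[OF \<mu>r]) simp
  finally have mr: "m powr r \<le> 2 powr r * e * \<beta> powr (r - 1)" by (simp add: mult_ac)
  have "\<alpha> * \<beta> powr (r - 1) \<le> C * (2 powr r * e * \<beta> powr (r - 1))"
    using A(3) mult_left_mono[OF mr A(6)] by linarith
  moreover have "0 < \<beta> powr (r - 1)"
  proof (rule ccontr)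
    assume "\<not> 0 < \<beta> powr (r - 1)"
    then have "\<beta> powr (r - 1) = 0" by (simp add: powr_eq_0_iff)
    then have "m powr r \<le> 0" using mr by simp
    then show False using m(2) by simp
  qed
  ultimately have "\<alpha> \<le> C * 2 powr r * e" by (simp add: mult.assoc[symmetric])
  then have "ennreal \<alpha> \<le> ennreal (C * 2 powr r) * ennreal e"
    unfolding ennreal_mult''[OF e(2), symmetric] by (rule ennreal_leI)
  then show ?thesis unfolding e(1) using A(1) by (rule order_trans[rotated])
qed

section \<open>Truncated weights and the growth of the two integrands\<close>

locale double_phase_setting =
  fixes p q :: real and a :: "real ^ 'n \<Rightarrow> real"
  assumes p: "1 < p" and pq: "p < q" and a_meas [measurable]: "a \<in> borel_measurable lebesgue"
    and a_nonneg: "0 \<le> a x"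
begin

text \<open>\<open>D\<close> is comparable to the conjugate function, that is, to the minimum of \<open>s\<close> to the power \<open>p / (p - 1)\<close> and
  \<open>a powr (- b)\<close> times \<open>s\<close> to the power \<open>q / (q - 1) = 1 + b\<close>. Writing it with the truncated weight \<open>W\<close> avoids the
  junk value \<open>0 powr (- b) = 0\<close> where \<open>a\<close> vanishes.\<close>

definition b :: real where "b = 1 / (q - 1)"

text \<open>The exponent of \<open>kap\<close> comes from
  \<open>u powr (p - 1) = s = a * u powr (q - 1)\<close>: the first equation determines
  \<open>u\<close>, the second then gives
  \<open>a = s powr (1 - (q - 1) / (p - 1)) = s powr (- e)\<close>.\<close>

definition e :: real where "e = (q - p) / (p - 1)"

definition kap :: "real \<Rightarrow> real" where "kap s = s powr (- e)"

definition W :: "real \<Rightarrow> real ^ 'n \<Rightarrow> real" where "W s x = max (a x) (kap s)"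

definition V :: "real \<Rightarrow> real ^ 'n \<Rightarrow> real" where "V s x = W s x powr (- b)"

definition D :: "real ^ 'n \<Rightarrow> real \<Rightarrow> real" where "D x s = s powr (1 + b) * V s x"

definition H :: "real ^ 'n \<Rightarrow> real \<Rightarrow> real" where "H x t = t powr p + a x * t powr q"

lemma q: "1 < q" using p pq by simp

lemma b: "0 < b" using q by (simp add: b_def)

lemma e: "0 < e" using p pq by (simp add: e_def)

lemma exp_b: "b * (q - 1) = 1" "(1 + b) * (q - 1) = q" "q * b = 1 + b"
  using q by (simp_all add: b_def field_simps)

text \<open>By the last identity, inserting \<open>kap s\<close> as the weight in \<open>D\<close>
  changes the exponent conjugate to \<open>q\<close> into the one conjugate to
  \<open>p\<close>.\<close>

lemma exp_e: "1 + e = (q - 1) / (p - 1)" "e * b + b = 1 / (p - 1)" "1 + b + e * b = p / (p - 1)"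
  using p q by (simp_all add: b_def e_def divide_simps) (simp_all add: algebra_simps)

lemma kap_pos: "0 < s \<Longrightarrow> 0 < kap s" by (simp add: kap_def)

lemma kap_antimono: "0 < s \<Longrightarrow> s \<le> t \<Longrightarrow> kap t \<le> kap s"
  using e by (simp add: kap_def powr_mono2')

lemma W_pos: "0 < s \<Longrightarrow> 0 < W s x" using kap_pos[of s] by (simp add: W_def max_def)

lemma W_antimono: "0 < s \<Longrightarrow> s \<le> t \<Longrightarrow> W t x \<le> W s x"
  using kap_antimono[of s t] by (auto simp: W_def)

lemma V_pos: "0 < s \<Longrightarrow> 0 < V s x" using W_pos[of s x] by (simp add: V_def)

lemma V_mono: "0 < s \<Longrightarrow> s \<le> t \<Longrightarrow> V s x \<le> V t x"
  unfolding V_def using W_antimono[of s t x] W_pos[of t x] b by (intro powr_mono2') auto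

lemma V_le_kap: "0 < s \<Longrightarrow> V s x \<le> kap s powr (- b)"
  unfolding V_def using kap_pos[of s] b by (intro powr_mono2') (auto simp: W_def)

lemma W_measurable [measurable]: "W s \<in> borel_measurable lebesgue"
  unfolding W_def by measurable

lemma V_measurable [measurable]: "V s \<in> borel_measurable lebesgue"
  unfolding V_def by measurable

lemma D_nonneg: "0 \<le> D x s" by (simp add: D_def V_def)

lemma D_le_powr: "0 \<le> s \<Longrightarrow> D x s \<le> s powr (p / (p - 1))"
proof (cases "s = 0")
  case False
  assume "0 \<le> s"
  then have s: "0 < s" using False by simp
  have "D x s \<le> s powr (1 + b) * kap s powr (- b)"
    unfolding D_def by (rule mult_left_mono[OF V_le_kap[OF s]]) simp
  also have "\<dots> = s powr (1 + b + e * b)" using s by (simp add: kap_def powr_powr powr_add)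
  finally show ?thesis by (simp add: exp_e)
qed (simp add: D_def)

lemma D_eq_powr: "0 < s \<Longrightarrow> a x \<le> kap s \<Longrightarrow> D x s = s powr (p / (p - 1))"
proof -
  assume s: "0 < s" "a x \<le> kap s"
  have "D x s = s powr (1 + b) * kap s powr (- b)" using s by (simp add: D_def V_def W_def max_def)
  also have "\<dots> = s powr (1 + b + e * b)" using s by (simp add: kap_def powr_powr powr_add)
  finally show ?thesis by (simp add: exp_e)
qed

text \<open>Conjugation reverses the exponents: those of \<open>D\<close> are conjugate to
  \<open>q\<close> and to \<open>p\<close>. The lower one comes from the monotonicity of
  \<open>V\<close> in its parameter, the upper one from
  \<open>W (\<theta> * t) x \<le> \<theta> powr (- e) * W t x\<close>, since \<open>kap\<close>
  scales by exactly this factor, which is at least 1.\<close>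

lemma D_growth: "growth D (1 + b) (p / (p - 1))"
  unfolding growth_def
proof (intro conjI allI impI)
  show "0 < 1 + b" using b by simp
  show "0 < p / (p - 1)" using p by simp
  show "0 \<le> D x t" for x t by (rule D_nonneg)
  show "0 < D x 1" for x using V_pos[of 1 x] by (simp add: D_def)
  fix x and t \<theta> :: real assume t: "0 \<le> t" and \<theta>: "0 \<le> \<theta>" "\<theta> \<le> 1"
  show "D x (\<theta> * t) \<le> \<theta> powr (1 + b) * D x t"
  proof (cases "\<theta> = 0 \<or> t = 0")
    case False
    then have pos: "0 < \<theta>" "0 < t" using t \<theta> by auto
    have "V (\<theta> * t) x \<le> V t x" using pos \<theta> by (intro V_mono) (auto simp: mult_le_cancel_right1)
    then have "(\<theta> * t) powr (1 + b) * V (\<theta> * t) x \<le> (\<theta> * t) powr (1 + b) * V t x" by (rule mult_left_mono) simp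
    then show ?thesis using pos by (simp add: D_def powr_mult mult_ac)
  qed (auto simp: D_def)
  show "\<theta> powr (p / (p - 1)) * D x t \<le> D x (\<theta> * t)"
  proof (cases "\<theta> = 0 \<or> t = 0")
    case False
    then have pos: "0 < \<theta>" "0 < t" using t \<theta> by auto
    have "1 \<le> \<theta> powr (- e)" using pos \<theta> e by (simp add: powr_minus powr_le1 one_le_inverse_iff)
    then have "a x * 1 \<le> a x * \<theta> powr (- e)" using a_nonneg[of x] by (rule mult_left_mono)
    then have "W (\<theta> * t) x \<le> \<theta> powr (- e) * W t x"
      using pos by (auto simp: W_def kap_def powr_mult max_def mult_ac)
        (metis mult.commute mult_left_mono order_trans powr_ge_zero linear)+
    then have "(\<theta> powr (- e) * W t x) powr (- b) \<le> V (\<theta> * t) x"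
      unfolding V_def using W_pos[of "\<theta> * t" x] pos b by (intro powr_mono2') auto
    then have "\<theta> powr (e * b) * V t x \<le> V (\<theta> * t) x"
      using pos W_pos[of t x] by (simp add: V_def powr_mult powr_powr)
    then have "(\<theta> * t) powr (1 + b) * (\<theta> powr (e * b) * V t x) \<le> (\<theta> * t) powr (1 + b) * V (\<theta> * t) x"
      by (rule mult_left_mono) simp
    moreover have "(\<theta> * t) powr (1 + b) * (\<theta> powr (e * b) * V t x) = \<theta> powr (1 + b + e * b) * D x t"
      using pos by (simp add: D_def powr_mult powr_add mult_ac)
    ultimately show ?thesis by (simp add: D_def exp_e)
  qed (use p in \<open>auto simp: D_def\<close>)
qed

lemma D_caratheodory: "caratheodory D"
  unfolding caratheodory_def
proof (intro ballI impI)
  fix u :: "real ^ 'n \<Rightarrow> real" assume [measurable]: "u \<in> borel_measurable lebesgue"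
  show "(\<lambda>x. D x (u x)) \<in> borel_measurable lebesgue"
    unfolding D_def V_def W_def kap_def by measurable
qed

lemma H_nonneg: "0 \<le> H x t" using a_nonneg[of x] by (simp add: H_def)

lemma H_growth: "growth H p q"
  unfolding growth_def
proof (intro conjI allI impI)
  show "0 < p" "0 < q" using p q by auto
  show "0 \<le> H x t" for x t by (rule H_nonneg)
  show "0 < H x 1" for x using a_nonneg[of x] by (simp add: H_def)
  fix x and t \<theta> :: real assume t: "0 \<le> t" and \<theta>: "0 \<le> \<theta>" "\<theta> \<le> 1"
  have le: "\<theta> powr q \<le> \<theta> powr p" using \<theta> pq by (cases "\<theta> = 0") (auto intro!: powr_mono')
  have "\<theta> powr q * (a x * t powr q) \<le> \<theta> powr p * (a x * t powr q)"
    using le a_nonneg[of x] by (intro mult_right_mono) auto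
  then show "H x (\<theta> * t) \<le> \<theta> powr p * H x t"
    using t \<theta> by (simp add: H_def powr_mult algebra_simps)
  have "\<theta> powr q * t powr p \<le> \<theta> powr p * t powr p" using le by (rule mult_right_mono) simp
  then show "\<theta> powr q * H x t \<le> H x (\<theta> * t)"
    using t \<theta> by (simp add: H_def powr_mult algebra_simps)
qed

lemma H_caratheodory: "caratheodory H"
  unfolding caratheodory_def
proof (intro ballI impI)
  fix u :: "real ^ 'n \<Rightarrow> real" assume [measurable]: "u \<in> borel_measurable lebesgue"
  show "(\<lambda>x. H x (u x)) \<in> borel_measurable lebesgue"
    unfolding H_def by measurable
qed

text \<open>Class A in terms of \<open>D\<close>: here \<open>1 / s\<close> stands for the norm of the indicator of the cube with respect to
  the conjugate.\<close>

definition balanced :: "real \<Rightarrow> bool" where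
  "balanced C \<longleftrightarrow> 0 \<le> C \<and> (\<forall>c l. 0 < l \<longrightarrow> (\<exists>s>0. (\<integral>\<^sup>+x\<in>cube c l. ennreal (D x s) \<partial>lebesgue) \<le> 1 \<and>
    (\<integral>\<^sup>+x\<in>cube c l. ennreal (a x) \<partial>lebesgue) \<le> ennreal (C * (s * l ^ CARD('n)) powr q)))"

section \<open>The Muckenhoupt condition for the truncated weights\<close>

lemma V_integral_le:
  assumes s: "0 < s" and Q [measurable]: "Q \<in> sets lebesgue"
    and le: "(\<integral>\<^sup>+x\<in>Q. ennreal (D x s) \<partial>lebesgue) \<le> 1"
  shows "(\<integral>\<^sup>+x\<in>Q. ennreal (V s x) \<partial>lebesgue) \<le> ennreal (s powr (- (1 + b)))"
proof -
  have "ennreal (V s x) = ennreal (s powr (- (1 + b))) * ennreal (D x s)" for x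
  proof -
    have "s powr (- (1 + b)) * s powr (1 + b) = 1" using s by (simp only: powr_add[symmetric]) simp
    then have "V s x = s powr (- (1 + b)) * D x s" by (simp add: D_def mult.assoc[symmetric])
    then show ?thesis by (simp only: ennreal_mult''[OF D_nonneg])
  qed
  then have "(\<integral>\<^sup>+x\<in>Q. ennreal (V s x) \<partial>lebesgue) = (\<integral>\<^sup>+x. ennreal (s powr (- (1 + b))) * (ennreal (D x s) * indicator Q x) \<partial>lebesgue)"
    by (simp add: mult.assoc)
  also have "\<dots> = ennreal (s powr (- (1 + b))) * (\<integral>\<^sup>+x\<in>Q. ennreal (D x s) \<partial>lebesgue)"
    by (rule nn_integral_cmult) (simp add: D_def)
  also have "\<dots> \<le> ennreal (s powr (- (1 + b))) * 1" by (rule mult_left_mono[OF le]) simp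
  finally show ?thesis by simp
qed

text \<open>\<open>balanced\<close> supplies a single \<open>s0\<close>, whereas the condition is
  claimed for every admissible \<open>s\<close>. The larger of the two is again admissible and
  \<open>V\<close> increases with its parameter, so the mass of \<open>V s\<close> is at most
  \<open>s1 powr (- (1 + b))\<close>, which absorbs the power of \<open>s0\<close> in the bound for
  \<open>a\<close>. The term \<open>kap s\<close> in \<open>W\<close> is paired with the pointwise
  bound \<open>V_le_kap\<close> and accounts for the 1 in \<open>C + 1\<close>.\<close>

lemma muckenhoupt:
  assumes C: "balanced C" and s: "0 < s" and l: "0 < l"
    and le: "(\<integral>\<^sup>+x\<in>cube c l. ennreal (D x s) \<partial>lebesgue) \<le> 1"
  obtains \<alpha> \<beta> where "0 < \<alpha>" "0 < \<beta>" "(\<integral>\<^sup>+x\<in>cube c l. ennreal (W s x) \<partial>lebesgue) = ennreal \<alpha>"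
    "(\<integral>\<^sup>+x\<in>cube c l. ennreal (V s x) \<partial>lebesgue) = ennreal \<beta>"
    "\<alpha> * \<beta> powr (q - 1) \<le> (C + 1) * (l ^ CARD('n)) powr q"
proof -
  define m where "m = l ^ CARD('n)"
  have m: "0 < m" using l by (simp add: m_def)
  have em: "emeasure lebesgue (cube c l) = ennreal m" unfolding m_def by (rule emeasure_cube) (use l in simp)
  have C0: "0 \<le> C" using C by (simp add: balanced_def)
  obtain s0 where s0: "0 < s0" "(\<integral>\<^sup>+x\<in>cube c l. ennreal (D x s0) \<partial>lebesgue) \<le> 1"
    "(\<integral>\<^sup>+x\<in>cube c l. ennreal (a x) \<partial>lebesgue) \<le> ennreal (C * (s0 * m) powr q)"
    using C l unfolding balanced_def m_def by blast
  define s1 where "s1 = max s s0"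
  have s1: "0 < s1" "s \<le> s1" "s0 \<le> s1" "(\<integral>\<^sup>+x\<in>cube c l. ennreal (D x s1) \<partial>lebesgue) \<le> 1"
    using s s0 le by (auto simp: s1_def max_def)
  have "(\<integral>\<^sup>+x\<in>cube c l. ennreal (W s x) \<partial>lebesgue) \<le> (\<integral>\<^sup>+x. ennreal (a x) * indicator (cube c l) x + ennreal (kap s) * indicator (cube c l) x \<partial>lebesgue)"
  proof (rule nn_integral_mono)
    fix x
    have "ennreal (W s x) \<le> ennreal (a x + kap s)"
      using a_nonneg[of x] kap_pos[OF s] by (intro ennreal_leI) (auto simp: W_def)
    also have "\<dots> = ennreal (a x) + ennreal (kap s)"
      using a_nonneg[of x] kap_pos[OF s] by (intro ennreal_plus) auto
    finally show "ennreal (W s x) * indicator (cube c l) x \<le> ennreal (a x) * indicator (cube c l) x + ennreal (kap s) * indicator (cube c l) x"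
      by (simp add: indicator_def)
  qed
  also have "\<dots> = (\<integral>\<^sup>+x\<in>cube c l. ennreal (a x) \<partial>lebesgue) + ennreal (kap s * m)"
    using m kap_pos[OF s] by (subst nn_integral_add) (simp_all add: nn_integral_cmult_indicator em ennreal_mult)
  also have "\<dots> \<le> ennreal (C * (s0 * m) powr q) + ennreal (kap s * m)" by (rule add_right_mono[OF s0(3)])
  also have "\<dots> = ennreal (C * (s0 * m) powr q + kap s * m)"
    using C0 m kap_pos[OF s] by (intro ennreal_plus[symmetric]) auto
  finally have Wle: "(\<integral>\<^sup>+x\<in>cube c l. ennreal (W s x) \<partial>lebesgue) \<le> ennreal (C * (s0 * m) powr q + kap s * m)" .
  then obtain \<alpha> where \<alpha>: "(\<integral>\<^sup>+x\<in>cube c l. ennreal (W s x) \<partial>lebesgue) = ennreal \<alpha>" "0 \<le> \<alpha>"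
    by (cases "\<integral>\<^sup>+x\<in>cube c l. ennreal (W s x) \<partial>lebesgue") (auto simp: top_unique)
  have \<alpha>le: "\<alpha> \<le> C * (s0 * m) powr q + kap s * m"
    using Wle C0 m kap_pos[OF s] unfolding \<alpha>(1) by (subst (asm) ennreal_le_iff) auto
  have V1: "(\<integral>\<^sup>+x\<in>cube c l. ennreal (V s x) \<partial>lebesgue) \<le> ennreal (s1 powr (- (1 + b)))"
  proof -
    have "(\<integral>\<^sup>+x\<in>cube c l. ennreal (V s x) \<partial>lebesgue) \<le> (\<integral>\<^sup>+x\<in>cube c l. ennreal (V s1 x) \<partial>lebesgue)"
      by (intro nn_integral_mono mult_right_mono ennreal_leI V_mono s s1) simp
    also have "\<dots> \<le> ennreal (s1 powr (- (1 + b)))" by (rule V_integral_le[OF s1(1) _ s1(4)]) simp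
    finally show ?thesis .
  qed
  then obtain \<beta> where \<beta>: "(\<integral>\<^sup>+x\<in>cube c l. ennreal (V s x) \<partial>lebesgue) = ennreal \<beta>" "0 \<le> \<beta>"
    by (cases "\<integral>\<^sup>+x\<in>cube c l. ennreal (V s x) \<partial>lebesgue") (auto simp: top_unique)
  have \<beta>1: "\<beta> \<le> s1 powr (- (1 + b))" using V1 unfolding \<beta>(1) by (simp add: ennreal_le_iff)
  have \<beta>2: "\<beta> \<le> kap s powr (- b) * m"
  proof -
    have "(\<integral>\<^sup>+x\<in>cube c l. ennreal (V s x) \<partial>lebesgue) \<le> (\<integral>\<^sup>+x\<in>cube c l. ennreal (kap s powr (- b)) \<partial>lebesgue)"
      by (intro nn_integral_mono mult_right_mono ennreal_leI V_le_kap s) simp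
    also have "\<dots> = ennreal (kap s powr (- b) * m)"
      using m by (simp add: nn_integral_cmult_indicator em ennreal_mult)
    finally show ?thesis unfolding \<beta>(1) using m by (simp add: ennreal_le_iff)
  qed
  have zero_imp: False if "(\<integral>\<^sup>+x\<in>cube c l. ennreal (f x) \<partial>lebesgue) = 0" "\<And>x. 0 < f x" "f \<in> borel_measurable lebesgue" for f
  proof -
    have [measurable]: "f \<in> borel_measurable lebesgue" by (rule that(3))
    have "AE x in lebesgue. ennreal (f x) * indicator (cube c l) x = 0"
      using that(1) by (subst nn_integral_0_iff_AE[symmetric]) auto
    then have "AE x in lebesgue. x \<notin> cube c l"
    proof eventually_elim
      case (elim x)
      then show ?case using that(2)[of x] by (auto simp: indicator_def ennreal_eq_0_iff)
    qed
    then have "emeasure lebesgue (cube c l) = 0"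
      using AE_iff_null_sets[of "cube c l" lebesgue] by auto
    then show False using em m by simp
  qed
  have "0 < \<alpha>" using \<alpha> zero_imp[of "W s"] W_pos[OF s] by (cases "\<alpha> = 0") auto
  moreover have "0 < \<beta>" using \<beta> zero_imp[of "V s"] V_pos[OF s] by (cases "\<beta> = 0") auto
  moreover have "\<alpha> * \<beta> powr (q - 1) \<le> (C + 1) * m powr q"
  proof -
    have B1: "\<beta> powr (q - 1) \<le> s1 powr (- q)"
    proof -
      have "\<beta> powr (q - 1) \<le> (s1 powr (- (1 + b))) powr (q - 1)" using \<beta>1 \<beta>(2) q by (intro powr_mono2) auto
      also have "- (1 + b) * (q - 1) = - q" using exp_b(2) by (simp only: minus_mult_left[symmetric])
      then have "(s1 powr (- (1 + b))) powr (q - 1) = s1 powr (- q)" by (simp only: powr_powr)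
      finally show ?thesis .
    qed
    have B2: "\<beta> powr (q - 1) \<le> m powr (q - 1) / kap s"
    proof -
      have "\<beta> powr (q - 1) \<le> (kap s powr (- b) * m) powr (q - 1)" using \<beta>2 \<beta>(2) q by (intro powr_mono2) auto
      also have "\<dots> = (kap s powr (- b)) powr (q - 1) * m powr (q - 1)" using m by (simp add: powr_mult)
      also have "- b * (q - 1) = - 1" using exp_b(1) by (simp only: minus_mult_left[symmetric])
      then have "(kap s powr (- b)) powr (q - 1) = kap s powr (- 1)" by (simp only: powr_powr)
      finally show ?thesis using kap_pos[OF s] by (simp add: powr_minus divide_inverse mult.commute)
    qed
    have "\<alpha> * \<beta> powr (q - 1) \<le> (C * (s0 * m) powr q + kap s * m) * \<beta> powr (q - 1)"
      by (rule mult_right_mono[OF \<alpha>le]) simp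
    also have "\<dots> = C * ((s0 * m) powr q * \<beta> powr (q - 1)) + kap s * m * \<beta> powr (q - 1)" by (simp add: algebra_simps)
    also have "\<dots> \<le> C * m powr q + m powr q"
    proof (rule add_mono)
      have "(s0 * m) powr q * \<beta> powr (q - 1) \<le> (s1 * m) powr q * s1 powr (- q)"
        using s0 s1 m q B1 by (intro mult_mono powr_mono2) auto
      also have "\<dots> = m powr q" using s1(1) m by (simp add: powr_mult powr_minus)
      finally show "C * ((s0 * m) powr q * \<beta> powr (q - 1)) \<le> C * m powr q" using C0 by (rule mult_left_mono)
      have "kap s * m * \<beta> powr (q - 1) \<le> kap s * m * (m powr (q - 1) / kap s)"
        using B2 kap_pos[OF s] m by (intro mult_left_mono) auto
      also have "\<dots> = m powr 1 * m powr (q - 1)" using kap_pos[OF s] m by simp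
      also have "\<dots> = m powr q" by (simp only: powr_add[symmetric]) simp
      finally show "kap s * m * \<beta> powr (q - 1) \<le> m powr q" .
    qed
    finally show ?thesis by (simp add: algebra_simps)
  qed
  ultimately show thesis using that \<alpha>(1) \<beta>(1) unfolding m_def by blast
qed

end

section \<open>Reverse Hoelder inequality for both weights\<close>

lemma ennreal_scale_le:
  assumes "I \<le> ennreal K * J" "0 < \<delta>" "\<delta> * K \<le> 1" "0 \<le> K"
  shows "ennreal \<delta> * I \<le> J"
proof -
  have "ennreal \<delta> * I \<le> ennreal \<delta> * (ennreal K * J)" by (rule mult_left_mono[OF assms(1)]) simp
  also have "\<dots> = ennreal (\<delta> * K) * J" using assms by (simp add: ennreal_mult mult.assoc)
  also have "\<dots> \<le> ennreal 1 * J" using assms by (intro mult_right_mono ennreal_leI) auto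
  finally show ?thesis by simp
qed

context double_phase_setting
begin

lemma W_eq_V: "0 < s \<Longrightarrow> W s x = V s x powr (- (1 / b))"
  using W_pos[of s x] b by (simp add: V_def powr_powr)

text \<open>Because \<open>W = V powr (- (1 / b))\<close>, raising the condition for
  \<open>W\<close> to the power \<open>b\<close> yields the dual condition for \<open>V\<close>,
  with \<open>1 + b\<close> in the place of \<open>q\<close>.\<close>

lemma subset_bounds:
  assumes C: "balanced C" and s: "0 < s" and m: "0 < m"
    and le: "(\<integral>\<^sup>+x\<in>cube d m. ennreal (D x s) \<partial>lebesgue) \<le> 1"
    and E [measurable]: "E \<in> sets lebesgue" and EQ: "E \<subseteq> hcube d m"
    and half: "emeasure lebesgue (hcube d m) \<le> 2 * emeasure lebesgue E"
  shows "(\<integral>\<^sup>+x\<in>hcube d m. ennreal (W s x) \<partial>lebesgue) \<le> ennreal ((C + 1) * 2 powr q) * (\<integral>\<^sup>+x\<in>E. ennreal (W s x) \<partial>lebesgue)"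
    and "(\<integral>\<^sup>+x\<in>hcube d m. ennreal (V s x) \<partial>lebesgue) \<le> ennreal ((C + 1) powr b * 2 powr (1 + b)) * (\<integral>\<^sup>+x\<in>E. ennreal (V s x) \<partial>lebesgue)"
proof -
  have C0: "0 \<le> C" using C by (simp add: balanced_def)
  obtain \<alpha> \<beta> where \<alpha>\<beta>: "0 < \<alpha>" "0 < \<beta>" "(\<integral>\<^sup>+x\<in>cube d m. ennreal (W s x) \<partial>lebesgue) = ennreal \<alpha>"
    "(\<integral>\<^sup>+x\<in>cube d m. ennreal (V s x) \<partial>lebesgue) = ennreal \<beta>"
    "\<alpha> * \<beta> powr (q - 1) \<le> (C + 1) * (m ^ CARD('n)) powr q"
    by (rule muckenhoupt[OF C s m le])
  have mn: "0 < m ^ CARD('n)" using m by simp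
  have W\<alpha>: "(\<integral>\<^sup>+x\<in>hcube d m. ennreal (W s x) \<partial>lebesgue) = ennreal \<alpha>"
    using \<alpha>\<beta>(3) nn_integral_hcube[of "\<lambda>x. ennreal (W s x)" d m] by (simp add: cube_def)
  have V\<beta>: "(\<integral>\<^sup>+x\<in>hcube d m. ennreal (V s x) \<partial>lebesgue) = ennreal \<beta>"
    using \<alpha>\<beta>(4) nn_integral_hcube[of "\<lambda>x. ennreal (V s x)" d m] by (simp add: cube_def)
  have em: "emeasure lebesgue (hcube d m) = ennreal (m ^ CARD('n))" using m by (simp add: emeasure_hcube)
  show "(\<integral>\<^sup>+x\<in>hcube d m. ennreal (W s x) \<partial>lebesgue) \<le> ennreal ((C + 1) * 2 powr q) * (\<integral>\<^sup>+x\<in>E. ennreal (W s x) \<partial>lebesgue)"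
    by (rule muckenhoupt_subset[of "W s" lebesgue "V s" "hcube d m" E q \<alpha> \<beta> "C + 1" "m ^ CARD('n)"])
      (use W_pos[OF s] q \<alpha>\<beta> C0 mn W\<alpha> V\<beta> em EQ half in \<open>simp_all add: V_def b_def\<close>)
  have "\<beta> * \<alpha> powr b = (\<alpha> * \<beta> powr (q - 1)) powr b"
    using \<alpha>\<beta>(1,2) exp_b(1) by (simp add: powr_mult powr_powr mult.commute)
  also have "\<dots> \<le> ((C + 1) * (m ^ CARD('n)) powr q) powr b"
    using \<alpha>\<beta> b by (intro powr_mono2) auto
  also have "\<dots> = (C + 1) powr b * (m ^ CARD('n)) powr (1 + b)"
    using C0 mn exp_b(3) by (simp add: powr_mult powr_powr)
  finally have \<beta>\<alpha>: "\<beta> * \<alpha> powr b \<le> (C + 1) powr b * (m ^ CARD('n)) powr (1 + b)" .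
  show "(\<integral>\<^sup>+x\<in>hcube d m. ennreal (V s x) \<partial>lebesgue) \<le> ennreal ((C + 1) powr b * 2 powr (1 + b)) * (\<integral>\<^sup>+x\<in>E. ennreal (V s x) \<partial>lebesgue)"
    by (rule muckenhoupt_subset[of "V s" lebesgue "W s" "hcube d m" E "1 + b" \<beta> \<alpha> "(C + 1) powr b" "m ^ CARD('n)"])
      (use V_pos[OF s] b \<alpha>\<beta> C0 mn W\<alpha> V\<beta> em EQ half \<beta>\<alpha> in \<open>simp_all add: W_eq_V[OF s]\<close>)
qed

text \<open>A reverse Hoelder inequality uniform in \<open>s\<close> and in the cube, as long as
  \<open>s\<close> is admissible there. All smaller exponents are included because one of the
  applications uses two of them for the same weight.\<close>

definition self_improving :: "(real \<Rightarrow> real ^ 'n \<Rightarrow> real) \<Rightarrow> real \<Rightarrow> real \<Rightarrow> bool" where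
  "self_improving U \<epsilon>0 A \<longleftrightarrow> (\<forall>s c l B \<epsilon>. 0 < s \<longrightarrow> 0 < l \<longrightarrow> (\<integral>\<^sup>+x\<in>cube c l. ennreal (D x s) \<partial>lebesgue) \<le> 1 \<longrightarrow>
    0 < B \<longrightarrow> 0 < \<epsilon> \<longrightarrow> \<epsilon> \<le> \<epsilon>0 \<longrightarrow> (\<integral>\<^sup>+x\<in>cube c l. ennreal (U s x) \<partial>lebesgue) \<le> ennreal B \<longrightarrow>
    (\<integral>\<^sup>+x\<in>cube c l. ennreal (U s x powr (1 + \<epsilon>)) \<partial>lebesgue) \<le> ennreal (A * (B / l ^ CARD('n)) powr \<epsilon> * B))"

lemma self_improvingD:
  assumes "self_improving U \<epsilon>0 A" "0 < s" "0 < l" "(\<integral>\<^sup>+x\<in>cube c l. ennreal (D x s) \<partial>lebesgue) \<le> 1" "0 < B" "0 < \<epsilon>" "\<epsilon> \<le> \<epsilon>0"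
    "(\<integral>\<^sup>+x\<in>cube c l. ennreal (U s x) \<partial>lebesgue) \<le> ennreal B"
  shows "(\<integral>\<^sup>+x\<in>cube c l. ennreal (U s x powr (1 + \<epsilon>)) \<partial>lebesgue) \<le> ennreal (A * (B / l ^ CARD('n)) powr \<epsilon> * B)"
  using assms unfolding self_improving_def by blast

lemma self_improving_W_V:
  assumes C: "balanced C"
  shows "\<exists>\<epsilon>0>0. \<exists>A>0. self_improving W \<epsilon>0 A \<and> self_improving V \<epsilon>0 A"
proof -
  have C0: "0 \<le> C" using C by (simp add: balanced_def)
  \<comment> \<open>The maximum gives one share \<open>\<delta>\<close> for both weights, hence
    common \<open>\<epsilon>0\<close> and \<open>A\<close>.\<close>
  define K where "K = max ((C + 1) * 2 powr q) ((C + 1) powr b * 2 powr (1 + b))"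
  have "1 < 2 powr q" using q powr_less_mono[of 0 q 2] by simp
  moreover have "1 * 2 powr q \<le> (C + 1) * 2 powr q" using C0 by (intro mult_right_mono) auto
  ultimately have "1 < (C + 1) * 2 powr q" by linarith
  then have K: "1 < K" by (simp add: K_def less_max_iff_disj)
  define \<delta> where "\<delta> = 1 / K"
  have \<delta>: "0 < \<delta>" "\<delta> < 1" "\<delta> * K \<le> 1" using K by (auto simp: \<delta>_def)
  have sub: "(\<integral>\<^sup>+x\<in>cube d m. ennreal (D x s) \<partial>lebesgue) \<le> 1"
    if "hcube d m \<subseteq> hcube c l" "(\<integral>\<^sup>+x\<in>cube c l. ennreal (D x s) \<partial>lebesgue) \<le> 1" for d m c l s
  proof -
    have [measurable]: "(\<lambda>x. ennreal (D x s)) \<in> borel_measurable lebesgue" by (simp add: D_def)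
    have "(\<integral>\<^sup>+x\<in>cube d m. ennreal (D x s) \<partial>lebesgue) = (\<integral>\<^sup>+x\<in>hcube d m. ennreal (D x s) \<partial>lebesgue)"
      unfolding cube_def by (rule nn_integral_hcube[symmetric]) simp
    also have "\<dots> \<le> (\<integral>\<^sup>+x\<in>hcube c l. ennreal (D x s) \<partial>lebesgue)"
      by (rule nn_integral_mono) (use that(1) in \<open>auto simp: indicator_def\<close>)
    also have "\<dots> = (\<integral>\<^sup>+x\<in>cube c l. ennreal (D x s) \<partial>lebesgue)"
      unfolding cube_def by (rule nn_integral_hcube) simp
    finally show ?thesis using that(2) by simp
  qed
  have conv: "(\<integral>\<^sup>+x\<in>cube c l. ennreal (f x) \<partial>lebesgue) = (\<integral>\<^sup>+x\<in>hcube c l. ennreal (f x) \<partial>lebesgue)"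
    if "f \<in> borel_measurable lebesgue" for f and c :: "real ^ 'n" and l
    unfolding cube_def by (rule nn_integral_hcube[symmetric]) (use that in simp)
  show ?thesis
  proof (rule reverse_holder[where 'n='n, OF \<delta>(1,2)])
    fix \<epsilon>0 A :: real
    assume pos: "0 < \<epsilon>0" "0 < A"
    assume RH: "\<And>(w :: real ^ 'n \<Rightarrow> real) c l B \<epsilon>. \<lbrakk>w \<in> borel_measurable lebesgue; \<And>x. 0 \<le> w x; 0 < l; 0 < B; 0 < \<epsilon>; \<epsilon> \<le> \<epsilon>0;
      (\<integral>\<^sup>+x\<in>hcube c l. ennreal (w x) \<partial>lebesgue) \<le> ennreal B;
      \<And>d m E. \<lbrakk>0 < m; hcube d m \<subseteq> hcube c l; E \<in> sets lebesgue; E \<subseteq> hcube d m;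
        emeasure lebesgue (hcube d m) \<le> 2 * emeasure lebesgue E\<rbrakk> \<Longrightarrow>
        ennreal \<delta> * (\<integral>\<^sup>+x\<in>hcube d m. ennreal (w x) \<partial>lebesgue) \<le> (\<integral>\<^sup>+x\<in>E. ennreal (w x) \<partial>lebesgue)\<rbrakk> \<Longrightarrow>
      (\<integral>\<^sup>+x\<in>hcube c l. ennreal (w x powr (1 + \<epsilon>)) \<partial>lebesgue) \<le> ennreal (A * (B / l ^ CARD('n)) powr \<epsilon> * B)"
    have improve: "self_improving U \<epsilon>0 A"
      if U [measurable]: "\<And>s. U s \<in> borel_measurable lebesgue" and Unn: "\<And>s x. 0 < s \<Longrightarrow> 0 \<le> U s x"
        and L: "0 \<le> L" "\<delta> * L \<le> 1"
        and bound: "\<And>s d m E. \<lbrakk>0 < s; 0 < m; (\<integral>\<^sup>+x\<in>cube d m. ennreal (D x s) \<partial>lebesgue) \<le> 1; E \<in> sets lebesgue; E \<subseteq> hcube d m;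
          emeasure lebesgue (hcube d m) \<le> 2 * emeasure lebesgue E\<rbrakk> \<Longrightarrow>
          (\<integral>\<^sup>+x\<in>hcube d m. ennreal (U s x) \<partial>lebesgue) \<le> ennreal L * (\<integral>\<^sup>+x\<in>E. ennreal (U s x) \<partial>lebesgue)"
      for U :: "real \<Rightarrow> real ^ 'n \<Rightarrow> real" and L
      unfolding self_improving_def
    proof (intro allI impI)
      fix s c l B \<epsilon>
      assume h: "0 < s" "0 < l" "(\<integral>\<^sup>+x\<in>cube c l. ennreal (D x s) \<partial>lebesgue) \<le> 1" "0 < B" "0 < \<epsilon>" "\<epsilon> \<le> \<epsilon>0"
        and Ule: "(\<integral>\<^sup>+x\<in>cube c l. ennreal (U s x) \<partial>lebesgue) \<le> ennreal B"
      have "(\<integral>\<^sup>+x\<in>hcube c l. ennreal (U s x powr (1 + \<epsilon>)) \<partial>lebesgue) \<le> ennreal (A * (B / l ^ CARD('n)) powr \<epsilon> * B)"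
      proof (rule RH)
        show "(\<integral>\<^sup>+x\<in>hcube c l. ennreal (U s x) \<partial>lebesgue) \<le> ennreal B" using Ule by (simp add: conv)
        show "0 \<le> U s x" for x by (rule Unn[OF h(1)])
        fix d m E
        assume E: "0 < m" "hcube d m \<subseteq> hcube c l" "E \<in> sets lebesgue" "E \<subseteq> hcube d m"
          "emeasure lebesgue (hcube d m) \<le> 2 * emeasure lebesgue E"
        show "ennreal \<delta> * (\<integral>\<^sup>+x\<in>hcube d m. ennreal (U s x) \<partial>lebesgue) \<le> (\<integral>\<^sup>+x\<in>E. ennreal (U s x) \<partial>lebesgue)"
          by (rule ennreal_scale_le[OF bound[OF h(1) E(1) sub[OF E(2) h(3)] E(3-5)] \<delta>(1) L(2,1)])
      qed (use h in auto)
      then show "(\<integral>\<^sup>+x\<in>cube c l. ennreal (U s x powr (1 + \<epsilon>)) \<partial>lebesgue) \<le> ennreal (A * (B / l ^ CARD('n)) powr \<epsilon> * B)"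
        by (subst conv) simp_all
    qed
    have "self_improving W \<epsilon>0 A"
    proof (rule improve[OF W_measurable _ _ _ subset_bounds(1)[OF C]])
      show "\<delta> * ((C + 1) * 2 powr q) \<le> 1"
        using \<delta> by (intro order_trans[OF mult_left_mono \<delta>(3)]) (auto simp: K_def)
    qed (use W_pos C0 in \<open>auto simp: less_imp_le\<close>)
    moreover have "self_improving V \<epsilon>0 A"
    proof (rule improve[OF V_measurable _ _ _ subset_bounds(2)[OF C]])
      show "\<delta> * ((C + 1) powr b * 2 powr (1 + b)) \<le> 1"
        using \<delta> by (intro order_trans[OF mult_left_mono \<delta>(3)]) (auto simp: K_def)
    qed (use V_pos C0 in \<open>auto simp: less_imp_le\<close>)
    ultimately show ?thesis using pos by blast
  qed
qed

section \<open>Averages over single cubes in the modular sense\<close>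

lemma powr_add_le: "0 \<le> x \<Longrightarrow> 0 \<le> y \<Longrightarrow> 0 \<le> r \<Longrightarrow> (x + y) powr r \<le> 2 powr r * (x powr r + y powr r)" for x y r :: real
proof -
  assume xy: "0 \<le> x" "0 \<le> y" "0 \<le> r"
  have "(x + y) powr r \<le> (2 * max x y) powr r" using xy by (intro powr_mono2) auto
  also have "\<dots> = 2 powr r * max x y powr r" using xy by (simp add: powr_mult)
  also have "max x y powr r \<le> x powr r + y powr r" by (simp add: max_def)
  finally show ?thesis by simp
qed

text \<open>On the set where \<open>a < \<kappa>(s)\<close> the reverse Hoelder inequality for \<open>V\<close> bounds the measure of that set; elsewhere \<open>W = a\<close> and
  it gives the Muckenhoupt condition with the smaller exponent \<open>\<tau> q\<close>.\<close>

lemma averaging_H: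
  assumes C: "balanced C"
  shows "\<exists>\<tau> K. 0 < \<tau> \<and> \<tau> < 1 \<and> 0 \<le> K \<and> averaging (\<lambda>x t. H x (t powr \<tau>)) K"
proof -
  have C0: "0 \<le> C" using C by (simp add: balanced_def)
  obtain \<epsilon> A where \<epsilon>: "0 < \<epsilon>" and A: "0 < A" and "self_improving V \<epsilon> A"
    using self_improving_W_V[OF C] by blast
  note RH = self_improvingD[OF \<open>self_improving V \<epsilon> A\<close>]
  \<comment> \<open>Solves \<open>(1 + \<epsilon>) * (\<tau> * p - 1) = p - 1\<close>. This relation
    is what makes the powers of \<open>kap s\<close> and \<open>B\<close> in the estimate on
    \<open>E\<close> combine to \<open>s powr (- q)\<close>.\<close>
  define \<tau> where "\<tau> = (1 + (p - 1) / (1 + \<epsilon>)) / p"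
  have tp: "\<tau> * p - 1 = (p - 1) / (1 + \<epsilon>)" using p by (simp add: \<tau>_def)
  have tp1: "1 < \<tau> * p" using tp p \<epsilon> by (smt (verit) divide_pos_pos)
  have \<tau>0: "0 < \<tau>" using tp1 p by (smt (verit) mult_nonpos_nonneg)
  have e1: "(1 + \<epsilon>) * (\<tau> * p - 1) = p - 1" using tp \<epsilon> by simp
  have "(p - 1) / (1 + \<epsilon>) < p - 1" using p \<epsilon> by (simp add: divide_less_eq)
  then have "\<tau> * p < 1 * p" using tp by simp
  then have \<tau>1: "\<tau> < 1" using p by (simp only: mult_less_cancel_right)
  have tq1: "1 < \<tau> * q" using tp1 pq \<tau>0 by (smt (verit) mult_strict_left_mono)
  \<comment> \<open>With this exponent \<open>V powr (1 + \<epsilon>')\<close> equals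
    \<open>W powr (- (1 / (\<tau> * q - 1)))\<close>, the dual weight for the exponent
    \<open>\<tau> * q\<close>. It does not exceed \<open>\<epsilon>\<close>, because
    \<open>(u - 1) / (\<tau> * u - 1)\<close> decreases from \<open>u = p\<close> to
    \<open>u = q\<close>.\<close>
  define \<epsilon>' where "\<epsilon>' = (q - 1) / (\<tau> * q - 1) - 1"
  have e3: "(1 + \<epsilon>') * (\<tau> * q - 1) = q - 1" using tq1 by (simp add: \<epsilon>'_def)
  have e4: "\<epsilon>' * (\<tau> * q - 1) = q * (1 - \<tau>)" using e3 by (simp add: algebra_simps)
  have e2: "\<epsilon> * (\<tau> * p - 1) = p * (1 - \<tau>)" using e1 by (simp add: algebra_simps)
  have \<epsilon>'0: "0 < \<epsilon>'"
  proof -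
    have "0 < \<epsilon>' * (\<tau> * q - 1)" unfolding e4 using q \<tau>1 by simp
    then show ?thesis using tq1 by (simp add: zero_less_mult_iff)
  qed
  have \<epsilon>'1: "\<epsilon>' \<le> \<epsilon>"
  proof -
    have "\<tau> * (q - p) \<le> 1 * (q - p)" using \<tau>1 pq by (intro mult_right_mono) auto
    then have "(q - 1) * (\<tau> * p - 1) \<le> (p - 1) * (\<tau> * q - 1)" by (simp add: algebra_simps)
    then have "(q - 1) * (\<tau> * p - 1) \<le> (1 + \<epsilon>) * (\<tau> * p - 1) * (\<tau> * q - 1)" using e1 by simp
    then have "(q - 1) * (\<tau> * p - 1) \<le> ((1 + \<epsilon>) * (\<tau> * q - 1)) * (\<tau> * p - 1)" by (simp only: mult_ac)
    then have "q - 1 \<le> (1 + \<epsilon>) * (\<tau> * q - 1)" using tp1 by (simp only: mult_le_cancel_right)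
    then have "(q - 1) / (\<tau> * q - 1) \<le> 1 + \<epsilon>" using tq1 by (simp add: divide_le_eq)
    then show ?thesis by (simp add: \<epsilon>'_def)
  qed
  \<comment> \<open>This is \<open>(1 - 1 / (\<tau> * p)) * (\<tau> * q)\<close>, the power with
    which the bound \<open>M\<close> for the measure of \<open>E\<close> enters the second
    phase.\<close>
  define r2 where "r2 = (\<tau> * p - 1) * (q / p)"
  have r2: "(1 + \<epsilon>) * r2 = (p - 1) * (q / p)" "\<epsilon> * r2 = q * (1 - \<tau>)"
    using e1 e2 p by (simp_all add: r2_def mult.assoc[symmetric])
  have r2_pos: "0 < r2" using tp1 q p by (simp add: r2_def)
  define K where "K = 1 + C * 2 powr (\<tau> * q) * (A powr (\<tau> * q - 1) + A powr r2)"
  have K: "0 \<le> K" using C0 by (simp add: K_def)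
  have "averaging (\<lambda>x t. H x (t powr \<tau>)) K"
    unfolding averaging_def
  proof (intro allI ballI impI)
    fix c :: "real ^ 'n" and l :: real and h :: "real ^ 'n \<Rightarrow> real"
    assume h [measurable]: "h \<in> borel_measurable lebesgue" and l: "0 < l" and hnn: "\<forall>x. 0 \<le> h x"
      and le1: "(\<integral>\<^sup>+x\<in>cube c l. ennreal (H x (h x powr \<tau>)) \<partial>lebesgue) \<le> 1"
    let ?Q = "cube c l"
    define m where "m = l ^ CARD('n)"
    have m: "0 < m" using l by (simp add: m_def)
    have em: "emeasure lebesgue ?Q = ennreal m" unfolding m_def by (rule emeasure_cube) (use l in simp)
    have split: "ennreal (H x (h x powr \<tau>)) = ennreal (h x powr (\<tau> * p)) + ennreal (a x * h x powr (\<tau> * q))" for x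
      using a_nonneg[of x] by (simp add: H_def powr_powr)
    have sum: "(\<integral>\<^sup>+x\<in>?Q. ennreal (H x (h x powr \<tau>)) \<partial>lebesgue)
      = (\<integral>\<^sup>+x\<in>?Q. ennreal (h x powr (\<tau> * p)) \<partial>lebesgue) + (\<integral>\<^sup>+x\<in>?Q. ennreal (a x * h x powr (\<tau> * q)) \<partial>lebesgue)"
      unfolding split distrib_right by (rule nn_integral_add) measurable
    obtain X where X: "(\<integral>\<^sup>+x\<in>?Q. ennreal (h x powr (\<tau> * p)) \<partial>lebesgue) = ennreal X" "0 \<le> X"
      using le1 unfolding sum by (cases "\<integral>\<^sup>+x\<in>?Q. ennreal (h x powr (\<tau> * p)) \<partial>lebesgue") (auto simp: top_unique)
    obtain Y where Y: "(\<integral>\<^sup>+x\<in>?Q. ennreal (a x * h x powr (\<tau> * q)) \<partial>lebesgue) = ennreal Y" "0 \<le> Y"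
      using le1 unfolding sum by (cases "\<integral>\<^sup>+x\<in>?Q. ennreal (a x * h x powr (\<tau> * q)) \<partial>lebesgue") (auto simp: top_unique)
    have "ennreal (X + Y) \<le> 1" using le1 X Y unfolding sum by simp
    then have X1: "X \<le> 1" using X(2) Y(2) by (simp del: ennreal_plus)
    obtain s where s: "0 < s" "(\<integral>\<^sup>+x\<in>?Q. ennreal (D x s) \<partial>lebesgue) \<le> 1"
      "(\<integral>\<^sup>+x\<in>?Q. ennreal (a x) \<partial>lebesgue) \<le> ennreal (C * (s * m) powr q)"
      using C l unfolding balanced_def m_def by blast
    define B where "B = s powr (- (1 + b))"
    have B: "0 < B" using s(1) by (simp add: B_def)
    have VB: "(\<integral>\<^sup>+x\<in>?Q. ennreal (V s x) \<partial>lebesgue) \<le> ennreal B"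
      unfolding B_def by (rule V_integral_le[OF s(1) _ s(2)]) simp
    define E where "E = ?Q \<inter> {x \<in> space lebesgue. a x < kap s}"
    have [measurable]: "E \<in> sets lebesgue" unfolding E_def by measurable
    define M where "M = kap s powr (b * (1 + \<epsilon>)) * (A * (B / m) powr \<epsilon> * B)"
    have M: "0 < M" using kap_pos[OF s(1)] A B m by (simp add: M_def)
    have EM: "(\<integral>\<^sup>+x\<in>E. ennreal 1 \<partial>lebesgue) \<le> ennreal M"
    proof -
      have "(\<integral>\<^sup>+x\<in>E. ennreal 1 \<partial>lebesgue) \<le> (\<integral>\<^sup>+x. ennreal (kap s powr (b * (1 + \<epsilon>))) * (ennreal (V s x powr (1 + \<epsilon>)) * indicator ?Q x) \<partial>lebesgue)"
      proof (rule nn_integral_mono)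
        fix x
        show "ennreal 1 * indicator E x \<le> ennreal (kap s powr (b * (1 + \<epsilon>))) * (ennreal (V s x powr (1 + \<epsilon>)) * indicator ?Q x)"
        proof (cases "x \<in> E")
          case True
          then have "V s x = kap s powr (- b)" by (simp add: E_def V_def W_def max_def)
          then have "V s x powr (1 + \<epsilon>) = kap s powr (- (b * (1 + \<epsilon>)))" by (simp add: powr_powr)
          then have "kap s powr (b * (1 + \<epsilon>)) * V s x powr (1 + \<epsilon>) = 1"
            using kap_pos[OF s(1)] by (simp only: powr_add[symmetric]) simp
          then show ?thesis using True by (simp add: E_def ennreal_mult[symmetric])
        qed simp
      qed
      also have "\<dots> = ennreal (kap s powr (b * (1 + \<epsilon>))) * (\<integral>\<^sup>+x\<in>?Q. ennreal (V s x powr (1 + \<epsilon>)) \<partial>lebesgue)"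
        by (rule nn_integral_cmult) measurable
      also have "\<dots> \<le> ennreal (kap s powr (b * (1 + \<epsilon>))) * ennreal (A * (B / m) powr \<epsilon> * B)"
        unfolding m_def by (rule mult_left_mono[OF RH[OF s(1) l s(2) B \<epsilon> order_refl VB]]) simp
      also have "\<dots> = ennreal M" using A B by (simp add: M_def ennreal_mult)
      finally show ?thesis .
    qed
    \<comment> \<open>On \<open>E\<close> only the first phase of \<open>h\<close> is used, against
      the constant 1; the small measure of \<open>E\<close> makes up for the missing weight.\<close>
    define i2 where "i2 = X powr (1 / (\<tau> * p)) * M powr (1 - 1 / (\<tau> * p))"
    have I2: "(\<integral>\<^sup>+x\<in>E. ennreal (h x) \<partial>lebesgue) \<le> ennreal i2"
    proof -
      have "(\<integral>\<^sup>+x\<in>E. ennreal (h x) \<partial>lebesgue) = (\<integral>\<^sup>+x\<in>E. ennreal ((h x powr (\<tau> * p)) powr (1 / (\<tau> * p)) * 1 powr (1 - 1 / (\<tau> * p))) \<partial>lebesgue)"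
        using tp1 hnn p \<tau>0 by (simp add: powr_powr)
      also have "\<dots> \<le> ennreal i2"
        unfolding i2_def
      proof (rule holder_nn_integral)
        have "(\<integral>\<^sup>+x\<in>E. ennreal (h x powr (\<tau> * p)) \<partial>lebesgue) \<le> (\<integral>\<^sup>+x\<in>?Q. ennreal (h x powr (\<tau> * p)) \<partial>lebesgue)"
          by (rule nn_integral_mono) (auto simp: E_def indicator_def)
        then show "(\<integral>\<^sup>+x\<in>E. ennreal (h x powr (\<tau> * p)) \<partial>lebesgue) \<le> ennreal X" using X(1) by simp
      qed (use tp1 X M EM in auto)
      finally show ?thesis .
    qed
    define N where "N = A * (B / m) powr \<epsilon>' * B"
    have N: "0 < N" using A B m by (simp add: N_def)
    have VN: "(\<integral>\<^sup>+x\<in>?Q. ennreal (V s x powr (1 + \<epsilon>')) \<partial>lebesgue) \<le> ennreal N"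
      unfolding N_def m_def by (rule RH[OF s(1) l s(2) B \<epsilon>'0 \<epsilon>'1 VB])
    define i1 where "i1 = Y powr (1 / (\<tau> * q)) * N powr (1 - 1 / (\<tau> * q))"
    have I1: "(\<integral>\<^sup>+x\<in>?Q - E. ennreal (h x) \<partial>lebesgue) \<le> ennreal i1"
    proof -
      have eq: "h x = (a x * h x powr (\<tau> * q)) powr (1 / (\<tau> * q)) * (V s x powr (1 + \<epsilon>')) powr (1 - 1 / (\<tau> * q))" if "x \<in> ?Q - E" for x
      proof -
        have ax: "kap s \<le> a x" using that by (auto simp: E_def)
        then have apos: "0 < a x" using kap_pos[OF s(1)] by linarith
        have "(1 + \<epsilon>') * (1 - 1 / (\<tau> * q)) = (q - 1) / (\<tau> * q)"
          unfolding e3[symmetric] using tq1 q \<tau>0 by (simp add: field_simps)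
        then have "b * ((1 + \<epsilon>') * (1 - 1 / (\<tau> * q))) = 1 / (\<tau> * q)"
          using q tq1 \<tau>0 by (simp add: b_def)
        then have "(V s x powr (1 + \<epsilon>')) powr (1 - 1 / (\<tau> * q)) = a x powr (- (1 / (\<tau> * q)))"
          using ax by (simp add: V_def W_def max_def powr_powr mult.assoc)
        then show ?thesis using apos hnn tq1 q \<tau>0 by (simp add: powr_mult powr_powr powr_minus)
      qed
      have "(\<integral>\<^sup>+x\<in>?Q - E. ennreal (h x) \<partial>lebesgue) = (\<integral>\<^sup>+x\<in>?Q - E. ennreal ((a x * h x powr (\<tau> * q)) powr (1 / (\<tau> * q)) * (V s x powr (1 + \<epsilon>')) powr (1 - 1 / (\<tau> * q))) \<partial>lebesgue)"
        by (rule nn_integral_cong) (use eq in \<open>auto simp: indicator_def\<close>)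
      also have "\<dots> \<le> ennreal i1"
        unfolding i1_def
      proof (rule holder_nn_integral)
        have "(\<integral>\<^sup>+x\<in>?Q - E. ennreal (a x * h x powr (\<tau> * q)) \<partial>lebesgue) \<le> (\<integral>\<^sup>+x\<in>?Q. ennreal (a x * h x powr (\<tau> * q)) \<partial>lebesgue)"
          by (rule nn_integral_mono) (auto simp: indicator_def)
        then show "(\<integral>\<^sup>+x\<in>?Q - E. ennreal (a x * h x powr (\<tau> * q)) \<partial>lebesgue) \<le> ennreal Y" using Y(1) by simp
        have "(\<integral>\<^sup>+x\<in>?Q - E. ennreal (V s x powr (1 + \<epsilon>')) \<partial>lebesgue) \<le> (\<integral>\<^sup>+x\<in>?Q. ennreal (V s x powr (1 + \<epsilon>')) \<partial>lebesgue)"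
          by (rule nn_integral_mono) (auto simp: indicator_def)
        then show "(\<integral>\<^sup>+x\<in>?Q - E. ennreal (V s x powr (1 + \<epsilon>')) \<partial>lebesgue) \<le> ennreal N" using VN by simp
      qed (use tq1 Y N a_nonneg in auto)
      finally show ?thesis .
    qed
    have i: "0 \<le> i1" "0 \<le> i2" by (simp_all add: i1_def i2_def)
    have "(\<integral>\<^sup>+x\<in>?Q. ennreal (h x) \<partial>lebesgue) = (\<integral>\<^sup>+x. ennreal (h x) * indicator (?Q - E) x + ennreal (h x) * indicator E x \<partial>lebesgue)"
      by (rule nn_integral_cong) (auto simp: indicator_def E_def)
    also have "\<dots> = (\<integral>\<^sup>+x\<in>?Q - E. ennreal (h x) \<partial>lebesgue) + (\<integral>\<^sup>+x\<in>E. ennreal (h x) \<partial>lebesgue)"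
      by (rule nn_integral_add) measurable
    also have "\<dots> \<le> ennreal (i1 + i2)" using add_mono[OF I1 I2] i by simp
    finally have Ile: "(\<integral>\<^sup>+x\<in>?Q. ennreal (h x) \<partial>lebesgue) \<le> ennreal (i1 + i2)" .
    then obtain I where I: "(\<integral>\<^sup>+x\<in>?Q. ennreal (h x) \<partial>lebesgue) = ennreal I" "0 \<le> I"
      by (cases "\<integral>\<^sup>+x\<in>?Q. ennreal (h x) \<partial>lebesgue") (auto simp: top_unique)
    have I12: "I \<le> i1 + i2" using Ile i unfolding I(1) by (simp add: ennreal_le_iff del: ennreal_plus)
    \<comment> \<open>A second bound for the same integral, over the whole cube: it controls the
      first phase of the average by the first phase of \<open>h\<close>, while the split bound
      serves the second phase.\<close>
    have I3: "I \<le> X powr (1 / (\<tau> * p)) * m powr (1 - 1 / (\<tau> * p))"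
    proof -
      have "ennreal I = (\<integral>\<^sup>+x\<in>?Q. ennreal ((h x powr (\<tau> * p)) powr (1 / (\<tau> * p)) * 1 powr (1 - 1 / (\<tau> * p))) \<partial>lebesgue)"
        unfolding I(1)[symmetric] using tp1 hnn p \<tau>0 by (simp add: powr_powr)
      also have "\<dots> \<le> ennreal (X powr (1 / (\<tau> * p)) * m powr (1 - 1 / (\<tau> * p)))"
        by (rule holder_nn_integral) (use tp1 X m em in auto)
      finally show ?thesis by (simp add: ennreal_le_iff)
    qed
    define Av where "Av = I / m"
    have Av: "0 \<le> Av" using I m by (simp add: Av_def)
    have p1: "m * Av powr (\<tau> * p) \<le> X"
    proof -
      have "I powr (\<tau> * p) \<le> (X powr (1 / (\<tau> * p)) * m powr (1 - 1 / (\<tau> * p))) powr (\<tau> * p)"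
        using I3 I(2) tp1 by (intro powr_mono2) auto
      also have "\<dots> = X * m powr (\<tau> * p - 1)"
      proof -
        have "(1 - 1 / (\<tau> * p)) * (\<tau> * p) = \<tau> * p - 1" using tp1 p \<tau>0 by (simp add: left_diff_distrib)
        then show ?thesis using X(2) tp1 p \<tau>0 by (simp add: powr_mult powr_powr)
      qed
      finally have "m * (I powr (\<tau> * p) / m powr (\<tau> * p)) \<le> m * (X * m powr (\<tau> * p - 1) / m powr (\<tau> * p))"
        using m by (intro mult_left_mono divide_right_mono) auto
      also have "\<dots> = X" using m by (simp add: powr_diff)
      finally show ?thesis using I(2) m by (simp add: Av_def powr_divide)
    qed
    have Bq: "B powr (q - 1) = s powr (- q)"
    proof -
      have "- (1 + b) * (q - 1) = - q" using exp_b(2) by (simp only: minus_mult_left[symmetric])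
      then show ?thesis unfolding B_def by (simp only: powr_powr)
    qed
    have i1q: "i1 powr (\<tau> * q) = Y * (A powr (\<tau> * q - 1) * (s powr (- q) / m powr (q * (1 - \<tau>))))"
    proof -
      have "(1 - 1 / (\<tau> * q)) * (\<tau> * q) = \<tau> * q - 1" using tq1 q \<tau>0 by (simp add: left_diff_distrib)
      then have "i1 powr (\<tau> * q) = Y * N powr (\<tau> * q - 1)"
        using Y(2) tq1 q \<tau>0 by (simp add: i1_def powr_mult powr_powr)
      also have "N powr (\<tau> * q - 1) = A powr (\<tau> * q - 1) * ((B / m) powr (q * (1 - \<tau>)) * B powr (\<tau> * q - 1))"
        using A B m by (simp add: N_def powr_mult powr_powr e4)
      also have "(B / m) powr (q * (1 - \<tau>)) * B powr (\<tau> * q - 1) = B powr (q * (1 - \<tau>) + (\<tau> * q - 1)) / m powr (q * (1 - \<tau>))"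
        using B m by (simp add: powr_divide powr_add)
      also have "q * (1 - \<tau>) + (\<tau> * q - 1) = q - 1" by (simp add: algebra_simps)
      finally show ?thesis unfolding Bq .
    qed
    have i2q: "i2 powr (\<tau> * q) \<le> X * (A powr r2 * (s powr (- q) / m powr (q * (1 - \<tau>))))"
    proof -
      have 1: "(1 - 1 / (\<tau> * p)) * (\<tau> * q) = r2" "1 / (\<tau> * p) * (\<tau> * q) = q / p"
        using \<tau>0 p by (simp_all add: r2_def field_simps)
      have "i2 powr (\<tau> * q) = X powr (q / p) * M powr r2"
        unfolding i2_def using X(2) by (simp only: powr_mult powr_powr 1)
      also have "M powr r2 = kap s powr (b * ((p - 1) * (q / p))) * (A powr r2 * ((B / m) powr (q * (1 - \<tau>)) * B powr r2))"
        using A B m kap_pos[OF s(1)] unfolding M_def by (simp only: powr_mult powr_powr mult.assoc r2)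
      also have "(B / m) powr (q * (1 - \<tau>)) * B powr r2 = B powr (q * (1 - \<tau>) + r2) / m powr (q * (1 - \<tau>))"
        using B m by (simp add: powr_divide powr_add)
      also have "q * (1 - \<tau>) + r2 = (p - 1) * (q / p)" using r2 by (simp add: distrib_right)
      also have "kap s powr (b * ((p - 1) * (q / p))) * (A powr r2 * (B powr ((p - 1) * (q / p)) / m powr (q * (1 - \<tau>))))
        = A powr r2 * ((kap s powr (b * ((p - 1) * (q / p))) * B powr ((p - 1) * (q / p))) / m powr (q * (1 - \<tau>)))" by simp
      also have "kap s powr (b * ((p - 1) * (q / p))) * B powr ((p - 1) * (q / p)) = s powr (- q)"
      proof -
        \<comment> \<open>The total exponent is
          \<open>- (p / (p - 1)) * ((p - 1) * (q / p)) = - q\<close>.\<close>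
        have "(- e) * (b * z) + (- (1 + b)) * z = - ((1 + b + e * b) * z)" for z by (simp add: algebra_simps)
        then have "(- e) * (b * ((p - 1) * (q / p))) + (- (1 + b)) * ((p - 1) * (q / p)) = - ((1 + b + e * b) * ((p - 1) * (q / p)))" .
        also have "\<dots> = - q" unfolding exp_e using p by simp
        finally show ?thesis
          unfolding kap_def B_def powr_powr powr_add[symmetric] by (simp only:)
      qed
      finally have "i2 powr (\<tau> * q) = X powr (q / p) * (A powr r2 * (s powr (- q) / m powr (q * (1 - \<tau>))))" .
      \<comment> \<open>The first phase of \<open>h\<close> enters the second phase of the average
        with the power \<open>q / p > 1\<close>; a bound linear in \<open>X\<close> results because
        the modular, and with it \<open>X\<close>, is at most 1.\<close>
      moreover have "X powr (q / p) \<le> X"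
      proof -
        have "X powr (q / p) \<le> X powr 1" by (rule powr_mono') (use X(2) X1 pq p in auto)
        then show ?thesis using X(2) by simp
      qed
      ultimately show ?thesis by (simp only:) (rule mult_right_mono, simp_all)
    qed
    have p2: "C * (s * m) powr q * Av powr (\<tau> * q) \<le> C * 2 powr (\<tau> * q) * (A powr (\<tau> * q - 1) * Y + A powr r2 * X)"
    proof -
      have "Av powr (\<tau> * q) \<le> (i1 + i2) powr (\<tau> * q) / m powr (\<tau> * q)"
        unfolding Av_def using I(2) I12 m tq1 by (simp add: powr_divide divide_right_mono powr_mono2)
      also have "\<dots> \<le> 2 powr (\<tau> * q) * (i1 powr (\<tau> * q) + i2 powr (\<tau> * q)) / m powr (\<tau> * q)"
        using i tq1 by (intro divide_right_mono powr_add_le) auto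
      also have "\<dots> \<le> 2 powr (\<tau> * q) * (Y * (A powr (\<tau> * q - 1) * (s powr (- q) / m powr (q * (1 - \<tau>))))
          + X * (A powr r2 * (s powr (- q) / m powr (q * (1 - \<tau>))))) / m powr (\<tau> * q)"
        unfolding i1q using i2q by (intro divide_right_mono mult_left_mono add_left_mono) auto
      also have "\<dots> = 2 powr (\<tau> * q) * (A powr (\<tau> * q - 1) * Y + A powr r2 * X) * (s powr (- q) / (m powr (q * (1 - \<tau>)) * m powr (\<tau> * q)))"
        using m by (simp add: field_simps)
      also have "m powr (q * (1 - \<tau>)) * m powr (\<tau> * q) = m powr q"
        by (simp only: powr_add[symmetric]) (simp add: algebra_simps)
      finally have "C * (s * m) powr q * Av powr (\<tau> * q) \<le> C * (s * m) powr q * (2 powr (\<tau> * q) * (A powr (\<tau> * q - 1) * Y + A powr r2 * X) * (s powr (- q) / m powr q))"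
        using C0 by (intro mult_left_mono) auto
      also have "\<dots> = C * 2 powr (\<tau> * q) * (A powr (\<tau> * q - 1) * Y + A powr r2 * X)"
        using s(1) m by (simp add: powr_mult powr_minus field_simps)
      finally show ?thesis .
    qed
    have "(\<integral>\<^sup>+x\<in>?Q. ennreal (H x (Av powr \<tau>)) \<partial>lebesgue)
      = (\<integral>\<^sup>+x. ennreal (Av powr (\<tau> * p)) * indicator ?Q x + ennreal (Av powr (\<tau> * q)) * (ennreal (a x) * indicator ?Q x) \<partial>lebesgue)"
    proof (rule nn_integral_cong)
      fix x
      have "ennreal (H x (Av powr \<tau>)) = ennreal (Av powr (\<tau> * p)) + ennreal (Av powr (\<tau> * q)) * ennreal (a x)"
        using a_nonneg[of x] by (simp add: H_def powr_powr ennreal_mult[symmetric] mult.commute)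
      then show "ennreal (H x (Av powr \<tau>)) * indicator ?Q x = ennreal (Av powr (\<tau> * p)) * indicator ?Q x + ennreal (Av powr (\<tau> * q)) * (ennreal (a x) * indicator ?Q x)"
        by (simp add: indicator_def)
    qed
    also have "\<dots> = ennreal (Av powr (\<tau> * p)) * ennreal m + ennreal (Av powr (\<tau> * q)) * (\<integral>\<^sup>+x\<in>?Q. ennreal (a x) \<partial>lebesgue)"
      by (subst nn_integral_add) (simp_all add: nn_integral_cmult nn_integral_cmult_indicator em)
    also have "\<dots> \<le> ennreal (Av powr (\<tau> * p)) * ennreal m + ennreal (Av powr (\<tau> * q)) * ennreal (C * (s * m) powr q)"
      by (intro add_left_mono mult_left_mono s(3)) simp
    also have "\<dots> = ennreal (m * Av powr (\<tau> * p) + C * (s * m) powr q * Av powr (\<tau> * q))"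
      using m C0 by (simp add: ennreal_mult[symmetric] mult.commute)
    also have "\<dots> \<le> ennreal (K * (X + Y))"
    proof (rule ennreal_leI)
      have "A powr (\<tau> * q - 1) * Y + A powr r2 * X \<le> (A powr (\<tau> * q - 1) + A powr r2) * (X + Y)"
        using X(2) Y(2) by (simp add: algebra_simps)
      then have "C * 2 powr (\<tau> * q) * (A powr (\<tau> * q - 1) * Y + A powr r2 * X) \<le> C * 2 powr (\<tau> * q) * ((A powr (\<tau> * q - 1) + A powr r2) * (X + Y))"
        using C0 by (intro mult_left_mono) auto
      then show "m * Av powr (\<tau> * p) + C * (s * m) powr q * Av powr (\<tau> * q) \<le> K * (X + Y)"
        using p1 p2 Y(2) unfolding K_def by (simp add: distrib_right mult.assoc)
    qed
    also have "\<dots> = ennreal K * (\<integral>\<^sup>+x\<in>?Q. ennreal (H x (h x powr \<tau>)) \<partial>lebesgue)"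
      unfolding sum X(1) Y(1) using X(2) Y(2) K by (simp add: ennreal_mult)
    finally have fin: "(\<integral>\<^sup>+x\<in>?Q. ennreal (H x (Av powr \<tau>)) \<partial>lebesgue) \<le> ennreal K * (\<integral>\<^sup>+x\<in>?Q. ennreal (H x (h x powr \<tau>)) \<partial>lebesgue)" .
    show "\<exists>Av\<ge>0. (\<integral>\<^sup>+x\<in>?Q. ennreal (h x) \<partial>lebesgue) = ennreal (Av * l ^ CARD('n)) \<and>
      (\<integral>\<^sup>+x\<in>?Q. ennreal (H x (Av powr \<tau>)) \<partial>lebesgue) \<le> ennreal K * (\<integral>\<^sup>+x\<in>?Q. ennreal (H x (h x powr \<tau>)) \<partial>lebesgue)"
      using Av I(1) fin l by (intro exI[of _ Av]) (simp add: Av_def m_def)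
  qed
  then show ?thesis using \<tau>0 \<tau>1 K by blast
qed

text \<open>For the part where \<open>D\<close> has growth \<open>1 + b\<close>, the weight is truncated at the level given by the average \<open>A1\<close> itself. This
  is only allowed if the modular of that constant is at most 1, which is first shown for a small multiple of \<open>A1\<close>
  by halving.\<close>

lemma averaging_D:
  assumes C: "balanced C"
  shows "\<exists>\<tau> K. 0 < \<tau> \<and> \<tau> < 1 \<and> 0 \<le> K \<and> averaging (\<lambda>x t. D x (t powr \<tau>)) K"
proof -
  have C0: "0 \<le> C" using C by (simp add: balanced_def)
  obtain \<epsilon> A where \<epsilon>: "0 < \<epsilon>" and A: "0 < A" and "self_improving W \<epsilon> A"
    using self_improving_W_V[OF C] by blast
  note RH = self_improvingD[OF \<open>self_improving W \<epsilon> A\<close>]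
  define P where "P = p / (p - 1)"
  \<comment> \<open>\<open>\<kappa> = \<tau> * (1 + b)\<close> is the lowered exponent of
    \<open>h\<close>, and \<open>(1 + \<epsilon>) * (\<kappa> - 1) = b\<close> makes
    \<open>W powr (1 + \<epsilon>)\<close> the dual weight of \<open>V\<close> for the exponent
    \<open>\<kappa>\<close>.\<close>
  define \<kappa> where "\<kappa> = 1 + b / (1 + \<epsilon>)"
  define \<tau> where "\<tau> = \<kappa> / (1 + b)"
  have \<kappa>: "1 < \<kappa>" using b \<epsilon> by (simp add: \<kappa>_def)
  have e1: "(1 + \<epsilon>) * (\<kappa> - 1) = b" using \<epsilon> by (simp add: \<kappa>_def)
  have e2: "\<epsilon> * (\<kappa> - 1) = 1 + b - \<kappa>" using e1 by (simp add: algebra_simps)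
  have \<tau>b: "\<tau> * (1 + b) = \<kappa>" using b by (simp add: \<tau>_def)
  have \<tau>0: "0 < \<tau>" using \<kappa> b by (simp add: \<tau>_def)
  have "0 < \<epsilon> * (\<kappa> - 1)" using \<epsilon> \<kappa> by simp
  then have \<tau>1: "\<tau> < 1" using e2 b by (simp add: \<tau>_def divide_less_eq)
  have P: "1 + b < P" using exp_e(3) mult_pos_pos[OF e b] by (simp add: P_def)
  have "\<tau> * (1 + b) < \<tau> * P" using P \<tau>0 by (rule mult_strict_left_mono)
  then have tP: "1 < \<tau> * P" using \<tau>b \<kappa> by linarith
  define C1 where "C1 = A powr (\<kappa> - 1) * (C + 1) powr b"
  have C1: "0 < C1" using A C0 by (simp add: C1_def)
  define d where "d = P * \<tau>"
  have gt: "growth (\<lambda>x t. D x (t powr \<tau>)) ((1 + b) * \<tau>) d"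
    unfolding d_def P_def by (rule growth_powr[OF D_growth \<tau>0])
  have d0: "0 < d" using tP by (simp add: d_def mult.commute)
  \<comment> \<open>Small enough that
    \<open>2 powr d * (C1 * \<rho>0 powr \<kappa>) \<le> 1\<close>: the bound from
    \<open>star\<close>, after the loss of one doubling, is still at most 1.\<close>
  define \<rho>0 where "\<rho>0 = min 1 ((1 / (2 powr d * C1)) powr (1 / \<kappa>))"
  have \<rho>0: "0 < \<rho>0" "\<rho>0 \<le> 1" using C1 by (auto simp: \<rho>0_def)
  have \<rho>0\<kappa>: "2 powr d * (C1 * \<rho>0 powr \<kappa>) \<le> 1"
  proof -
    have "\<rho>0 powr \<kappa> \<le> ((1 / (2 powr d * C1)) powr (1 / \<kappa>)) powr \<kappa>"
      using \<rho>0 \<kappa> by (intro powr_mono2) (auto simp: \<rho>0_def)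
    also have "\<dots> = 1 / (2 powr d * C1)" using \<kappa> C1 by (simp add: powr_powr)
    finally have "2 powr d * C1 * \<rho>0 powr \<kappa> \<le> 2 powr d * C1 * (1 / (2 powr d * C1))"
      using C1 by (intro mult_left_mono) auto
    then show ?thesis using C1 by (simp add: mult.assoc)
  qed
  define K1 where "K1 = (1 / \<rho>0) powr d * C1"
  have K1: "0 < K1" using C1 \<rho>0 by (simp add: K1_def)
  define K where "K = 2 powr d * (K1 + 1)"
  have K: "0 \<le> K" using K1 by (simp add: K_def)
  have "averaging (\<lambda>x t. D x (t powr \<tau>)) K"
    unfolding averaging_def
  proof (intro allI ballI impI)
    fix c :: "real ^ 'n" and l :: real and h :: "real ^ 'n \<Rightarrow> real"
    assume h [measurable]: "h \<in> borel_measurable lebesgue" and l: "0 < l" and hnn: "\<forall>x. 0 \<le> h x"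
      and le1: "(\<integral>\<^sup>+x\<in>cube c l. ennreal (D x (h x powr \<tau>)) \<partial>lebesgue) \<le> 1"
    let ?Q = "cube c l"
    define m where "m = l ^ CARD('n)"
    have m: "0 < m" using l by (simp add: m_def)
    have em: "emeasure lebesgue ?Q = ennreal m" unfolding m_def by (rule emeasure_cube) (use l in simp)
    have D_meas [measurable]: "(\<lambda>x. D x (u x)) \<in> borel_measurable lebesgue" if "u \<in> borel_measurable lebesgue" for u
      unfolding D_def V_def W_def kap_def using that by measurable
    obtain Z where Z: "(\<integral>\<^sup>+x\<in>?Q. ennreal (D x (h x powr \<tau>)) \<partial>lebesgue) = ennreal Z" "0 \<le> Z" "Z \<le> 1"
      using le1 by (cases "\<integral>\<^sup>+x\<in>?Q. ennreal (D x (h x powr \<tau>)) \<partial>lebesgue") (auto simp: top_unique)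
    \<comment> \<open>Here the threshold follows \<open>h\<close> instead of a fixed
      \<open>s\<close>: on \<open>E\<close> the integrand \<open>D x (h x powr \<tau>)\<close> is
      the pure power with exponent \<open>P\<close>, and off \<open>E\<close>, where
      \<open>h\<close> does not vanish, it carries the untruncated weight
      \<open>a powr (- b)\<close>.\<close>
    define E where "E = ?Q \<inter> {x \<in> space lebesgue. a x < kap (h x powr \<tau>)}"
    have [measurable]: "E \<in> sets lebesgue" unfolding E_def kap_def by measurable
    \<comment> \<open>Off \<open>E\<close> and for \<open>h x \<noteq> 0\<close> the integrand
      dominates \<open>h x powr \<kappa> * V s x\<close> for any \<open>s > 0\<close>, since
      truncation can only lower \<open>a powr (- b)\<close>. Hoelder against
      \<open>W s powr (1 + \<epsilon>)\<close> bounds the integral of \<open>h\<close>, and the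
      Muckenhoupt condition for an admissible \<open>s\<close> eliminates
      \<open>\<alpha>\<close>.\<close>
    have key: "\<exists>\<beta> i. 0 < \<beta> \<and> 0 \<le> i \<and> (\<integral>\<^sup>+x\<in>?Q. ennreal (V s x) \<partial>lebesgue) = ennreal \<beta> \<and>
      (\<integral>\<^sup>+x\<in>?Q - E. ennreal (h x) \<partial>lebesgue) \<le> ennreal i \<and> i powr \<kappa> * \<beta> \<le> C1 * m powr \<kappa> * Z"
      if s: "0 < s" and Ds: "(\<integral>\<^sup>+x\<in>?Q. ennreal (D x s) \<partial>lebesgue) \<le> 1" for s
    proof -
      obtain \<alpha> \<beta> where \<alpha>\<beta>: "0 < \<alpha>" "0 < \<beta>" "(\<integral>\<^sup>+x\<in>?Q. ennreal (W s x) \<partial>lebesgue) = ennreal \<alpha>"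
        "(\<integral>\<^sup>+x\<in>?Q. ennreal (V s x) \<partial>lebesgue) = ennreal \<beta>" "\<alpha> * \<beta> powr (q - 1) \<le> (C + 1) * m powr q"
        unfolding m_def by (rule muckenhoupt[OF C s l Ds])
      define N where "N = A * (\<alpha> / m) powr \<epsilon> * \<alpha>"
      have N: "0 < N" using A \<alpha>\<beta>(1) m by (simp add: N_def)
      have WN: "(\<integral>\<^sup>+x\<in>?Q. ennreal (W s x powr (1 + \<epsilon>)) \<partial>lebesgue) \<le> ennreal N"
        unfolding N_def m_def by (rule RH[OF s l Ds \<alpha>\<beta>(1) \<epsilon> order_refl]) (simp add: \<alpha>\<beta>(3))
      define i where "i = Z powr (1 / \<kappa>) * N powr (1 - 1 / \<kappa>)"
      have eq: "h x = (h x powr \<kappa> * V s x) powr (1 / \<kappa>) * (W s x powr (1 + \<epsilon>)) powr (1 - 1 / \<kappa>)" for x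
      proof -
        have "(1 + \<epsilon>) * (1 - 1 / \<kappa>) = b / \<kappa>" unfolding e1[symmetric] using \<kappa> by (simp add: field_simps)
        then have "(W s x powr (1 + \<epsilon>)) powr (1 - 1 / \<kappa>) = W s x powr (b / \<kappa>)" by (simp add: powr_powr)
        moreover have "V s x powr (1 / \<kappa>) = W s x powr (- (b / \<kappa>))" by (simp add: V_def powr_powr)
        ultimately have "V s x powr (1 / \<kappa>) * (W s x powr (1 + \<epsilon>)) powr (1 - 1 / \<kappa>) = 1"
          using W_pos[OF s, of x] by (simp only: powr_add[symmetric]) simp
        then show ?thesis using hnn \<kappa> V_pos[OF s, of x] by (simp add: powr_mult powr_powr mult.assoc)
      qed
      have VD: "h x powr \<kappa> * V s x \<le> D x (h x powr \<tau>)" if x: "x \<in> ?Q - E" for x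
      proof (cases "h x = 0")
        case False
        then have hx: "0 < h x" using hnn by (simp add: order.strict_iff_order)
        have ax: "kap (h x powr \<tau>) \<le> a x" using x by (auto simp: E_def)
        have apos: "0 < a x" using kap_pos[of "h x powr \<tau>"] hx ax by simp
        have "V s x \<le> a x powr (- b)"
          unfolding V_def using apos b by (intro powr_mono2') (auto simp: W_def)
        also have "\<dots> = V (h x powr \<tau>) x" using ax by (simp add: V_def W_def max_def)
        finally have "h x powr \<kappa> * V s x \<le> h x powr \<kappa> * V (h x powr \<tau>) x" by (rule mult_left_mono) simp
        then show ?thesis by (simp add: D_def powr_powr \<tau>b)
      qed (simp add: D_nonneg)
      have "(\<integral>\<^sup>+x\<in>?Q - E. ennreal (h x) \<partial>lebesgue) = (\<integral>\<^sup>+x\<in>?Q - E. ennreal ((h x powr \<kappa> * V s x) powr (1 / \<kappa>) * (W s x powr (1 + \<epsilon>)) powr (1 - 1 / \<kappa>)) \<partial>lebesgue)"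
        by (rule nn_integral_cong) (simp only: eq[symmetric])
      also have "\<dots> \<le> ennreal i"
        unfolding i_def
      proof (rule holder_nn_integral)
        have "(\<integral>\<^sup>+x\<in>?Q - E. ennreal (h x powr \<kappa> * V s x) \<partial>lebesgue) \<le> (\<integral>\<^sup>+x\<in>?Q. ennreal (D x (h x powr \<tau>)) \<partial>lebesgue)"
        proof (rule nn_integral_mono)
          fix x
          show "ennreal (h x powr \<kappa> * V s x) * indicator (?Q - E) x \<le> ennreal (D x (h x powr \<tau>)) * indicator ?Q x"
            using VD[of x] by (cases "x \<in> ?Q - E") (auto intro: ennreal_leI)
        qed
        then show "(\<integral>\<^sup>+x\<in>?Q - E. ennreal (h x powr \<kappa> * V s x) \<partial>lebesgue) \<le> ennreal Z" using Z(1) by simp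
        have "(\<integral>\<^sup>+x\<in>?Q - E. ennreal (W s x powr (1 + \<epsilon>)) \<partial>lebesgue) \<le> (\<integral>\<^sup>+x\<in>?Q. ennreal (W s x powr (1 + \<epsilon>)) \<partial>lebesgue)"
          by (rule nn_integral_mono) (auto simp: indicator_def)
        then show "(\<integral>\<^sup>+x\<in>?Q - E. ennreal (W s x powr (1 + \<epsilon>)) \<partial>lebesgue) \<le> ennreal N" using WN by simp
      qed (use \<kappa> Z N V_pos[OF s] in \<open>auto simp: less_imp_le\<close>)
      finally have Ile: "(\<integral>\<^sup>+x\<in>?Q - E. ennreal (h x) \<partial>lebesgue) \<le> ennreal i" .
      have "(1 - 1 / \<kappa>) * \<kappa> = \<kappa> - 1" using \<kappa> by (simp add: left_diff_distrib)
      then have "i powr \<kappa> = Z * N powr (\<kappa> - 1)"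
        using Z(2) \<kappa> by (simp add: i_def powr_mult powr_powr)
      also have "N powr (\<kappa> - 1) = A powr (\<kappa> - 1) * ((\<alpha> / m) powr (1 + b - \<kappa>) * \<alpha> powr (\<kappa> - 1))"
        using A \<alpha>\<beta>(1) m by (simp add: N_def powr_mult powr_powr e2)
      also have "(\<alpha> / m) powr (1 + b - \<kappa>) * \<alpha> powr (\<kappa> - 1) = \<alpha> powr (1 + b - \<kappa> + (\<kappa> - 1)) / m powr (1 + b - \<kappa>)"
        using \<alpha>\<beta>(1) m by (simp only: powr_add) (simp add: powr_divide)
      also have "1 + b - \<kappa> + (\<kappa> - 1) = b" by simp
      finally have iN: "i powr \<kappa> * \<beta> = Z * A powr (\<kappa> - 1) * (\<alpha> powr b * \<beta>) / m powr (1 + b - \<kappa>)" by simp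
      have "\<alpha> powr b * \<beta> = (\<alpha> * \<beta> powr (q - 1)) powr b"
        using \<alpha>\<beta>(1,2) exp_b(1) by (simp add: powr_mult powr_powr mult.commute)
      also have "\<dots> \<le> ((C + 1) * m powr q) powr b"
        using \<alpha>\<beta> b by (intro powr_mono2) auto
      also have "\<dots> = (C + 1) powr b * m powr (1 + b)"
        using C0 m exp_b(3) by (simp add: powr_mult powr_powr)
      finally have "Z * A powr (\<kappa> - 1) * (\<alpha> powr b * \<beta>) / m powr (1 + b - \<kappa>)
        \<le> Z * A powr (\<kappa> - 1) * ((C + 1) powr b * m powr (1 + b)) / m powr (1 + b - \<kappa>)"
        using Z(2) by (intro divide_right_mono mult_left_mono) auto
      also have "\<dots> = C1 * m powr \<kappa> * Z"
      proof -
        have "m powr (1 + b) = m powr \<kappa> * m powr (1 + b - \<kappa>)" by (simp only: powr_add[symmetric]) simp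
        then show ?thesis using m by (simp add: C1_def)
      qed
      finally have "i powr \<kappa> * \<beta> \<le> C1 * m powr \<kappa> * Z" unfolding iN .
      then show ?thesis using \<alpha>\<beta>(2,4) Ile by (intro exI[of _ \<beta>] exI[of _ i]) (simp add: i_def)
    qed
    obtain s0 where s0: "0 < s0" "(\<integral>\<^sup>+x\<in>?Q. ennreal (D x s0) \<partial>lebesgue) \<le> 1"
      using C l unfolding balanced_def by blast
    obtain I1 where I1: "(\<integral>\<^sup>+x\<in>?Q - E. ennreal (h x) \<partial>lebesgue) = ennreal I1" "0 \<le> I1"
      using key[OF s0] by (cases "\<integral>\<^sup>+x\<in>?Q - E. ennreal (h x) \<partial>lebesgue") (auto simp: top_unique)
    define A1 where "A1 = I1 / m"
    have A1: "0 \<le> A1" using I1 m by (simp add: A1_def)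
    define J where "J \<rho> = (\<integral>\<^sup>+x\<in>?Q. ennreal (D x ((\<rho> * A1) powr \<tau>)) \<partial>lebesgue)" for \<rho>
    \<comment> \<open>For \<open>A1 > 0\<close>, admissibility of
      \<open>s = (\<rho> * A1) powr \<tau>\<close> is precisely \<open>J \<rho> \<le> 1\<close>.
      Once it is granted, \<open>key\<close> with this \<open>s\<close> improves the crude bound to
      one proportional to \<open>Z\<close>.\<close>
    have star: "J \<rho> \<le> ennreal (C1 * \<rho> powr \<kappa> * Z)" if \<rho>: "0 < \<rho>" and J1: "J \<rho> \<le> 1" for \<rho>
    proof (cases "A1 = 0")
      case True
      then show ?thesis by (simp add: J_def D_def)
    next
      case False
      then have A1p: "0 < A1" using A1 by simp
      define s where "s = (\<rho> * A1) powr \<tau>"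
      have s: "0 < s" using \<rho> A1p by (simp add: s_def)
      obtain \<beta> i where bi: "0 < \<beta>" "0 \<le> i" "(\<integral>\<^sup>+x\<in>?Q. ennreal (V s x) \<partial>lebesgue) = ennreal \<beta>"
        "(\<integral>\<^sup>+x\<in>?Q - E. ennreal (h x) \<partial>lebesgue) \<le> ennreal i" "i powr \<kappa> * \<beta> \<le> C1 * m powr \<kappa> * Z"
        using key[OF s] J1 unfolding J_def s_def by blast
      have "I1 \<le> i" using bi(2,4) unfolding I1(1) by (simp add: ennreal_le_iff)
      then have "A1 powr \<kappa> \<le> i powr \<kappa> / m powr \<kappa>"
        unfolding A1_def using I1(2) m \<kappa> by (simp add: powr_divide divide_right_mono powr_mono2)
      then have "A1 powr \<kappa> * \<beta> \<le> i powr \<kappa> / m powr \<kappa> * \<beta>" using bi(1) by (intro mult_right_mono) auto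
      also have "\<dots> \<le> C1 * Z" using bi(5) m by (simp add: divide_le_eq mult_ac)
      finally have A1\<beta>: "A1 powr \<kappa> * \<beta> \<le> C1 * Z" .
      have "J \<rho> = (\<integral>\<^sup>+x. ennreal (s powr (1 + b)) * (ennreal (V s x) * indicator ?Q x) \<partial>lebesgue)"
        unfolding J_def s_def[symmetric] D_def using V_pos[OF s] by (simp add: ennreal_mult''[OF less_imp_le] mult.assoc)
      also have "\<dots> = ennreal (s powr (1 + b)) * ennreal \<beta>"
        unfolding bi(3)[symmetric] by (rule nn_integral_cmult) measurable
      also have "\<dots> = ennreal (\<rho> powr \<kappa> * (A1 powr \<kappa> * \<beta>))"
        using \<rho> A1p bi(1) by (simp add: s_def powr_powr \<tau>b powr_mult ennreal_mult[symmetric] mult.assoc)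
      also have "\<dots> \<le> ennreal (\<rho> powr \<kappa> * (C1 * Z))" by (intro ennreal_leI mult_left_mono[OF A1\<beta>]) simp
      finally show ?thesis by (simp add: mult_ac)
    qed
    have Jscale: "J (k * \<rho>) \<le> ennreal (k powr d) * J \<rho>" if "1 \<le> k" "0 \<le> \<rho>" for k \<rho>
    proof -
      have "J (k * \<rho>) \<le> (\<integral>\<^sup>+x. ennreal (k powr d) * (ennreal (D x ((\<rho> * A1) powr \<tau>)) * indicator ?Q x) \<partial>lebesgue)"
        unfolding J_def
      proof (rule nn_integral_mono)
        fix x
        have "D x ((k * (\<rho> * A1)) powr \<tau>) \<le> k powr d * D x ((\<rho> * A1) powr \<tau>)"
          by (rule growth_upper(1)[OF gt]) (use that A1 in auto)
        then have "ennreal (D x ((k * \<rho> * A1) powr \<tau>)) \<le> ennreal (k powr d) * ennreal (D x ((\<rho> * A1) powr \<tau>))"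
          unfolding ennreal_mult''[OF D_nonneg, symmetric] by (simp add: mult.assoc ennreal_leI)
        then show "ennreal (D x ((k * \<rho> * A1) powr \<tau>)) * indicator ?Q x \<le> ennreal (k powr d) * (ennreal (D x ((\<rho> * A1) powr \<tau>)) * indicator ?Q x)"
          by (simp add: indicator_def)
      qed
      also have "\<dots> = ennreal (k powr d) * J \<rho>"
        unfolding J_def by (rule nn_integral_cmult) measurable
      finally show ?thesis .
    qed
    \<comment> \<open>\<open>D\<close> never exceeds the power with exponent \<open>P\<close>, so a
      sufficiently small multiple of \<open>A1\<close> has modular at most 1 on the cube. The number
      of halvings may depend on the cube and on \<open>h\<close>; only its existence
      matters.\<close>
    have small: "\<exists>k. J (\<rho>0 / 2 ^ k) \<le> 1"
    proof -
      define y where "y = (1 / m) powr (1 / d)"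
      have y: "0 < y" using m by (simp add: y_def)
      obtain k where "\<rho>0 * A1 / y < 2 ^ k" using real_arch_pow[of 2 "\<rho>0 * A1 / y"] by auto
      then have ky: "\<rho>0 / 2 ^ k * A1 \<le> y" using y by (simp add: field_simps)
      have "J (\<rho>0 / 2 ^ k) \<le> (\<integral>\<^sup>+x\<in>?Q. ennreal (1 / m) \<partial>lebesgue)"
        unfolding J_def
      proof (intro nn_integral_mono mult_right_mono ennreal_leI)
        fix x
        have "D x ((\<rho>0 / 2 ^ k * A1) powr \<tau>) \<le> ((\<rho>0 / 2 ^ k * A1) powr \<tau>) powr P"
          unfolding P_def by (rule D_le_powr) simp
        also have "\<dots> = (\<rho>0 / 2 ^ k * A1) powr d" by (simp add: powr_powr d_def mult.commute)
        also have "\<dots> \<le> y powr d" using ky \<rho>0 A1 d0 by (intro powr_mono2) auto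
        also have "\<dots> = 1 / m" using d0 m by (simp add: y_def powr_powr)
        finally show "D x ((\<rho>0 / 2 ^ k * A1) powr \<tau>) \<le> 1 / m" .
      qed simp
      also have "\<dots> = 1" using m by (simp add: nn_integral_cmult_indicator em ennreal_mult''[symmetric])
      finally show ?thesis by blast
    qed
    \<comment> \<open>Climbing back: each doubling costs \<open>2 powr d\<close>, and
      \<open>star\<close> together with the choice of \<open>\<rho>0\<close> keeps the modular at
      most 1. The multiple \<open>\<rho>0\<close> reached in the end is the same for all cubes and
      all \<open>h\<close>, so passing from it to \<open>A1\<close> costs a fixed constant.\<close>
    have "J (\<rho>0 / 2 ^ k) \<le> 1 \<Longrightarrow> J \<rho>0 \<le> 1" for k
    proof (induction k)
      case (Suc k)
      have pos: "0 < \<rho>0 / 2 ^ Suc k" using \<rho>0 by simp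
      have "J (\<rho>0 / 2 ^ k) = J (2 * (\<rho>0 / 2 ^ Suc k))" by simp
      also have "\<dots> \<le> ennreal (2 powr d) * J (\<rho>0 / 2 ^ Suc k)" using pos by (intro Jscale) auto
      also have "\<dots> \<le> ennreal (2 powr d) * ennreal (C1 * (\<rho>0 / 2 ^ Suc k) powr \<kappa> * Z)"
        by (intro mult_left_mono star pos Suc.prems) simp
      also have "\<dots> = ennreal (2 powr d * (C1 * (\<rho>0 / 2 ^ Suc k) powr \<kappa> * Z))"
        using C1 Z(2) by (intro ennreal_mult''[symmetric]) auto
      also have "\<dots> \<le> ennreal 1"
      proof (rule ennreal_leI)
        have "\<rho>0 / 2 ^ Suc k \<le> \<rho>0 / 1" using \<rho>0 by (intro divide_left_mono) (auto simp del: power_Suc)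
        then have "(\<rho>0 / 2 ^ Suc k) powr \<kappa> \<le> \<rho>0 powr \<kappa>" using \<rho>0 \<kappa> by (intro powr_mono2) auto
        then have "C1 * (\<rho>0 / 2 ^ Suc k) powr \<kappa> * Z \<le> C1 * \<rho>0 powr \<kappa> * 1"
          using C1 Z by (intro mult_mono mult_left_mono) auto
        then have "2 powr d * (C1 * (\<rho>0 / 2 ^ Suc k) powr \<kappa> * Z) \<le> 2 powr d * (C1 * \<rho>0 powr \<kappa>)"
          by (intro mult_left_mono) auto
        then show "2 powr d * (C1 * (\<rho>0 / 2 ^ Suc k) powr \<kappa> * Z) \<le> 1" using \<rho>0\<kappa> by linarith
      qed
      finally show ?case using Suc.IH by simp
    qed simp
    then have "J \<rho>0 \<le> 1" using small by blast
    from star[OF \<rho>0(1) this] have "J \<rho>0 \<le> ennreal (C1 * \<rho>0 powr \<kappa> * Z)" .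
    also have "\<dots> \<le> ennreal (C1 * Z)"
    proof (rule ennreal_leI)
      have "\<rho>0 powr \<kappa> \<le> 1" using \<rho>0 \<kappa> by (intro powr_le1) auto
      then have "C1 * \<rho>0 powr \<kappa> * Z \<le> C1 * 1 * Z" using C1 Z(2) by (intro mult_right_mono mult_left_mono) auto
      then show "C1 * \<rho>0 powr \<kappa> * Z \<le> C1 * Z" by simp
    qed
    finally have J\<rho>0: "J \<rho>0 \<le> ennreal (C1 * Z)" .
    have "J (1 / \<rho>0 * \<rho>0) \<le> ennreal ((1 / \<rho>0) powr d) * J \<rho>0" using \<rho>0 by (intro Jscale) auto
    also have "\<dots> \<le> ennreal ((1 / \<rho>0) powr d) * ennreal (C1 * Z)" by (rule mult_left_mono[OF J\<rho>0]) simp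
    also have "\<dots> = ennreal (K1 * Z)" using C1 Z(2) by (simp add: K1_def ennreal_mult mult.assoc)
    finally have D1: "(\<integral>\<^sup>+x\<in>?Q. ennreal (D x (A1 powr \<tau>)) \<partial>lebesgue) \<le> ennreal (K1 * Z)"
      using \<rho>0 by (simp add: J_def)
    have I2le: "(\<integral>\<^sup>+x\<in>E. ennreal (h x) \<partial>lebesgue) \<le> ennreal (Z powr (1 / (\<tau> * P)) * m powr (1 - 1 / (\<tau> * P)))"
    proof -
      have "(\<integral>\<^sup>+x\<in>E. ennreal (h x) \<partial>lebesgue) = (\<integral>\<^sup>+x\<in>E. ennreal ((h x powr (\<tau> * P)) powr (1 / (\<tau> * P)) * 1 powr (1 - 1 / (\<tau> * P))) \<partial>lebesgue)"
      proof -
        have "\<tau> * P * (1 / (\<tau> * P)) = 1" using P b \<tau>0 by simp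
        then show ?thesis using hnn by (simp only: powr_powr) simp
      qed
      also have "\<dots> \<le> ennreal (Z powr (1 / (\<tau> * P)) * m powr (1 - 1 / (\<tau> * P)))"
      proof (rule holder_nn_integral)
        have "(\<integral>\<^sup>+x\<in>E. ennreal (h x powr (\<tau> * P)) \<partial>lebesgue) \<le> (\<integral>\<^sup>+x\<in>?Q. ennreal (D x (h x powr \<tau>)) \<partial>lebesgue)"
        proof (rule nn_integral_mono)
          fix x
          show "ennreal (h x powr (\<tau> * P)) * indicator E x \<le> ennreal (D x (h x powr \<tau>)) * indicator ?Q x"
          proof (cases "x \<in> E")
            case True
            then have ax: "x \<in> ?Q" "a x < kap (h x powr \<tau>)" by (simp_all add: E_def)
            have "h x \<noteq> 0"
            proof
              assume "h x = 0"
              then show False using ax(2) a_nonneg[of x] by (simp add: kap_def)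
            qed
            then have "0 < h x powr \<tau>" by simp
            then have "D x (h x powr \<tau>) = (h x powr \<tau>) powr P"
              unfolding P_def by (rule D_eq_powr) (use ax in simp)
            then show ?thesis using True ax(1) by (simp add: powr_powr)
          qed simp
        qed
        then show "(\<integral>\<^sup>+x\<in>E. ennreal (h x powr (\<tau> * P)) \<partial>lebesgue) \<le> ennreal Z" using Z(1) by simp
        have "(\<integral>\<^sup>+x\<in>E. ennreal 1 \<partial>lebesgue) \<le> (\<integral>\<^sup>+x\<in>?Q. ennreal 1 \<partial>lebesgue)"
          by (rule nn_integral_mono) (auto simp: E_def indicator_def)
        then show "(\<integral>\<^sup>+x\<in>E. ennreal 1 \<partial>lebesgue) \<le> ennreal m" using em by simp
      qed (use tP Z m in auto)
      finally show ?thesis .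
    qed
    then obtain I2 where I2: "(\<integral>\<^sup>+x\<in>E. ennreal (h x) \<partial>lebesgue) = ennreal I2" "0 \<le> I2"
      by (cases "\<integral>\<^sup>+x\<in>E. ennreal (h x) \<partial>lebesgue") (auto simp: top_unique)
    define A2 where "A2 = I2 / m"
    have A2: "0 \<le> A2" using I2 m by (simp add: A2_def)
    \<comment> \<open>The pure power on \<open>E\<close> gave an unweighted Jensen inequality; the
      constant \<open>A2\<close> can then be estimated on the whole cube because \<open>D\<close>
      lies below that power everywhere.\<close>
    have D2: "(\<integral>\<^sup>+x\<in>?Q. ennreal (D x (A2 powr \<tau>)) \<partial>lebesgue) \<le> ennreal Z"
    proof -
      have tP': "(1 - 1 / (\<tau> * P)) * (\<tau> * P) = \<tau> * P - 1" "1 / (\<tau> * P) * (\<tau> * P) = 1"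
        using P b \<tau>0 by (simp_all add: left_diff_distrib)
      have "I2 \<le> Z powr (1 / (\<tau> * P)) * m powr (1 - 1 / (\<tau> * P))"
        using I2le unfolding I2(1) by (simp add: ennreal_le_iff)
      then have "I2 powr (\<tau> * P) \<le> (Z powr (1 / (\<tau> * P)) * m powr (1 - 1 / (\<tau> * P))) powr (\<tau> * P)"
        using I2(2) tP by (intro powr_mono2) auto
      also have "\<dots> = Z * m powr (\<tau> * P - 1)"
        using Z(2) by (simp only: powr_mult powr_powr tP' powr_one)
      finally have "m * (I2 powr (\<tau> * P) / m powr (\<tau> * P)) \<le> m * (Z * m powr (\<tau> * P - 1) / m powr (\<tau> * P))"
        using m by (intro mult_left_mono divide_right_mono) auto
      also have "\<dots> = Z" using m by (simp add: powr_diff)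
      finally have mA: "A2 powr (\<tau> * P) * m \<le> Z" using I2(2) m by (simp add: A2_def powr_divide mult.commute)
      have "(\<integral>\<^sup>+x\<in>?Q. ennreal (D x (A2 powr \<tau>)) \<partial>lebesgue) \<le> (\<integral>\<^sup>+x\<in>?Q. ennreal (A2 powr (\<tau> * P)) \<partial>lebesgue)"
      proof (intro nn_integral_mono mult_right_mono ennreal_leI)
        fix x
        show "D x (A2 powr \<tau>) \<le> A2 powr (\<tau> * P)"
          using D_le_powr[of "A2 powr \<tau>" x] by (simp add: powr_powr P_def)
      qed simp
      also have "\<dots> = ennreal (A2 powr (\<tau> * P) * m)" using m by (simp add: nn_integral_cmult_indicator em ennreal_mult)
      also have "\<dots> \<le> ennreal Z" by (rule ennreal_leI[OF mA])
      finally show ?thesis .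
    qed
    define Av where "Av = A1 + A2"
    have Av: "0 \<le> Av" using A1 A2 by (simp add: Av_def)
    have "(\<integral>\<^sup>+x\<in>?Q. ennreal (h x) \<partial>lebesgue) = (\<integral>\<^sup>+x. ennreal (h x) * indicator (?Q - E) x + ennreal (h x) * indicator E x \<partial>lebesgue)"
      by (rule nn_integral_cong) (auto simp: indicator_def E_def)
    also have "\<dots> = (\<integral>\<^sup>+x\<in>?Q - E. ennreal (h x) \<partial>lebesgue) + (\<integral>\<^sup>+x\<in>E. ennreal (h x) \<partial>lebesgue)"
      by (rule nn_integral_add) measurable
    also have "\<dots> = ennreal (Av * m)"
      unfolding I1(1) I2(1) using I1(2) I2(2) m by (simp add: Av_def A1_def A2_def distrib_right)
    finally have Iav: "(\<integral>\<^sup>+x\<in>?Q. ennreal (h x) \<partial>lebesgue) = ennreal (Av * m)" .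
    have "(\<integral>\<^sup>+x\<in>?Q. ennreal (D x (Av powr \<tau>)) \<partial>lebesgue)
      \<le> (\<integral>\<^sup>+x. ennreal (2 powr d) * (ennreal (D x (A1 powr \<tau>)) * indicator ?Q x + ennreal (D x (A2 powr \<tau>)) * indicator ?Q x) \<partial>lebesgue)"
    proof (rule nn_integral_mono)
      fix x
      have "D x (Av powr \<tau>) \<le> D x ((2 * max A1 A2) powr \<tau>)"
        using Av by (intro growth_mono[OF gt]) (auto simp: Av_def)
      also have "\<dots> \<le> 2 powr d * D x ((max A1 A2) powr \<tau>)"
        by (rule growth_upper(1)[OF gt]) (use A1 in auto)
      also have "D x ((max A1 A2) powr \<tau>) \<le> D x (A1 powr \<tau>) + D x (A2 powr \<tau>)"
        using D_nonneg[of x "A1 powr \<tau>"] D_nonneg[of x "A2 powr \<tau>"] by (simp add: max_def)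
      finally have "D x (Av powr \<tau>) \<le> 2 powr d * (D x (A1 powr \<tau>) + D x (A2 powr \<tau>))" by simp
      then have "ennreal (D x (Av powr \<tau>)) \<le> ennreal (2 powr d * (D x (A1 powr \<tau>) + D x (A2 powr \<tau>)))" by (rule ennreal_leI)
      also have "\<dots> = ennreal (2 powr d) * (ennreal (D x (A1 powr \<tau>)) + ennreal (D x (A2 powr \<tau>)))"
        using D_nonneg by (simp add: ennreal_mult)
      finally show "ennreal (D x (Av powr \<tau>)) * indicator ?Q x \<le> ennreal (2 powr d) * (ennreal (D x (A1 powr \<tau>)) * indicator ?Q x + ennreal (D x (A2 powr \<tau>)) * indicator ?Q x)"
        by (simp add: indicator_def)
    qed
    also have "\<dots> = ennreal (2 powr d) * ((\<integral>\<^sup>+x\<in>?Q. ennreal (D x (A1 powr \<tau>)) \<partial>lebesgue) + (\<integral>\<^sup>+x\<in>?Q. ennreal (D x (A2 powr \<tau>)) \<partial>lebesgue))"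
      by (subst nn_integral_cmult) (simp_all add: nn_integral_add)
    also have "\<dots> \<le> ennreal (2 powr d) * (ennreal (K1 * Z) + ennreal Z)"
      by (intro mult_left_mono add_mono D1 D2) simp
    also have "\<dots> = ennreal K * ennreal Z"
      using K1 Z(2) by (simp add: K_def ennreal_mult[symmetric] ennreal_plus[symmetric] algebra_simps del: ennreal_plus)
    finally have fin: "(\<integral>\<^sup>+x\<in>?Q. ennreal (D x (Av powr \<tau>)) \<partial>lebesgue) \<le> ennreal K * (\<integral>\<^sup>+x\<in>?Q. ennreal (D x (h x powr \<tau>)) \<partial>lebesgue)"
      unfolding Z(1) .
    show "\<exists>Av\<ge>0. (\<integral>\<^sup>+x\<in>?Q. ennreal (h x) \<partial>lebesgue) = ennreal (Av * l ^ CARD('n)) \<and>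
      (\<integral>\<^sup>+x\<in>?Q. ennreal (D x (Av powr \<tau>)) \<partial>lebesgue) \<le> ennreal K * (\<integral>\<^sup>+x\<in>?Q. ennreal (D x (h x powr \<tau>)) \<partial>lebesgue)"
      using Av Iav fin by (intro exI[of _ Av]) (simp add: m_def)
  qed
  then show ?thesis using \<tau>0 \<tau>1 K by blast
qed

end

section \<open>Modulars and norms\<close>

definition comparable :: "('a \<Rightarrow> real \<Rightarrow> ennreal) \<Rightarrow> ('a \<Rightarrow> real \<Rightarrow> real) \<Rightarrow> real \<Rightarrow> bool" where
  "comparable \<phi> \<Phi> k \<longleftrightarrow> 1 \<le> k \<and> (\<forall>x t. 0 \<le> t \<longrightarrow> ennreal (\<Phi> x t / k) \<le> \<phi> x t \<and> \<phi> x t \<le> ennreal (k * \<Phi> x t))"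

section \<open>Comparison and scaling of modulars\<close>

lemma comparable_zero: "comparable \<phi> \<Phi> k \<Longrightarrow> growth \<Phi> c d \<Longrightarrow> \<phi> x 0 = 0"
  using growth_zero[of \<Phi> c d x] unfolding comparable_def by (metis ennreal_0 le_zero_eq mult_zero_right order_refl)

lemma extend_mono:
  assumes "\<And>s t. 0 \<le> s \<Longrightarrow> s \<le> t \<Longrightarrow> \<phi> x s \<le> \<phi> x t" "u \<le> v"
  shows "extend \<phi> x u \<le> extend \<phi> x v"
proof (cases "v = \<infinity>")
  case False
  then have "u \<noteq> \<infinity>" using assms(2) by (auto simp: top_unique)
  moreover have "enn2real u \<le> enn2real v"
    using assms(2) False by (intro enn2real_mono) (auto simp: top.not_eq_extremum)
  ultimately show ?thesis using False assms(1) by (simp add: extend_def)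
qed (simp add: extend_def)

lemma extend_comparable:
  assumes "comparable \<phi> \<Phi> k" "\<And>t. 0 \<le> t \<Longrightarrow> 0 \<le> \<Phi> x t"
  shows "extend \<phi> x u \<le> ennreal k * extend (\<lambda>x t. ennreal (\<Phi> x t)) x u"
    and "ennreal (1 / k) * extend (\<lambda>x t. ennreal (\<Phi> x t)) x u \<le> extend \<phi> x u"
proof -
  have k: "1 \<le> k" using assms(1) by (simp add: comparable_def)
  have *: "ennreal (\<Phi> x t / k) \<le> \<phi> x t" "\<phi> x t \<le> ennreal (k * \<Phi> x t)" if "0 \<le> t" for t
    using assms(1) that by (simp_all add: comparable_def)
  show "extend \<phi> x u \<le> ennreal k * extend (\<lambda>x t. ennreal (\<Phi> x t)) x u"
  proof (cases "u = \<infinity>")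
    case True
    then show ?thesis using k by (simp add: extend_def ennreal_mult_top)
  next
    case False
    then show ?thesis using *(2)[of "enn2real u"] assms(2)[of "enn2real u"] by (simp add: extend_def ennreal_mult'')
  qed
  show "ennreal (1 / k) * extend (\<lambda>x t. ennreal (\<Phi> x t)) x u \<le> extend \<phi> x u"
  proof (cases "u = \<infinity>")
    case False
    then show ?thesis using *(1)[of "enn2real u"] assms(2)[of "enn2real u"] by (simp add: extend_def ennreal_mult''[symmetric])
  qed (simp add: extend_def)
qed

lemma extend_measurable:
  assumes car: "caratheodory \<Phi>" and [measurable]: "u \<in> borel_measurable lebesgue"
  shows "(\<lambda>x. extend (\<lambda>x t. ennreal (\<Phi> x t)) x (u x)) \<in> borel_measurable lebesgue"
proof -
  have [measurable]: "(\<lambda>x. \<Phi> x (enn2real (u x))) \<in> borel_measurable lebesgue"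
    by (rule caratheodoryD[OF car]) simp_all
  show ?thesis unfolding extend_def by measurable
qed

lemma modular_comparable:
  fixes \<phi> :: "real ^ 'n \<Rightarrow> real \<Rightarrow> ennreal"
  assumes cmp: "comparable \<phi> \<Phi> k" and g: "growth \<Phi> c d" and car: "caratheodory \<Phi>"
    and u: "u \<in> borel_measurable lebesgue"
  shows "modular \<phi> u \<le> ennreal k * modular (\<lambda>x t. ennreal (\<Phi> x t)) u"
    and "modular (\<lambda>x t. ennreal (\<Phi> x t)) u \<le> ennreal k * modular \<phi> u"
proof -
  have k: "1 \<le> k" using cmp by (simp add: comparable_def)
  note [measurable] = extend_measurable[OF car u]
  have "modular \<phi> u \<le> (\<integral>\<^sup>+x. ennreal k * extend (\<lambda>x t. ennreal (\<Phi> x t)) x (u x) \<partial>lebesgue)"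
    unfolding modular_def by (intro nn_integral_mono extend_comparable(1)[OF cmp] growth_nonneg[OF g])
  also have "\<dots> = ennreal k * modular (\<lambda>x t. ennreal (\<Phi> x t)) u"
    unfolding modular_def by (rule nn_integral_cmult) measurable
  finally show "modular \<phi> u \<le> ennreal k * modular (\<lambda>x t. ennreal (\<Phi> x t)) u" .
  have "ennreal (1 / k) * modular (\<lambda>x t. ennreal (\<Phi> x t)) u = (\<integral>\<^sup>+x. ennreal (1 / k) * extend (\<lambda>x t. ennreal (\<Phi> x t)) x (u x) \<partial>lebesgue)"
    unfolding modular_def by (rule nn_integral_cmult[symmetric]) measurable
  also have "\<dots> \<le> modular \<phi> u"
    unfolding modular_def by (intro nn_integral_mono extend_comparable(2)[OF cmp] growth_nonneg[OF g])
  finally have "ennreal k * (ennreal (1 / k) * modular (\<lambda>x t. ennreal (\<Phi> x t)) u) \<le> ennreal k * modular \<phi> u"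
    by (rule mult_left_mono) simp
  moreover have "ennreal k * ennreal (1 / k) = 1" using k by (simp add: ennreal_mult[symmetric])
  ultimately show "modular (\<lambda>x t. ennreal (\<Phi> x t)) u \<le> ennreal k * modular \<phi> u"
    by (simp add: mult.assoc[symmetric])
qed

lemma modular_scale:
  fixes \<Phi> :: "real ^ 'n \<Rightarrow> real \<Rightarrow> real"
  assumes g: "growth \<Phi> c d" and car: "caratheodory \<Phi>" and u [measurable]: "u \<in> borel_measurable lebesgue" and K: "1 \<le> K"
  shows "modular (\<lambda>x t. ennreal (\<Phi> x t)) (\<lambda>x. u x / ennreal K) \<le> ennreal (K powr (- c)) * modular (\<lambda>x t. ennreal (\<Phi> x t)) u"
    and "modular (\<lambda>x t. ennreal (\<Phi> x t)) (\<lambda>x. ennreal K * u x) \<le> ennreal (K powr d) * modular (\<lambda>x t. ennreal (\<Phi> x t)) u"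
proof -
  note [measurable] = extend_measurable[OF car u]
  have "modular (\<lambda>x t. ennreal (\<Phi> x t)) (\<lambda>x. u x / ennreal K)
    \<le> (\<integral>\<^sup>+x. ennreal (K powr (- c)) * extend (\<lambda>x t. ennreal (\<Phi> x t)) x (u x) \<partial>lebesgue)"
    unfolding modular_def
  proof (rule nn_integral_mono)
    fix x
    show "extend (\<lambda>x t. ennreal (\<Phi> x t)) x (u x / ennreal K) \<le> ennreal (K powr (- c)) * extend (\<lambda>x t. ennreal (\<Phi> x t)) x (u x)"
    proof (cases "u x")
      case (real r)
      have "\<Phi> x (1 / K * r) \<le> (1 / K) powr c * \<Phi> x r"
        using K real by (intro growth_lower(1)[OF g]) auto
      also have "(1 / K) powr c = K powr (- c)" using K by (simp add: powr_divide powr_minus_divide)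
      finally have "ennreal (\<Phi> x (r / K)) \<le> ennreal (K powr (- c)) * ennreal (\<Phi> x r)"
        unfolding ennreal_mult''[OF growth_nonneg[OF g real(1)], symmetric] by (simp add: ennreal_leI)
      then show ?thesis using real K by (simp add: extend_def divide_ennreal)
    next
      case top
      then show ?thesis using K by (simp add: extend_def ennreal_mult_top)
    qed
  qed
  also have "\<dots> = ennreal (K powr (- c)) * modular (\<lambda>x t. ennreal (\<Phi> x t)) u"
    unfolding modular_def by (rule nn_integral_cmult) measurable
  finally show "modular (\<lambda>x t. ennreal (\<Phi> x t)) (\<lambda>x. u x / ennreal K) \<le> ennreal (K powr (- c)) * modular (\<lambda>x t. ennreal (\<Phi> x t)) u" .
  have "modular (\<lambda>x t. ennreal (\<Phi> x t)) (\<lambda>x. ennreal K * u x)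
    \<le> (\<integral>\<^sup>+x. ennreal (K powr d) * extend (\<lambda>x t. ennreal (\<Phi> x t)) x (u x) \<partial>lebesgue)"
    unfolding modular_def
  proof (rule nn_integral_mono)
    fix x
    show "extend (\<lambda>x t. ennreal (\<Phi> x t)) x (ennreal K * u x) \<le> ennreal (K powr d) * extend (\<lambda>x t. ennreal (\<Phi> x t)) x (u x)"
    proof (cases "u x")
      case (real r)
      have "\<Phi> x (K * r) \<le> K powr d * \<Phi> x r" by (rule growth_upper(1)[OF g real(1) K])
      then have "ennreal (\<Phi> x (K * r)) \<le> ennreal (K powr d) * ennreal (\<Phi> x r)"
        unfolding ennreal_mult''[OF growth_nonneg[OF g real(1)], symmetric] by (rule ennreal_leI)
      then show ?thesis using real K by (simp add: extend_def ennreal_mult[symmetric])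
    next
      case top
      then show ?thesis using K by (simp add: extend_def ennreal_mult_top)
    qed
  qed
  also have "\<dots> = ennreal (K powr d) * modular (\<lambda>x t. ennreal (\<Phi> x t)) u"
    unfolding modular_def by (rule nn_integral_cmult) measurable
  finally show "modular (\<lambda>x t. ennreal (\<Phi> x t)) (\<lambda>x. ennreal K * u x) \<le> ennreal (K powr d) * modular (\<lambda>x t. ennreal (\<Phi> x t)) u" .
qed

lemma modular_mono:
  assumes "\<And>x s t. 0 \<le> s \<Longrightarrow> s \<le> t \<Longrightarrow> \<phi> x s \<le> \<phi> x t" "\<And>x. u x \<le> v x"
  shows "modular \<phi> u \<le> modular \<phi> v"
  unfolding modular_def by (intro nn_integral_mono extend_mono assms)

section \<open>The Luxemburg norm as an infimum, and homogeneity of the maximal operator\<close>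

lemma lux_norm_le: "0 < r \<Longrightarrow> modular \<phi> (\<lambda>x. u x / ennreal r) \<le> 1 \<Longrightarrow> lux_norm \<phi> u \<le> ennreal r"
  unfolding lux_norm_def by (rule Inf_lower) blast

text \<open>Nothing is claimed about attainment of the infimum; a strict upper bound produces an
  admissible radius below it. This is the source of the additional 1 or factor 2 in several
  constants.\<close>

lemma lux_norm_lessD:
  assumes "lux_norm \<phi> u < R"
  obtains r where "0 < r" "ennreal r < R" "modular \<phi> (\<lambda>x. u x / ennreal r) \<le> 1"
  using assms unfolding lux_norm_def Inf_less_iff by blast

lemma lux_norm_le_mult:
  assumes K: "0 < K" and le: "\<And>r. 0 < r \<Longrightarrow> modular \<phi> (\<lambda>x. u x / ennreal r) \<le> 1 \<Longrightarrow> L \<le> ennreal (K * r)"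
  shows "L \<le> ennreal K * lux_norm \<phi> u"
proof -
  have KK: "ennreal K * ennreal (1 / K) = 1" using K by (simp add: ennreal_mult[symmetric])
  have "ennreal (1 / K) * L \<le> lux_norm \<phi> u"
    unfolding lux_norm_def
  proof (rule Inf_greatest)
    fix y assume "y \<in> {ennreal r |r. 0 < r \<and> modular \<phi> (\<lambda>x. u x / ennreal r) \<le> 1}"
    then obtain r where r: "y = ennreal r" "0 < r" "modular \<phi> (\<lambda>x. u x / ennreal r) \<le> 1" by blast
    have "ennreal (1 / K) * L \<le> ennreal (1 / K) * ennreal (K * r)" by (rule mult_left_mono[OF le[OF r(2,3)]]) simp
    also have "\<dots> = ennreal r" using K r(2) by (simp add: ennreal_mult[symmetric])
    finally show "ennreal (1 / K) * L \<le> y" unfolding r(1) .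
  qed
  then have "ennreal K * (ennreal (1 / K) * L) \<le> ennreal K * lux_norm \<phi> u" by (rule mult_left_mono) simp
  then show ?thesis by (simp add: mult.assoc[symmetric] KK)
qed

lemma maximal_scale:
  fixes f :: "real ^ 'n \<Rightarrow> real"
  assumes f [measurable]: "f \<in> borel_measurable lebesgue" and K: "0 < K"
  shows "maximal (\<lambda>x. K * f x) x = ennreal K * maximal f x"
proof -
  have "(\<integral>\<^sup>+y\<in>Q. ennreal \<bar>K * f y\<bar> \<partial>lebesgue) = ennreal K * (\<integral>\<^sup>+y\<in>Q. ennreal \<bar>f y\<bar> \<partial>lebesgue)" if Q: "Q \<in> cubes" for Q
  proof -
    have [measurable]: "Q \<in> sets lebesgue" using Q by (auto simp: cubes_eq)
    have "(\<integral>\<^sup>+y\<in>Q. ennreal \<bar>K * f y\<bar> \<partial>lebesgue) = (\<integral>\<^sup>+y. ennreal K * (ennreal \<bar>f y\<bar> * indicator Q y) \<partial>lebesgue)"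
      using K by (simp add: abs_mult ennreal_mult mult.assoc)
    also have "\<dots> = ennreal K * (\<integral>\<^sup>+y\<in>Q. ennreal \<bar>f y\<bar> \<partial>lebesgue)" by (rule nn_integral_cmult) measurable
    finally show ?thesis .
  qed
  then have "maximal (\<lambda>x. K * f x) x = (SUP Q\<in>{Q \<in> cubes. x \<in> Q}. ennreal K * ((\<integral>\<^sup>+y\<in>Q. ennreal \<bar>f y\<bar> \<partial>lebesgue) / emeasure lebesgue Q))"
    unfolding maximal_def by (intro SUP_cong) (auto simp: ennreal_times_divide)
  also have "\<dots> = ennreal K * maximal f x"
    unfolding maximal_def
    by (rule SUP_mult_left_ennreal[symmetric])
  finally show ?thesis .
qed

lemma scale_inverse_ennreal:
  assumes "0 < r" shows "ennreal (1 / r) * v = v / ennreal r"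
  using assms by (simp add: divide_ennreal_def inverse_ennreal mult.commute inverse_eq_divide)

section \<open>From modular to norm inequalities\<close>

definition modular_strong_type :: "(real ^ 'n \<Rightarrow> real \<Rightarrow> real) \<Rightarrow> bool" where
  "modular_strong_type \<Phi> \<longleftrightarrow> (\<exists>C>0. \<forall>f\<in>borel_measurable lebesgue. (\<integral>\<^sup>+x. ennreal (\<Phi> x \<bar>f x\<bar>) \<partial>lebesgue) \<le> 1 \<longrightarrow>
    (\<integral>\<^sup>+x. extend (\<lambda>x t. ennreal (\<Phi> x t)) x (maximal f x) \<partial>lebesgue) \<le> ennreal C * (\<integral>\<^sup>+x. ennreal (\<Phi> x \<bar>f x\<bar>) \<partial>lebesgue))"

lemma modular_abs: "modular \<phi> (\<lambda>x. ennreal \<bar>f x\<bar>) = (\<integral>\<^sup>+x. \<phi> x \<bar>f x\<bar> \<partial>lebesgue)"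
  by (simp add: modular_def extend_def)

text \<open>A norm of at most 1 for \<open>\<phi>\<close> does not quite give a modular of at most 1
  for \<open>\<Phi>\<close>, as the strong type estimate requires. Division by a fixed
  \<open>L\<close> repairs this; since \<open>maximal\<close> is homogeneous, the growth exponent
  \<open>d\<close> bounds the cost of multiplying back.\<close>

lemma maximal_modular_boundedI:
  fixes \<phi> :: "real ^ 'n \<Rightarrow> real \<Rightarrow> ennreal"
  assumes cmp: "comparable \<phi> \<Phi> k" and g: "growth \<Phi> c d" and car: "caratheodory \<Phi>" and st: "modular_strong_type \<Phi>"
  shows "maximal_modular_bounded \<phi>"
proof -
  let ?\<Phi> = "\<lambda>x t. ennreal (\<Phi> x t)"
  have k: "1 \<le> k" using cmp by (simp add: comparable_def)
  have c: "0 < c" "0 < d" using g by (simp_all add: growth_def)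
  obtain C where C: "0 < C" "\<And>f. f \<in> borel_measurable lebesgue \<Longrightarrow> modular ?\<Phi> (\<lambda>x. ennreal \<bar>f x\<bar>) \<le> 1 \<Longrightarrow>
    modular ?\<Phi> (maximal f) \<le> ennreal C * modular ?\<Phi> (\<lambda>x. ennreal \<bar>f x\<bar>)"
    using st unfolding modular_strong_type_def modular_abs unfolding modular_def by blast
  \<comment> \<open>The 2 outweighs the radius \<open>r < 2\<close> obtained from the norm, and
    \<open>k powr (1 / c)\<close> lowers the modular by the comparison factor
    \<open>k\<close>.\<close>
  define L where "L = 2 * k powr (1 / c)"
  have k1: "1 \<le> k powr (1 / c)" using k c by (simp add: ge_one_powr_ge_zero)
  have L: "1 \<le> L" using k1 by (simp add: L_def)
  define C' where "C' = k * L powr d * C * k"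
  have C': "0 < C'" using k L C by (simp add: C'_def)
  show ?thesis
    unfolding maximal_modular_bounded_def
  proof (intro exI[of _ C'] conjI C' ballI impI)
    fix f assume f: "f \<in> L_space \<phi>" and "lux_norm \<phi> (\<lambda>x. ennreal \<bar>f x\<bar>) \<le> 1"
    have f_meas [measurable]: "f \<in> borel_measurable lebesgue" using f by (simp add: L_space_def)
    have "lux_norm \<phi> (\<lambda>x. ennreal \<bar>f x\<bar>) < ennreal 2"
      using \<open>lux_norm _ _ \<le> 1\<close> by (rule order.strict_trans1) simp
    then obtain r where r: "0 < r" "ennreal r < ennreal 2" "modular \<phi> (\<lambda>x. ennreal \<bar>f x\<bar> / ennreal r) \<le> 1"
      by (rule lux_norm_lessD)
    have r2: "r < 2" using r(1,2) by (simp add: ennreal_less_iff)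
    define gf where "gf x = 1 / L * f x" for x
    have gf_meas [measurable]: "gf \<in> borel_measurable lebesgue" unfolding gf_def by measurable
    have "modular ?\<Phi> (\<lambda>x. ennreal \<bar>gf x\<bar>) \<le> modular ?\<Phi> (\<lambda>x. (ennreal \<bar>f x\<bar> / ennreal r) / ennreal (k powr (1 / c)))"
    proof (rule modular_mono)
      show "ennreal (\<Phi> x s) \<le> ennreal (\<Phi> x t)" if "0 \<le> s" "s \<le> t" for x s t
        using growth_mono[OF g that] by (rule ennreal_leI)
      fix x
      have "\<bar>gf x\<bar> \<le> \<bar>f x\<bar> / r / k powr (1 / c)"
      proof -
        have "\<bar>gf x\<bar> = \<bar>f x\<bar> / (2 * k powr (1 / c))" using k by (simp add: gf_def L_def abs_mult)
        also have "\<dots> \<le> \<bar>f x\<bar> / (r * k powr (1 / c))"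
          using r(1) r2 k1 k by (intro divide_left_mono mult_right_mono mult_pos_pos) auto
        finally show ?thesis by simp
      qed
      then have "ennreal \<bar>gf x\<bar> \<le> ennreal (\<bar>f x\<bar> / r / k powr (1 / c))" by (rule ennreal_leI)
      also have "\<dots> = ennreal \<bar>f x\<bar> / ennreal r / ennreal (k powr (1 / c))"
        using r(1) k by (simp add: divide_ennreal)
      finally show "ennreal \<bar>gf x\<bar> \<le> ennreal \<bar>f x\<bar> / ennreal r / ennreal (k powr (1 / c))" .
    qed
    also have "\<dots> \<le> ennreal ((k powr (1 / c)) powr (- c)) * modular ?\<Phi> (\<lambda>x. ennreal \<bar>f x\<bar> / ennreal r)"
      by (rule modular_scale(1)[OF g car _ k1]) measurable
    also have "\<dots> \<le> ennreal ((k powr (1 / c)) powr (- c)) * (ennreal k * modular \<phi> (\<lambda>x. ennreal \<bar>f x\<bar> / ennreal r))"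
      by (intro mult_left_mono modular_comparable(2)[OF cmp g car]) simp_all
    also have "\<dots> \<le> ennreal ((k powr (1 / c)) powr (- c)) * (ennreal k * 1)"
      by (intro mult_left_mono r(3)) simp_all
    also have "\<dots> = 1"
    proof -
      have "(k powr (1 / c)) powr (- c) * k = 1" using k c by (simp add: powr_powr powr_minus)
      then show ?thesis using k by (simp add: ennreal_mult[symmetric])
    qed
    finally have g1: "modular ?\<Phi> (\<lambda>x. ennreal \<bar>gf x\<bar>) \<le> 1" .
    have fgf: "f x = L * gf x" for x using L by (simp add: gf_def)
    have "maximal f = (\<lambda>x. ennreal L * maximal gf x)"
    proof
      fix x
      have "maximal (\<lambda>x. L * gf x) x = ennreal L * maximal gf x" by (rule maximal_scale[OF gf_meas]) (use L in simp)
      then show "maximal f x = ennreal L * maximal gf x" by (simp only: fgf[symmetric])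
    qed
    then have "modular ?\<Phi> (maximal f) \<le> ennreal (L powr d) * modular ?\<Phi> (maximal gf)"
      using modular_scale(2)[OF g car borel_measurable_maximal L, of gf] by simp
    also have "\<dots> \<le> ennreal (L powr d) * (ennreal C * modular ?\<Phi> (\<lambda>x. ennreal \<bar>gf x\<bar>))"
      by (intro mult_left_mono C(2) gf_meas g1) simp
    also have "\<dots> \<le> ennreal (L powr d) * (ennreal C * modular ?\<Phi> (\<lambda>x. ennreal \<bar>f x\<bar>))"
    proof (intro mult_left_mono modular_mono)
      show "ennreal (\<Phi> x s) \<le> ennreal (\<Phi> x t)" if "0 \<le> s" "s \<le> t" for x s t
        using growth_mono[OF g that] by (rule ennreal_leI)
      show "ennreal \<bar>gf x\<bar> \<le> ennreal \<bar>f x\<bar>" for x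
        using L by (intro ennreal_leI) (simp add: gf_def abs_mult divide_le_eq mult_le_cancel_left1)
    qed simp_all
    also have "\<dots> \<le> ennreal (L powr d) * (ennreal C * (ennreal k * modular \<phi> (\<lambda>x. ennreal \<bar>f x\<bar>)))"
      by (intro mult_left_mono modular_comparable(2)[OF cmp g car]) simp_all
    finally have *: "modular ?\<Phi> (maximal f) \<le> ennreal (L powr d) * (ennreal C * (ennreal k * modular \<phi> (\<lambda>x. ennreal \<bar>f x\<bar>)))" .
    have "modular \<phi> (maximal f) \<le> ennreal k * modular ?\<Phi> (maximal f)"
      by (rule modular_comparable(1)[OF cmp g car]) simp
    also have "\<dots> \<le> ennreal k * (ennreal (L powr d) * (ennreal C * (ennreal k * modular \<phi> (\<lambda>x. ennreal \<bar>f x\<bar>))))"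
      by (rule mult_left_mono[OF *]) simp
    also have "\<dots> = ennreal C' * modular \<phi> (\<lambda>x. ennreal \<bar>f x\<bar>)"
      using k C(1) by (simp add: C'_def ennreal_mult mult.assoc)
    finally show "modular \<phi> (maximal f) \<le> ennreal C' * modular \<phi> (\<lambda>x. ennreal \<bar>f x\<bar>)" .
  qed
qed

text \<open>By homogeneity the modular bound is applied to \<open>f / r\<close>, whose modular is at
  most 1. A modular of at most \<open>C\<close> becomes one of at most 1 after division by a large
  \<open>K\<close>, because the lower growth exponent is positive.\<close>

lemma maximal_modular_bounded_imp_bounded:
  fixes \<phi> :: "real ^ 'n \<Rightarrow> real \<Rightarrow> ennreal"
  assumes cmp: "comparable \<phi> \<Phi> k" and g: "growth \<Phi> c d" and car: "caratheodory \<Phi>" and mb: "maximal_modular_bounded \<phi>"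
  shows "maximal_bounded \<phi>"
proof -
  let ?\<Phi> = "\<lambda>x t. ennreal (\<Phi> x t)"
  have k: "1 \<le> k" using cmp by (simp add: comparable_def)
  have c: "0 < c" using g by (simp add: growth_def)
  obtain C where C: "0 < C" "\<And>f. f \<in> L_space \<phi> \<Longrightarrow> lux_norm \<phi> (\<lambda>x. ennreal \<bar>f x\<bar>) \<le> 1 \<Longrightarrow>
     modular \<phi> (maximal f) \<le> ennreal C * modular \<phi> (\<lambda>x. ennreal \<bar>f x\<bar>)"
    using mb unfolding maximal_modular_bounded_def by blast
  \<comment> \<open>\<open>k * k * C\<close> collects two comparisons and the modular constant; the
    added 1 ensures \<open>1 \<le> K\<close>, as scaling by growth demands.\<close>
  define K where "K = (k * k * C + 1) powr (1 / c)"
  have K1: "1 \<le> K" using k C c by (simp add: K_def ge_one_powr_ge_zero)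
  have Kc: "k * (K powr (- c) * (k * C)) \<le> 1"
  proof -
    have "K powr (- c) = 1 / (k * k * C + 1)" using k C c by (simp add: K_def powr_powr powr_minus_divide)
    moreover have "0 < k * k * C + 1" using k C(1) by (intro add_nonneg_pos mult_nonneg_nonneg) auto
    ultimately show ?thesis by (simp add: divide_le_eq)
  qed
  show ?thesis
    unfolding maximal_bounded_def
  proof (intro exI[of _ K] conjI ballI)
    show "0 \<le> K" using K1 by simp
    fix f assume f: "f \<in> L_space \<phi>"
    have f_meas [measurable]: "f \<in> borel_measurable lebesgue" using f by (simp add: L_space_def)
    show "lux_norm \<phi> (maximal f) \<le> ennreal K * lux_norm \<phi> (\<lambda>x. ennreal \<bar>f x\<bar>)"
    proof (rule lux_norm_le_mult)
      show "0 < K" using K1 by simp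
      fix r assume r: "0 < r" and m1: "modular \<phi> (\<lambda>x. ennreal \<bar>f x\<bar> / ennreal r) \<le> 1"
      define gf where "gf x = 1 / r * f x" for x
      have gf_meas [measurable]: "gf \<in> borel_measurable lebesgue" unfolding gf_def by measurable
      have gf: "ennreal \<bar>gf x\<bar> = ennreal \<bar>f x\<bar> / ennreal r" for x
        using r by (simp add: gf_def abs_mult divide_ennreal)
      have lux1: "lux_norm \<phi> (\<lambda>x. ennreal \<bar>gf x\<bar>) \<le> ennreal 1"
      proof (rule lux_norm_le)
        have "v / 1 = v" for v :: ennreal by (simp add: divide_ennreal_def)
        then show "modular \<phi> (\<lambda>x. ennreal \<bar>gf x\<bar> / ennreal 1) \<le> 1" using m1 by (simp add: gf)
      qed simp
      then have gL: "gf \<in> L_space \<phi>"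
        unfolding L_space_def using order.strict_trans1[OF lux1, of \<infinity>] by simp
      have "modular \<phi> (maximal gf) \<le> ennreal C * modular \<phi> (\<lambda>x. ennreal \<bar>gf x\<bar>)"
        by (rule C(2)[OF gL]) (use lux1 in simp)
      also have "\<dots> \<le> ennreal C * 1" by (rule mult_left_mono) (use m1 in \<open>simp_all add: gf\<close>)
      finally have mC: "modular \<phi> (maximal gf) \<le> ennreal C" by simp
      have Mf: "maximal f x / ennreal (K * r) = maximal gf x / ennreal K" for x
      proof -
        have "maximal gf x = maximal f x / ennreal r"
          unfolding gf_def using maximal_scale[OF f_meas, of "1 / r" x] r by (simp add: scale_inverse_ennreal)
        then show ?thesis using r K1
          by (simp add: scale_inverse_ennreal[symmetric] mult.assoc[symmetric] ennreal_mult[symmetric])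
      qed
      have "modular \<phi> (\<lambda>x. maximal f x / ennreal (K * r)) \<le> ennreal k * modular ?\<Phi> (\<lambda>x. maximal gf x / ennreal K)"
        unfolding Mf by (rule modular_comparable(1)[OF cmp g car]) measurable
      also have "\<dots> \<le> ennreal k * (ennreal (K powr (- c)) * modular ?\<Phi> (maximal gf))"
        by (intro mult_left_mono modular_scale(1)[OF g car _ K1]) simp_all
      also have "\<dots> \<le> ennreal k * (ennreal (K powr (- c)) * (ennreal k * modular \<phi> (maximal gf)))"
        by (intro mult_left_mono modular_comparable(2)[OF cmp g car]) simp_all
      also have "\<dots> \<le> ennreal k * (ennreal (K powr (- c)) * (ennreal k * ennreal C))"
        by (intro mult_left_mono mC) simp_all
      also have "\<dots> = ennreal (k * (K powr (- c) * (k * C)))" using k C by (simp add: ennreal_mult)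
      also have "\<dots> \<le> ennreal 1" by (rule ennreal_leI[OF Kc])
      finally show "lux_norm \<phi> (maximal f) \<le> ennreal (K * r)"
        using r K1 by (intro lux_norm_le) auto
    qed
  qed
qed

section \<open>Testing on indicators, and Jensen's inequality for the maximal function\<close>

lemma modular_indicator:
  fixes \<phi> :: "real ^ 'n \<Rightarrow> real \<Rightarrow> ennreal"
  assumes "\<And>x. \<phi> x 0 = 0" "0 < r"
  shows "modular \<phi> (\<lambda>x. indicator Q x / ennreal r) = (\<integral>\<^sup>+x\<in>Q. \<phi> x (1 / r) \<partial>lebesgue)"
proof -
  have "1 / ennreal r = ennreal (1 / r)" using divide_ennreal[of 1 r] assms(2) by simp
  then have "extend \<phi> x (indicator Q x / ennreal r) = \<phi> x (1 / r) * indicator Q x" for x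
    using assms by (simp add: extend_def indicator_def)
  then show ?thesis unfolding modular_def by simp
qed

lemma maximal_lower:
  fixes f :: "real ^ 'n \<Rightarrow> real"
  assumes "0 < l" "x \<in> cube c l" "0 \<le> t" "ennreal (t * l ^ CARD('n)) \<le> (\<integral>\<^sup>+y\<in>cube c l. ennreal \<bar>f y\<bar> \<partial>lebesgue)"
  shows "ennreal t \<le> maximal f x"
proof -
  have em: "emeasure lebesgue (cube c l) = ennreal (l ^ CARD('n))" by (rule emeasure_cube) (use assms in simp)
  have p: "0 < l ^ CARD('n)" using assms by simp
  have "ennreal t = ennreal (t * l ^ CARD('n)) / ennreal (l ^ CARD('n))"
    using p assms(1,3) by (simp add: divide_ennreal)
  also have "\<dots> \<le> (\<integral>\<^sup>+y\<in>cube c l. ennreal \<bar>f y\<bar> \<partial>lebesgue) / emeasure lebesgue (cube c l)"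
    unfolding em by (rule divide_right_mono_ennreal[OF assms(4)])
  also have "\<dots> \<le> maximal f x"
    unfolding maximal_def by (rule SUP_upper) (use assms in \<open>auto simp: cubes_eq\<close>)
  finally show ?thesis .
qed

text \<open>Testing: \<open>maximal f\<close> is at least \<open>t\<close> on the cube, so
  \<open>t\<close> times the norm of the indicator is at most the norm of \<open>maximal f\<close>,
  hence at most \<open>B * K\<close>. The added 1 makes the bound strict, so that an admissible
  radius exists.\<close>

lemma lux_norm_indicator_le:
  fixes \<phi> :: "real ^ 'n \<Rightarrow> real \<Rightarrow> ennreal"
  assumes mono: "\<And>x s t. 0 \<le> s \<Longrightarrow> s \<le> t \<Longrightarrow> \<phi> x s \<le> \<phi> x t"
    and bd: "\<And>f. f \<in> L_space \<phi> \<Longrightarrow> lux_norm \<phi> (maximal f) \<le> ennreal B * lux_norm \<phi> (\<lambda>x. ennreal \<bar>f x\<bar>)" and B: "0 \<le> B"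
    and f: "f \<in> borel_measurable lebesgue" "lux_norm \<phi> (\<lambda>x. ennreal \<bar>f x\<bar>) \<le> ennreal K" "0 \<le> K"
    and l: "0 < l" and t: "0 < t" and avg: "ennreal (t * l ^ CARD('n)) \<le> (\<integral>\<^sup>+y\<in>cube c l. ennreal \<bar>f y\<bar> \<partial>lebesgue)"
  shows "lux_norm \<phi> (indicator (cube c l)) \<le> ennreal ((B * K + 1) / t)"
proof -
  have fL: "f \<in> L_space \<phi>" using f by (auto simp: L_space_def intro: order.strict_trans1)
  have "lux_norm \<phi> (maximal f) \<le> ennreal B * ennreal K"
    using bd[OF fL] mult_left_mono[OF f(2), of "ennreal B"] by (rule order_trans) simp
  also have "\<dots> < ennreal (B * K + 1)" using B f(3) by (simp add: ennreal_mult[symmetric] ennreal_less_iff)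
  finally obtain r where r: "0 < r" "ennreal r < ennreal (B * K + 1)" "modular \<phi> (\<lambda>x. maximal f x / ennreal r) \<le> 1"
    by (rule lux_norm_lessD)
  have "modular \<phi> (\<lambda>x. indicator (cube c l) x / ennreal (r / t)) \<le> modular \<phi> (\<lambda>x. maximal f x / ennreal r)"
  proof (rule modular_mono[OF mono])
    fix x
    show "indicator (cube c l) x / ennreal (r / t) \<le> maximal f x / ennreal r"
    proof (cases "x \<in> cube c l")
      case True
      have "1 / ennreal (r / t) = ennreal t / ennreal r"
        using divide_ennreal[of 1 "r / t"] divide_ennreal[of t r] r t by simp
      also have "\<dots> \<le> maximal f x / ennreal r"
        using maximal_lower[OF l True less_imp_le[OF t] avg] by (rule divide_right_mono_ennreal)
      finally show ?thesis using True by simp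
    qed simp
  qed
  then have "lux_norm \<phi> (indicator (cube c l)) \<le> ennreal (r / t)"
    using r t by (intro lux_norm_le) (auto intro: order_trans)
  also have "\<dots> \<le> ennreal ((B * K + 1) / t)"
    using r(1,2) t by (intro ennreal_leI divide_right_mono) (auto simp: ennreal_less_iff)
  finally show ?thesis .
qed

text \<open>Jensen's inequality for the power \<open>1 / s\<close> on each cube, in the form of
  Hoelder's inequality with second factor 1. The finite bound \<open>u\<close> avoids powers of
  extended reals.\<close>

lemma maximal_jensen:
  fixes f :: "real ^ 'n \<Rightarrow> real"
  assumes [measurable]: "f \<in> borel_measurable lebesgue" and s: "0 < s" "s < 1"
    and u: "maximal (\<lambda>x. \<bar>f x\<bar> powr (1 / s)) x \<le> ennreal u" "0 \<le> u"
  shows "maximal f x \<le> ennreal (u powr s)"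
  unfolding maximal_def
proof (rule SUP_least)
  fix Q assume "Q \<in> {Q \<in> cubes. x \<in> Q}"
  then obtain c l where Q: "Q = cube c l" "0 < l" "x \<in> cube c l" by (auto simp: cubes_eq)
  define m where "m = l ^ CARD('n)"
  have m: "0 < m" using Q by (simp add: m_def)
  have em: "emeasure lebesgue Q = ennreal m" unfolding m_def Q(1) by (rule emeasure_cube) (use Q in simp)
  have [measurable]: "Q \<in> sets lebesgue" by (simp add: Q)
  have I: "(\<integral>\<^sup>+y\<in>Q. ennreal (\<bar>f y\<bar> powr (1 / s)) \<partial>lebesgue) \<le> ennreal (u * m)"
  proof (rule ccontr)
    assume "\<not> ?thesis"
    then have "ennreal u < maximal (\<lambda>x. \<bar>f x\<bar> powr (1 / s)) x"
      using Q u(2) by (subst less_maximal_iff) (auto simp: m_def not_le)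
    then show False using u(1) by simp
  qed
  have "(\<integral>\<^sup>+y\<in>Q. ennreal \<bar>f y\<bar> \<partial>lebesgue) = (\<integral>\<^sup>+y\<in>Q. ennreal ((\<bar>f y\<bar> powr (1 / s)) powr s * 1 powr (1 - s)) \<partial>lebesgue)"
    using s by (simp add: powr_powr)
  also have "\<dots> \<le> ennreal ((u * m) powr s * m powr (1 - s))"
    by (rule holder_nn_integral) (use s u m I em in auto)
  also have "(u * m) powr s * m powr (1 - s) = u powr s * m"
  proof -
    have "m powr s * m powr (1 - s) = m" using m by (simp only: powr_add[symmetric]) simp
    then show ?thesis using u(2) m by (simp add: powr_mult)
  qed
  finally have "(\<integral>\<^sup>+y\<in>Q. ennreal \<bar>f y\<bar> \<partial>lebesgue) / emeasure lebesgue Q \<le> ennreal (u powr s * m) / ennreal m"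
    unfolding em by (rule divide_right_mono_ennreal)
  also have "\<dots> = ennreal (u powr s)" using m by (simp add: divide_ennreal)
  finally show "(\<integral>\<^sup>+y\<in>Q. ennreal \<bar>f y\<bar> \<partial>lebesgue) / emeasure lebesgue Q \<le> ennreal (u powr s)" .
qed

section \<open>The double phase function, its conjugate and the extremals of Young's
  inequality\<close>

context double_phase_setting
begin

abbreviation dphase :: "real ^ 'n \<Rightarrow> real \<Rightarrow> ennreal" where
  "dphase \<equiv> double_phase p q a"

lemma comparable_H: "comparable dphase H q"
  unfolding comparable_def
proof (intro conjI allI impI)
  show "1 \<le> q" using q by simp
  fix x and t :: real assume "0 \<le> t"
  have at: "0 \<le> a x * t powr q" using a_nonneg[of x] by simp
  have tp: "0 \<le> t powr p" by simp
  have "1 / q * t powr p \<le> 1 / p * t powr p" using p pq by (intro mult_right_mono divide_left_mono) auto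
  then show "ennreal (H x t / q) \<le> dphase x t"
    unfolding double_phase_def H_def by (intro ennreal_leI) (simp add: add_divide_distrib)
  have "1 / p * t powr p \<le> q * t powr p" "1 / q * (a x * t powr q) \<le> q * (a x * t powr q)"
    using p q at tp by (intro mult_right_mono; simp add: divide_le_eq; smt (verit) mult_less_cancel_left2)+
  then show "dphase x t \<le> ennreal (q * H x t)"
    unfolding double_phase_def H_def by (intro ennreal_leI) (simp add: distrib_left)
qed

lemma mono_phi: "0 \<le> s \<Longrightarrow> s \<le> t \<Longrightarrow> dphase x s \<le> dphase x t"
  unfolding double_phase_def using p q a_nonneg[of x]
  by (intro ennreal_leI add_mono mult_left_mono powr_mono2) auto

lemma mono_conjugate: "s \<le> t \<Longrightarrow> conjugate \<psi> x s \<le> conjugate \<psi> x t"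
  unfolding conjugate_def
proof (rule SUP_mono)
  fix u :: real assume "s \<le> t" "u \<in> {0..}"
  then have "ennreal (s * u) - \<psi> x u \<le> ennreal (t * u) - \<psi> x u"
    by (intro ennreal_minus_mono ennreal_leI mult_right_mono) auto
  then show "\<exists>v\<in>{0..}. ennreal (s * u) - \<psi> x u \<le> ennreal (t * v) - \<psi> x v" using \<open>u \<in> {0..}\<close> by blast
qed

lemma D_eq: "0 \<le> s \<Longrightarrow> D x s = s * (s powr b * V s x)"
  using b by (cases "s = 0") (simp_all add: D_def powr_add)

lemma F_powr: "0 < s \<Longrightarrow> (s powr b * V s x) powr (q - 1) = s / W s x"
proof -
  assume s: "0 < s"
  have "(s powr b * V s x) powr (q - 1) = s powr (b * (q - 1)) * W s x powr (- (b * (q - 1)))"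
    by (simp add: V_def powr_mult powr_powr)
  then show ?thesis using s W_pos[OF s, of x] by (simp add: exp_b powr_minus divide_inverse)
qed

text \<open>\<open>F\<close> is, up to a constant, the point where the supremum defining the
  conjugate is attained. It is the smaller of the solutions of \<open>u powr (p - 1) = s\<close> and
  \<open>a x * u powr (q - 1) = s\<close>, which explains both inequalities and the equality in the
  one that is active.\<close>

lemma F_bounds:
  fixes x :: "real ^ 'n" and s :: real
  assumes s: "0 < s"
  defines "F \<equiv> s powr b * V s x"
  shows "F powr (p - 1) \<le> s" "a x * F powr (q - 1) \<le> s" "0 < F"
    and "kap s \<le> a x \<Longrightarrow> a x * F powr (q - 1) = s" "a x \<le> kap s \<Longrightarrow> F powr (p - 1) = s"
proof -
  have W: "0 < W s x" "a x \<le> W s x" "kap s \<le> W s x" using W_pos[OF s] by (auto simp: W_def)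
  have Fq: "F powr (q - 1) = s / W s x" unfolding F_def by (rule F_powr[OF s])
  show F: "0 < F" using s V_pos[OF s, of x] by (simp add: F_def)
  have "a x * (s / W s x) \<le> W s x * (s / W s x)" using W s by (intro mult_right_mono) auto
  then show "a x * F powr (q - 1) \<le> s" unfolding Fq using W by simp
  show "a x * F powr (q - 1) = s" if "kap s \<le> a x"
  proof -
    have "W s x = a x" using that by (simp add: W_def)
    then show ?thesis unfolding Fq using W(1) by simp
  qed
  have kap_eq: "(kap s powr (- b) * s powr b) powr (p - 1) = s"
  proof -
    have "kap s powr (- b) * s powr b = s powr (e * b + b)"
      using s by (simp add: kap_def powr_powr powr_add)
    then show ?thesis using s p by (simp add: exp_e powr_powr)
  qed
  have "F \<le> kap s powr (- b) * s powr b"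
    unfolding F_def using V_le_kap[OF s, of x] by (simp add: mult.commute mult_left_mono)
  then show "F powr (p - 1) \<le> s"
    using powr_mono2[of "p - 1" F] p F kap_eq by (metis diff_ge_0_iff_ge less_imp_le)
  show "F powr (p - 1) = s" if "a x \<le> kap s"
  proof -
    have "W s x = kap s" using that by (simp add: W_def)
    then show ?thesis using kap_eq by (simp add: F_def V_def mult.commute)
  qed
qed

lemma H_F_le: "0 < s \<Longrightarrow> H x (s powr b * V s x) \<le> 2 * D x s"
proof -
  assume s: "0 < s"
  define F where "F = s powr b * V s x"
  note F = F_bounds[OF s, where x=x, folded F_def]
  have "F powr p = F * F powr (p - 1)" "F powr q = F * F powr (q - 1)"
    using F(3) by (simp_all add: powr_diff)
  then have "H x F = F * (F powr (p - 1) + a x * F powr (q - 1))" by (simp add: H_def algebra_simps)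
  also have "\<dots> \<le> F * (s + s)" using F by (intro mult_left_mono add_mono) auto
  finally show ?thesis using D_eq[of s x] s by (simp add: F_def mult_ac)
qed

text \<open>From below, the supremum is tested at a small multiple \<open>\<theta> * F\<close>,
  where the function costs at most half of \<open>s * (\<theta> * F)\<close>. From above, arguments
  up to \<open>K * F\<close> contribute at most \<open>K * D x s\<close>, and beyond
  \<open>K * F\<close> the phase that is active at \<open>F\<close> alone is already at least
  \<open>s * t\<close>.\<close>

lemma comparable_conjugate: "\<exists>k. comparable (conjugate dphase) D k"
proof -
  \<comment> \<open>\<open>K powr (p - 1) \<ge> p\<close> and \<open>K powr (q - 1) \<ge> q\<close>
    compensate the coefficients \<open>1 / p\<close> and \<open>1 / q\<close>.\<close>
  define K where "K = max (p powr (1 / (p - 1))) (q powr (1 / (q - 1)))"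
  have K1: "1 \<le> K" using p by (simp add: K_def ge_one_powr_ge_zero le_max_iff_disj)
  have Kp: "p \<le> K powr (p - 1)"
  proof -
    have "p = (p powr (1 / (p - 1))) powr (p - 1)" using p by (simp add: powr_powr)
    also have "\<dots> \<le> K powr (p - 1)" using p by (intro powr_mono2) (auto simp: K_def)
    finally show ?thesis .
  qed
  have Kq: "q \<le> K powr (q - 1)"
  proof -
    have "q = (q powr (1 / (q - 1))) powr (q - 1)" using q by (simp add: powr_powr)
    also have "\<dots> \<le> K powr (q - 1)" using q by (intro powr_mono2) (auto simp: K_def)
    finally show ?thesis .
  qed
  \<comment> \<open>With \<open>\<theta> powr (p - 1) = 1 / 4\<close> the cost
    \<open>\<theta> powr p * H x F\<close> is at most \<open>\<theta> / 4 * (2 * D x s)\<close>,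
    half of the gain \<open>\<theta> * D x s\<close>.\<close>
  define \<theta> :: real where "\<theta> = (1 / 4) powr (1 / (p - 1))"
  have \<theta>: "0 < \<theta>" "\<theta> \<le> 1" using p by (auto simp: \<theta>_def intro: powr_le1)
  have \<theta>p: "\<theta> powr p = \<theta> / 4"
  proof -
    have "\<theta> powr p = \<theta> * \<theta> powr (p - 1)" using \<theta> by (simp add: powr_diff)
    also have "\<theta> powr (p - 1) = 1 / 4" using p by (simp add: \<theta>_def powr_powr)
    finally show ?thesis by simp
  qed
  define k where "k = max K (2 / \<theta>)"
  have k: "1 \<le> k" "K \<le> k" "2 / \<theta> \<le> k" using K1 by (auto simp: k_def)
  define \<phi>r where "\<phi>r x t = 1 / p * t powr p + 1 / q * a x * t powr q" for x t
  have \<phi>r: "dphase x t = ennreal (\<phi>r x t)" "0 \<le> \<phi>r x t" for x t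
    using p q a_nonneg[of x] by (simp_all add: double_phase_def \<phi>r_def)
  have conj: "conjugate dphase x s = (SUP t\<in>{0..}. ennreal (s * t - \<phi>r x t))" for x s
    unfolding conjugate_def \<phi>r(1) by (intro SUP_cong refl) (simp add: ennreal_minus \<phi>r(2))
  have "comparable (conjugate dphase) D k"
    unfolding comparable_def
  proof (intro conjI allI impI)
    show "1 \<le> k" by (rule k(1))
    fix x and s :: real assume s0: "0 \<le> s"
    show "ennreal (D x s / k) \<le> conjugate dphase x s"
    proof (cases "s = 0")
      case False
      then have s: "0 < s" using s0 by simp
      define F where "F = s powr b * V s x"
      note F = F_bounds[OF s, where x=x, folded F_def]
      have D: "D x s = s * F" using D_eq[OF s0] by (simp add: F_def)
      have "\<phi>r x (\<theta> * F) \<le> H x (\<theta> * F)"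
      proof -
        have "1 / p * (\<theta> * F) powr p \<le> 1 * (\<theta> * F) powr p" using p by (intro mult_right_mono) auto
        moreover have "1 / q * (a x * (\<theta> * F) powr q) \<le> 1 * (a x * (\<theta> * F) powr q)"
          using q a_nonneg[of x] by (intro mult_right_mono) auto
        ultimately show ?thesis unfolding \<phi>r_def H_def mult.assoc mult_1_left by (rule add_mono)
      qed
      also have "\<dots> \<le> \<theta> powr p * H x F" using F \<theta> by (intro growth_lower(1)[OF H_growth]) auto
      also have "\<dots> \<le> \<theta> / 4 * (2 * D x s)"
        unfolding \<theta>p using H_F_le[OF s, of x] \<theta> by (intro mult_left_mono) (auto simp: F_def)
      finally have "\<theta> / 2 * D x s \<le> s * (\<theta> * F) - \<phi>r x (\<theta> * F)" unfolding D by (simp add: algebra_simps)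
      moreover have "D x s / k \<le> \<theta> / 2 * D x s"
      proof -
        have "1 / k \<le> \<theta> / 2" using k \<theta> by (simp add: field_simps)
        then show ?thesis using mult_right_mono[of "1 / k" "\<theta> / 2" "D x s"] D_nonneg[of x s] by simp
      qed
      ultimately have "ennreal (D x s / k) \<le> ennreal (s * (\<theta> * F) - \<phi>r x (\<theta> * F))" by (intro ennreal_leI) linarith
      also have "\<dots> \<le> conjugate dphase x s" unfolding conj by (rule SUP_upper) (use \<theta> F in auto)
      finally show ?thesis .
    qed (simp add: D_def)
    show "conjugate dphase x s \<le> ennreal (k * D x s)"
      unfolding conj
    proof (rule SUP_least, rule ennreal_leI)
      fix t :: real assume "t \<in> {0..}"
      then have t0: "0 \<le> t" by simp
      have kD: "0 \<le> k * D x s" using k D_nonneg[of x s] by simp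
      show "s * t - \<phi>r x t \<le> k * D x s"
      proof (cases "s = 0")
        case True
        then show ?thesis using \<phi>r(2)[of x t] kD by simp
      next
        case False
        then have s: "0 < s" using s0 by simp
        define F where "F = s powr b * V s x"
        note F = F_bounds[OF s, where x=x, folded F_def]
        have D: "D x s = s * F" using D_eq[OF s0] by (simp add: F_def)
        show ?thesis
        proof (cases "t \<le> K * F")
          case True
          have "s * t \<le> s * (K * F)" using True s by (intro mult_left_mono) auto
          also have "\<dots> \<le> k * D x s" unfolding D using k(2) s F(3) by (simp add: mult_right_mono)
          finally show ?thesis using \<phi>r(2)[of x t] by linarith
        next
          case False
          have "0 < K * F" using F(3) K1 by simp
          then have t: "K * F \<le> t" "0 < t" using False by linarith+
          have tp: "t powr p = t * t powr (p - 1)" "t powr q = t * t powr (q - 1)"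
            using t by (simp_all add: powr_diff)
          have "s * t \<le> \<phi>r x t"
          proof (cases "a x \<le> kap s")
            case True
            have "p * s \<le> K powr (p - 1) * F powr (p - 1)"
              unfolding F(5)[OF True] using Kp s by (intro mult_right_mono) auto
            also have "\<dots> = (K * F) powr (p - 1)" using K1 F(3) by (simp add: powr_mult)
            also have "\<dots> \<le> t powr (p - 1)" using t p K1 F(3) by (intro powr_mono2) auto
            finally have "s \<le> 1 / p * t powr (p - 1)" using p by (simp add: field_simps)
            then have "t * s \<le> t * (1 / p * t powr (p - 1))" using t by (intro mult_left_mono) auto
            moreover have "0 \<le> 1 / q * a x * t powr q" using q a_nonneg[of x] by simp
            ultimately show ?thesis unfolding \<phi>r_def tp(1) by (simp add: mult_ac)
          next
            case False
            then have kx: "kap s \<le> a x" by simp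
            have "q * s \<le> K powr (q - 1) * (a x * F powr (q - 1))"
              unfolding F(4)[OF kx] using Kq s by (intro mult_right_mono) auto
            also have "\<dots> = a x * (K * F) powr (q - 1)" using K1 F(3) by (simp add: powr_mult)
            also have "\<dots> \<le> a x * t powr (q - 1)" using t q K1 F(3) a_nonneg[of x] by (intro mult_left_mono powr_mono2) auto
            finally have "s \<le> 1 / q * (a x * t powr (q - 1))" using q by (simp add: field_simps)
            then have "t * s \<le> t * (1 / q * (a x * t powr (q - 1)))" using t by (intro mult_left_mono) auto
            moreover have "0 \<le> 1 / p * t powr p" using p by simp
            ultimately show ?thesis unfolding \<phi>r_def tp(2) by (simp add: mult_ac)
          qed
          then show ?thesis using kD by linarith
        qed
      qed
    qed
  qed
  then show ?thesis by blast
qed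

end

section \<open>Modulars at the norm of an indicator, and power rescaling\<close>

lemma lux_norm_le_of_modular:
  fixes \<phi> :: "real ^ 'n \<Rightarrow> real \<Rightarrow> ennreal"
  assumes cmp: "comparable \<phi> \<Phi> k" and g: "growth \<Phi> c d" and car: "caratheodory \<Phi>"
    and u [measurable]: "u \<in> borel_measurable lebesgue" and M: "0 \<le> M" "modular (\<lambda>x t. ennreal (\<Phi> x t)) u \<le> ennreal M"
  shows "lux_norm \<phi> u \<le> ennreal ((k * M + 1) powr (1 / c))"
proof -
  define K where "K = (k * M + 1) powr (1 / c)"
  have k: "1 \<le> k" using cmp by (simp add: comparable_def)
  have c: "0 < c" using g by (simp add: growth_def)
  have K: "1 \<le> K" using k M c by (simp add: K_def ge_one_powr_ge_zero)
  have "modular \<phi> (\<lambda>x. u x / ennreal K) \<le> ennreal k * modular (\<lambda>x t. ennreal (\<Phi> x t)) (\<lambda>x. u x / ennreal K)"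
    by (rule modular_comparable(1)[OF cmp g car]) measurable
  also have "\<dots> \<le> ennreal k * (ennreal (K powr (- c)) * ennreal M)"
    using modular_scale(1)[OF g car u K] mult_left_mono[OF M(2), of "ennreal (K powr (- c))"]
    by (intro mult_left_mono) (auto intro: order_trans)
  also have "\<dots> = ennreal (k * (K powr (- c) * M))" using k M by (simp add: ennreal_mult)
  also have "\<dots> \<le> ennreal 1"
  proof (rule ennreal_leI)
    have kM: "0 < k * M + 1" using k M by (intro add_nonneg_pos mult_nonneg_nonneg) auto
    then have "K powr (- c) = 1 / (k * M + 1)" using c by (simp add: K_def powr_powr powr_minus_divide)
    then show "k * (K powr (- c) * M) \<le> 1" using kM by (simp add: divide_le_eq)
  qed
  finally show ?thesis unfolding K_def[symmetric] using K by (intro lux_norm_le) auto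
qed

text \<open>The modular is controlled at arguments a factor 2 away from \<open>1 / \<nu>\<close> on
  either side, where the infimum decides without being attained: some admissible radius lies below
  \<open>2 * \<nu>\<close>, while \<open>\<nu> / 2\<close> is not admissible. Growth then carries
  the upper bound over to the larger argument.\<close>

lemma lux_norm_indicator:
  fixes \<phi> :: "real ^ 'n \<Rightarrow> real \<Rightarrow> ennreal"
  assumes cmp: "comparable \<phi> \<Phi> k" and g: "growth \<Phi> c d" and car: "caratheodory \<Phi>"
    and S [measurable]: "S \<in> sets lebesgue" and i: "(\<integral>\<^sup>+x\<in>S. ennreal (\<Phi> x 1) \<partial>lebesgue) = ennreal i" "0 < i"
  obtains \<nu> where "0 < \<nu>" "lux_norm \<phi> (indicator S) = ennreal \<nu>"
    "(\<integral>\<^sup>+x\<in>S. ennreal (\<Phi> x (1 / (2 * \<nu>))) \<partial>lebesgue) \<le> ennreal k"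
    "(\<integral>\<^sup>+x\<in>S. ennreal (\<Phi> x (2 / \<nu>)) \<partial>lebesgue) \<le> ennreal (4 powr d * k)"
    "ennreal (1 / k) \<le> (\<integral>\<^sup>+x\<in>S. ennreal (\<Phi> x (2 / \<nu>)) \<partial>lebesgue)"
proof -
  have k: "1 \<le> k" using cmp by (simp add: comparable_def)
  have c: "0 < c" using g by (simp add: growth_def)
  have m_meas [measurable]: "(\<lambda>x. \<Phi> x t) \<in> borel_measurable lebesgue" if "0 \<le> t" for t
    by (rule caratheodoryD[OF car]) (use that in simp_all)
  have mod: "modular (\<lambda>x t. ennreal (\<Phi> x t)) (\<lambda>x. indicator S x / ennreal r) = (\<integral>\<^sup>+x\<in>S. ennreal (\<Phi> x (1 / r)) \<partial>lebesgue)" if "0 < r" for r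
    by (rule modular_indicator) (use that growth_zero[OF g] in simp_all)
  have u_meas: "(\<lambda>x. indicator S x / ennreal r) \<in> borel_measurable lebesgue" for r by measurable
  have up: "modular \<phi> (\<lambda>x. indicator S x / ennreal r) \<le> ennreal k * (\<integral>\<^sup>+x\<in>S. ennreal (\<Phi> x (1 / r)) \<partial>lebesgue)" if "0 < r" for r
    using modular_comparable(1)[OF cmp g car u_meas, of r] mod[OF that] by simp
  have low: "(\<integral>\<^sup>+x\<in>S. ennreal (\<Phi> x (1 / r)) \<partial>lebesgue) \<le> ennreal k" if "0 < r" "modular \<phi> (\<lambda>x. indicator S x / ennreal r) \<le> 1" for r
  proof -
    have "(\<integral>\<^sup>+x\<in>S. ennreal (\<Phi> x (1 / r)) \<partial>lebesgue) \<le> ennreal k * modular \<phi> (\<lambda>x. indicator S x / ennreal r)"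
      using modular_comparable(2)[OF cmp g car u_meas, of r] mod[OF that(1)] by simp
    also have "\<dots> \<le> ennreal k * 1" by (rule mult_left_mono[OF that(2)]) simp
    finally show ?thesis by simp
  qed
  have "lux_norm \<phi> (indicator S) \<le> ennreal ((k * i + 1) powr (1 / c))"
  proof (rule lux_norm_le_of_modular[OF cmp g car])
    have "v / 1 = v" for v :: ennreal by (simp add: divide_ennreal_def)
    then show "modular (\<lambda>x t. ennreal (\<Phi> x t)) (indicator S) \<le> ennreal i" using mod[of 1] i(1) by simp
  qed (use i in simp_all)
  then obtain \<nu> where \<nu>: "lux_norm \<phi> (indicator S) = ennreal \<nu>" "0 \<le> \<nu>"
    by (cases "lux_norm \<phi> (indicator S)") (auto simp: top_unique)
  \<comment> \<open>A positive lower bound for all admissible radii, hence for the norm: for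
    \<open>r \<le> 1\<close> the modular at \<open>1 / r\<close> is at least
    \<open>(1 / r) powr c * i\<close>, whereas admissibility bounds it by \<open>k\<close>.\<close>
  define r0 where "r0 = min 1 ((i / k) powr (1 / c))"
  have r0: "0 < r0" using i k by (simp add: r0_def)
  have "ennreal r0 \<le> lux_norm \<phi> (indicator S)"
    unfolding lux_norm_def
  proof (rule Inf_greatest)
    fix y assume "y \<in> {ennreal r |r. 0 < r \<and> modular \<phi> (\<lambda>x. indicator S x / ennreal r) \<le> 1}"
    then obtain r where r: "y = ennreal r" "0 < r" "modular \<phi> (\<lambda>x. indicator S x / ennreal r) \<le> 1" by blast
    have "r0 \<le> r"
    proof (cases "r \<le> 1")
      case True
      have "ennreal ((1 / r) powr c * i) = (\<integral>\<^sup>+x. ennreal ((1 / r) powr c) * (ennreal (\<Phi> x 1) * indicator S x) \<partial>lebesgue)"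
        using i by (subst nn_integral_cmult) (simp_all add: ennreal_mult)
      also have "\<dots> \<le> (\<integral>\<^sup>+x\<in>S. ennreal (\<Phi> x (1 / r)) \<partial>lebesgue)"
      proof (rule nn_integral_mono)
        fix x
        have "(1 / r) powr c * \<Phi> x 1 \<le> \<Phi> x (1 / r * 1)" by (rule growth_upper(2)[OF g]) (use True r in auto)
        then have "ennreal ((1 / r) powr c) * ennreal (\<Phi> x 1) \<le> ennreal (\<Phi> x (1 / r))"
          unfolding ennreal_mult''[OF growth_nonneg[OF g zero_le_one], symmetric] by (simp add: ennreal_leI)
        then show "ennreal ((1 / r) powr c) * (ennreal (\<Phi> x 1) * indicator S x) \<le> ennreal (\<Phi> x (1 / r)) * indicator S x"
          by (simp add: indicator_def)
      qed
      also have "\<dots> \<le> ennreal k" by (rule low[OF r(2,3)])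
      finally have "(1 / r) powr c * i \<le> k" using k by (simp add: ennreal_le_iff)
      then have "i / k \<le> r powr c" using r(2) k by (simp add: powr_divide field_simps)
      then have "(i / k) powr (1 / c) \<le> (r powr c) powr (1 / c)" using i k c by (intro powr_mono2) auto
      then show ?thesis using r(2) c by (simp add: r0_def powr_powr)
    qed (simp add: r0_def)
    then show "ennreal r0 \<le> y" unfolding r(1) by (rule ennreal_leI)
  qed
  then have pos: "0 < \<nu>" using r0 unfolding \<nu>(1) by (simp add: ennreal_le_iff[OF \<nu>(2)])
  have "lux_norm \<phi> (indicator S) < ennreal (2 * \<nu>)" unfolding \<nu>(1) using pos by (simp add: ennreal_less_iff)
  then obtain r where r: "0 < r" "ennreal r < ennreal (2 * \<nu>)" "modular \<phi> (\<lambda>x. indicator S x / ennreal r) \<le> 1"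
    by (rule lux_norm_lessD)
  have r2: "r < 2 * \<nu>" using r(1,2) by (simp add: ennreal_less_iff)
  have "(\<integral>\<^sup>+x\<in>S. ennreal (\<Phi> x (1 / (2 * \<nu>))) \<partial>lebesgue) \<le> (\<integral>\<^sup>+x\<in>S. ennreal (\<Phi> x (1 / r)) \<partial>lebesgue)"
  proof (intro nn_integral_mono mult_right_mono ennreal_leI growth_mono[OF g])
    show "1 / (2 * \<nu>) \<le> 1 / r" using r(1) r2 pos by (intro divide_left_mono) auto
  qed (use pos in auto)
  also have "\<dots> \<le> ennreal k" by (rule low[OF r(1,3)])
  finally have A: "(\<integral>\<^sup>+x\<in>S. ennreal (\<Phi> x (1 / (2 * \<nu>))) \<partial>lebesgue) \<le> ennreal k" .
  have "(\<integral>\<^sup>+x\<in>S. ennreal (\<Phi> x (2 / \<nu>)) \<partial>lebesgue) \<le> (\<integral>\<^sup>+x. ennreal (4 powr d) * (ennreal (\<Phi> x (1 / (2 * \<nu>))) * indicator S x) \<partial>lebesgue)"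
  proof (rule nn_integral_mono)
    fix x
    have n: "0 \<le> 1 / (2 * \<nu>)" using pos by simp
    have "\<Phi> x (4 * (1 / (2 * \<nu>))) \<le> 4 powr d * \<Phi> x (1 / (2 * \<nu>))" by (rule growth_upper(1)[OF g n]) simp
    then have "ennreal (\<Phi> x (2 / \<nu>)) \<le> ennreal (4 powr d) * ennreal (\<Phi> x (1 / (2 * \<nu>)))"
      unfolding ennreal_mult''[OF growth_nonneg[OF g n], symmetric] by (simp add: ennreal_leI)
    then show "ennreal (\<Phi> x (2 / \<nu>)) * indicator S x \<le> ennreal (4 powr d) * (ennreal (\<Phi> x (1 / (2 * \<nu>))) * indicator S x)"
      by (simp add: indicator_def)
  qed
  also have "\<dots> = ennreal (4 powr d) * (\<integral>\<^sup>+x\<in>S. ennreal (\<Phi> x (1 / (2 * \<nu>))) \<partial>lebesgue)"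
    using pos by (intro nn_integral_cmult) simp
  also have "\<dots> \<le> ennreal (4 powr d) * ennreal k" by (rule mult_left_mono[OF A]) simp
  also have "\<dots> = ennreal (4 powr d * k)" using k by (simp add: ennreal_mult)
  finally have B: "(\<integral>\<^sup>+x\<in>S. ennreal (\<Phi> x (2 / \<nu>)) \<partial>lebesgue) \<le> ennreal (4 powr d * k)" .
  have "\<not> modular \<phi> (\<lambda>x. indicator S x / ennreal (\<nu> / 2)) \<le> 1"
  proof
    assume "modular \<phi> (\<lambda>x. indicator S x / ennreal (\<nu> / 2)) \<le> 1"
    then have "ennreal \<nu> \<le> ennreal (\<nu> / 2)" unfolding \<nu>(1)[symmetric] using pos by (intro lux_norm_le) auto
    then show False using pos by (simp add: ennreal_le_iff)
  qed
  then have "1 \<le> ennreal k * (\<integral>\<^sup>+x\<in>S. ennreal (\<Phi> x (2 / \<nu>)) \<partial>lebesgue)"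
    using up[of "\<nu> / 2"] pos by simp
  then have "ennreal (1 / k) * 1 \<le> ennreal (1 / k) * (ennreal k * (\<integral>\<^sup>+x\<in>S. ennreal (\<Phi> x (2 / \<nu>)) \<partial>lebesgue))"
    by (rule mult_left_mono) simp
  also have "\<dots> = (\<integral>\<^sup>+x\<in>S. ennreal (\<Phi> x (2 / \<nu>)) \<partial>lebesgue)"
    using k by (simp add: mult.assoc[symmetric] ennreal_mult[symmetric])
  finally show thesis using that[OF pos \<nu>(1) A B] by simp
qed

text \<open>The functions \<open>f\<close> and \<open>h = \<bar>f\<bar> powr (1 / s)\<close> have
  corresponding modulars, a radius \<open>r\<close> for \<open>f\<close> being the radius
  \<open>r powr (1 / s)\<close> for \<open>h\<close>, and Jensen bounds \<open>maximal f\<close> by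
  the power \<open>s\<close> of \<open>maximal h\<close>. The exponents recombine to a linear bound
  with constant \<open>(C + 1) powr s\<close>.\<close>

lemma power_rescale_bounded:
  fixes \<phi> :: "real ^ 'n \<Rightarrow> real \<Rightarrow> ennreal"
  assumes mono: "\<And>x s t. 0 \<le> s \<Longrightarrow> s \<le> t \<Longrightarrow> \<phi> x s \<le> \<phi> x t"
    and s: "0 < s" "s < 1" and bd: "maximal_bounded (power_rescale s \<phi>)"
  shows "maximal_bounded \<phi>"
proof -
  define \<psi> where "\<psi> = power_rescale s \<phi>"
  obtain C where C: "0 \<le> C" "\<And>f. f \<in> L_space \<psi> \<Longrightarrow> lux_norm \<psi> (maximal f) \<le> ennreal C * lux_norm \<psi> (\<lambda>x. ennreal \<bar>f x\<bar>)"
    using bd unfolding maximal_bounded_def \<psi>_def by blast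
  show ?thesis
    unfolding maximal_bounded_def
  proof (intro exI[of _ "(C + 1) powr s"] conjI ballI)
    fix f assume f: "f \<in> L_space \<phi>"
    have f_meas [measurable]: "f \<in> borel_measurable lebesgue" using f by (simp add: L_space_def)
    show "lux_norm \<phi> (maximal f) \<le> ennreal ((C + 1) powr s) * lux_norm \<phi> (\<lambda>x. ennreal \<bar>f x\<bar>)"
    proof (rule lux_norm_le_mult)
      show "0 < (C + 1) powr s" using C(1) by simp
      fix r assume r: "0 < r" and m1: "modular \<phi> (\<lambda>x. ennreal \<bar>f x\<bar> / ennreal r) \<le> 1"
      define h where "h x = \<bar>f x\<bar> powr (1 / s)" for x
      have h_meas [measurable]: "h \<in> borel_measurable lebesgue" unfolding h_def by measurable
      define \<rho> where "\<rho> = r powr (1 / s)"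
      have \<rho>: "0 < \<rho>" using r by (simp add: \<rho>_def)
      have "extend \<psi> x (ennreal \<bar>h x\<bar> / ennreal \<rho>) = extend \<phi> x (ennreal \<bar>f x\<bar> / ennreal r)" for x
        using r \<rho> s by (simp add: divide_ennreal extend_def \<psi>_def power_rescale_def h_def \<rho>_def powr_divide powr_powr)
      then have "modular \<psi> (\<lambda>x. ennreal \<bar>h x\<bar> / ennreal \<rho>) \<le> 1" using m1 by (simp add: modular_def)
      then have lh: "lux_norm \<psi> (\<lambda>x. ennreal \<bar>h x\<bar>) \<le> ennreal \<rho>" by (rule lux_norm_le[OF \<rho>])
      then have hL: "h \<in> L_space \<psi>" unfolding L_space_def using order.strict_trans1[OF lh, of \<infinity>] by simp
      have "lux_norm \<psi> (maximal h) \<le> ennreal C * ennreal \<rho>"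
        using C(2)[OF hL] mult_left_mono[OF lh, of "ennreal C"] by (rule order_trans) simp
      also have "\<dots> < ennreal ((C + 1) * \<rho>)" using C(1) \<rho> by (simp add: ennreal_mult[symmetric] ennreal_less_iff)
      finally obtain r1 where r1: "0 < r1" "ennreal r1 < ennreal ((C + 1) * \<rho>)" "modular \<psi> (\<lambda>x. maximal h x / ennreal r1) \<le> 1"
        by (rule lux_norm_lessD)
      have r1s: "0 < r1 powr s" using r1 by simp
      have "modular \<phi> (\<lambda>x. maximal f x / ennreal (r1 powr s)) \<le> modular \<psi> (\<lambda>x. maximal h x / ennreal r1)"
        unfolding modular_def
      proof (rule nn_integral_mono)
        fix x
        show "extend \<phi> x (maximal f x / ennreal (r1 powr s)) \<le> extend \<psi> x (maximal h x / ennreal r1)"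
        proof (cases "maximal h x")
          case (real u)
          have "maximal f x \<le> ennreal (u powr s)"
            by (rule maximal_jensen[OF f_meas s]) (use real in \<open>simp_all add: h_def[abs_def]\<close>)
          then have "extend \<phi> x (maximal f x / ennreal (r1 powr s)) \<le> extend \<phi> x (ennreal (u powr s) / ennreal (r1 powr s))"
            by (intro extend_mono mono divide_right_mono_ennreal)
          also have "\<dots> = extend \<psi> x (maximal h x / ennreal r1)"
            using real r1(1) by (simp add: divide_ennreal extend_def \<psi>_def power_rescale_def powr_divide)
          finally show ?thesis .
        next
          case top
          then show ?thesis by (simp add: extend_def ennreal_top_divide)
        qed
      qed
      then have "lux_norm \<phi> (maximal f) \<le> ennreal (r1 powr s)"
        using r1(3) by (intro lux_norm_le[OF r1s]) (rule order_trans)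
      also have "\<dots> \<le> ennreal ((C + 1) powr s * r)"
      proof (rule ennreal_leI)
        have "r1 powr s \<le> ((C + 1) * \<rho>) powr s" using r1(1,2) s by (intro powr_mono2) (auto simp: ennreal_less_iff)
        also have "\<dots> = (C + 1) powr s * r" using C(1) r s by (simp add: \<rho>_def powr_mult powr_powr)
        finally show "r1 powr s \<le> (C + 1) powr s * r" .
      qed
      finally show "lux_norm \<phi> (maximal f) \<le> ennreal ((C + 1) powr s * r)" .
    qed
  qed simp
qed

section \<open>Class A and boundedness of the maximal operator\<close>

context double_phase_setting
begin

text \<open>\<open>0 < D x 1 \<le> 1\<close> makes the conjugate norm of the indicator finite and
  positive on every cube, whether or not \<open>a\<close> is integrable there.\<close>

lemma conjugate_cube_norm:
  assumes cmp: "comparable (conjugate dphase) D k" and l: "0 < l"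
  obtains \<nu> where "0 < \<nu>" "lux_norm (conjugate dphase) (indicator (cube c l)) = ennreal \<nu>"
    "(\<integral>\<^sup>+x\<in>cube c l. ennreal (D x (1 / (2 * \<nu>))) \<partial>lebesgue) \<le> ennreal k"
    "(\<integral>\<^sup>+x\<in>cube c l. ennreal (D x (2 / \<nu>)) \<partial>lebesgue) \<le> ennreal (4 powr (p / (p - 1)) * k)"
    "ennreal (1 / k) \<le> (\<integral>\<^sup>+x\<in>cube c l. ennreal (D x (2 / \<nu>)) \<partial>lebesgue)"
proof -
  have em: "emeasure lebesgue (cube c l) = ennreal (l ^ CARD('n))" by (rule emeasure_cube) (use l in simp)
  have D_meas [measurable]: "(\<lambda>x. D x 1) \<in> borel_measurable lebesgue" unfolding D_def by measurable
  have "(\<integral>\<^sup>+x\<in>cube c l. ennreal (D x 1) \<partial>lebesgue) \<le> (\<integral>\<^sup>+x\<in>cube c l. ennreal 1 \<partial>lebesgue)"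
    using D_le_powr[of 1] by (intro nn_integral_mono mult_right_mono ennreal_leI) simp_all
  also have "\<dots> = ennreal (l ^ CARD('n))" using em by simp
  finally obtain i where i: "(\<integral>\<^sup>+x\<in>cube c l. ennreal (D x 1) \<partial>lebesgue) = ennreal i" "0 \<le> i"
    by (cases "\<integral>\<^sup>+x\<in>cube c l. ennreal (D x 1) \<partial>lebesgue") (auto simp: top_unique)
  have "i \<noteq> 0"
  proof
    assume "i = 0"
    then have "AE x in lebesgue. ennreal (D x 1) * indicator (cube c l) x = 0"
      using i(1) by (subst nn_integral_0_iff_AE[symmetric]) auto
    then have "AE x in lebesgue. x \<notin> cube c l"
    proof eventually_elim
      case (elim x)
      then show ?case using growth_pos[OF D_growth, of 1 x] by (auto simp: indicator_def ennreal_eq_0_iff)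
    qed
    then have "emeasure lebesgue (cube c l) = 0" using AE_iff_null_sets[of "cube c l" lebesgue] by auto
    then show False using em l by simp
  qed
  then have "0 < i" using i(2) by simp
  show thesis
    by (rule lux_norm_indicator[OF cmp D_growth D_caratheodory cube_lebesgue i(1) \<open>0 < i\<close>]) (rule that)
qed

text \<open>The admissible parameter is a fixed multiple of \<open>1 / \<nu>\<close>, with
  \<open>\<nu>\<close> the conjugate norm of the indicator. Class A bounds the other norm by a
  multiple of \<open>m / \<nu>\<close>, that is of \<open>s * m\<close>, and the second phase of
  that modular alone yields the bound for the integral of \<open>a\<close>.\<close>

lemma class_A_imp_balanced:
  assumes A: "dphase \<in> class_A"
  shows "\<exists>C. balanced C"
proof -
  obtain k where cmp: "comparable (conjugate dphase) D k" using comparable_conjugate by blast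
  have k: "1 \<le> k" using cmp by (simp add: comparable_def)
  obtain CA where CA: "class_A_const dphase = ennreal CA" "0 \<le> CA"
    using A unfolding class_A_def by (cases "class_A_const dphase") auto
  \<comment> \<open>Shrinking the argument by \<open>\<theta>\<close> lowers the modular of
    \<open>D\<close> from \<open>k\<close> to 1, by the lower growth exponent
    \<open>1 + b\<close>.\<close>
  define \<theta> where "\<theta> = (1 / k) powr (1 / (1 + b))"
  have \<theta>: "0 < \<theta>" "\<theta> \<le> 1" using k b by (auto simp: \<theta>_def intro!: powr_le1)
  have \<theta>b: "\<theta> powr (1 + b) = 1 / k" using k b by (simp add: \<theta>_def powr_powr)
  define C where "C = q * (2 * (CA + 1) / \<theta>) powr q"
  have C0: "0 \<le> C" using q by (simp add: C_def)
  have "balanced C"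
    unfolding balanced_def
  proof (intro conjI C0 allI impI)
    fix c :: "real ^ 'n" and l :: real assume l: "0 < l"
    let ?Q = "cube c l"
    define m where "m = l ^ CARD('n)"
    have m: "0 < m" using l by (simp add: m_def)
    have em: "emeasure lebesgue ?Q = ennreal m" unfolding m_def by (rule emeasure_cube) (use l in simp)
    obtain \<nu> where \<nu>: "0 < \<nu>" "lux_norm (conjugate dphase) (indicator ?Q) = ennreal \<nu>"
      "(\<integral>\<^sup>+x\<in>?Q. ennreal (D x (1 / (2 * \<nu>))) \<partial>lebesgue) \<le> ennreal k"
      by (rule conjugate_cube_norm[OF cmp l])
    have "lux_norm dphase (indicator ?Q) * ennreal \<nu> / ennreal m \<le> ennreal CA"
      unfolding CA(1)[symmetric] class_A_const_def \<nu>(2)[symmetric] em[symmetric]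
      by (rule SUP_upper) (use l in \<open>auto simp: cubes_eq\<close>)
    then have R: "lux_norm dphase (indicator ?Q) * ennreal \<nu> \<le> ennreal (CA * m)"
      using m CA(2) by (cases "lux_norm dphase (indicator ?Q) * ennreal \<nu>")
        (simp_all add: divide_ennreal ennreal_le_iff divide_le_eq ennreal_top_divide top_unique)
    define r where "r = (CA + 1) * m / \<nu>"
    have r: "0 < r" using CA(2) m \<nu>(1) by (simp add: r_def)
    have "lux_norm dphase (indicator ?Q) < ennreal r"
    proof (rule ccontr)
      assume "\<not> ?thesis"
      then have "ennreal r * ennreal \<nu> \<le> lux_norm dphase (indicator ?Q) * ennreal \<nu>" by (intro mult_right_mono) auto
      also note R
      finally have "r * \<nu> \<le> CA * m" using r \<nu>(1) CA(2) m by (simp add: ennreal_mult[symmetric] ennreal_le_iff)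
      moreover have "r * \<nu> = (CA + 1) * m" using \<nu>(1) by (simp add: r_def)
      ultimately show False using m by (simp add: distrib_right)
    qed
    then obtain r' where r': "0 < r'" "ennreal r' < ennreal r" "modular dphase (\<lambda>x. indicator ?Q x / ennreal r') \<le> 1"
      by (rule lux_norm_lessD)
    have r'r: "r' < r" using r'(1,2) by (simp add: ennreal_less_iff)
    have "(\<integral>\<^sup>+x. ennreal ((1 / r) powr q / q) * (ennreal (a x) * indicator ?Q x) \<partial>lebesgue) \<le> (\<integral>\<^sup>+x\<in>?Q. dphase x (1 / r') \<partial>lebesgue)"
    proof (rule nn_integral_mono)
      fix x
      have "(1 / r) powr q / q * a x \<le> (1 / r') powr q / q * a x"
        using r'(1) r'r q a_nonneg[of x] by (intro mult_right_mono divide_right_mono powr_mono2 divide_left_mono) auto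
      also have "\<dots> \<le> 1 / p * (1 / r') powr p + 1 / q * a x * (1 / r') powr q"
        using divide_nonneg_pos[of "(1 / r') powr p" p] p by (simp add: mult.commute)
      finally have "ennreal ((1 / r) powr q / q) * ennreal (a x) \<le> dphase x (1 / r')"
        unfolding double_phase_def ennreal_mult''[OF a_nonneg, symmetric] by (rule ennreal_leI)
      then show "ennreal ((1 / r) powr q / q) * (ennreal (a x) * indicator ?Q x) \<le> dphase x (1 / r') * indicator ?Q x"
        by (simp add: indicator_def)
    qed
    also have "\<dots> = modular dphase (\<lambda>x. indicator ?Q x / ennreal r')"
      by (rule modular_indicator[symmetric]) (use r' in \<open>simp_all add: double_phase_def\<close>)
    also have "\<dots> \<le> 1" by (rule r'(3))
    also have "(\<integral>\<^sup>+x. ennreal ((1 / r) powr q / q) * (ennreal (a x) * indicator ?Q x) \<partial>lebesgue) = ennreal ((1 / r) powr q / q) * (\<integral>\<^sup>+x\<in>?Q. ennreal (a x) \<partial>lebesgue)"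
      by (rule nn_integral_cmult) measurable
    finally have le1: "ennreal ((1 / r) powr q / q) * (\<integral>\<^sup>+x\<in>?Q. ennreal (a x) \<partial>lebesgue) \<le> 1" .
    have rr: "q * r powr q * ((1 / r) powr q / q) = 1" using r q by (simp add: powr_divide)
    have "ennreal (q * r powr q) * (ennreal ((1 / r) powr q / q) * (\<integral>\<^sup>+x\<in>?Q. ennreal (a x) \<partial>lebesgue)) \<le> ennreal (q * r powr q) * 1"
      by (rule mult_left_mono[OF le1]) simp
    moreover have "ennreal (q * r powr q) * ennreal ((1 / r) powr q / q) = 1"
      using q rr by (subst ennreal_mult[symmetric]) simp_all
    ultimately have aQ: "(\<integral>\<^sup>+x\<in>?Q. ennreal (a x) \<partial>lebesgue) \<le> ennreal (q * r powr q)"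
      by (simp add: mult.assoc[symmetric])
    define s where "s = \<theta> / (2 * \<nu>)"
    have s: "0 < s" using \<theta> \<nu>(1) by (simp add: s_def)
    have "(\<integral>\<^sup>+x\<in>?Q. ennreal (D x s) \<partial>lebesgue) \<le> (\<integral>\<^sup>+x. ennreal (1 / k) * (ennreal (D x (1 / (2 * \<nu>))) * indicator ?Q x) \<partial>lebesgue)"
    proof (rule nn_integral_mono)
      fix x
      have "D x (\<theta> * (1 / (2 * \<nu>))) \<le> \<theta> powr (1 + b) * D x (1 / (2 * \<nu>))"
        by (rule growth_lower(1)[OF D_growth]) (use \<theta> \<nu>(1) in auto)
      then have "ennreal (D x s) \<le> ennreal (1 / k) * ennreal (D x (1 / (2 * \<nu>)))"
        unfolding ennreal_mult''[OF D_nonneg, symmetric] s_def \<theta>b by (simp add: ennreal_leI)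
      then show "ennreal (D x s) * indicator ?Q x \<le> ennreal (1 / k) * (ennreal (D x (1 / (2 * \<nu>))) * indicator ?Q x)"
        by (simp add: indicator_def)
    qed
    also have "\<dots> = ennreal (1 / k) * (\<integral>\<^sup>+x\<in>?Q. ennreal (D x (1 / (2 * \<nu>))) \<partial>lebesgue)"
      by (rule nn_integral_cmult) (simp add: D_def)
    also have "\<dots> \<le> ennreal (1 / k) * ennreal k" by (rule mult_left_mono[OF \<nu>(3)]) simp
    also have "\<dots> = 1" using k by (simp add: ennreal_mult[symmetric])
    finally have Ds: "(\<integral>\<^sup>+x\<in>?Q. ennreal (D x s) \<partial>lebesgue) \<le> 1" .
    have eqC: "q * r powr q = C * (s * m) powr q"
    proof -
      have "r = 2 * (CA + 1) / \<theta> * (s * m)" using \<theta> \<nu>(1) by (simp add: r_def s_def field_simps)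
      then have "r powr q = (2 * (CA + 1) / \<theta>) powr q * (s * m) powr q"
        using CA(2) \<theta> s m by (simp only: powr_mult)
      then show ?thesis by (simp add: C_def)
    qed
    then show "\<exists>s>0. (\<integral>\<^sup>+x\<in>?Q. ennreal (D x s) \<partial>lebesgue) \<le> 1 \<and>
      (\<integral>\<^sup>+x\<in>?Q. ennreal (a x) \<partial>lebesgue) \<le> ennreal (C * (s * l ^ CARD('n)) powr q)"
      using s Ds aQ[unfolded eqC, unfolded m_def] by blast
  qed
  then show ?thesis by blast
qed

lemma class_AI:
  assumes le: "\<And>c l \<nu>. \<lbrakk>0 < l; 0 < \<nu>; lux_norm (conjugate dphase) (indicator (cube c l)) = ennreal \<nu>\<rbrakk> \<Longrightarrow>
    lux_norm dphase (indicator (cube c l)) \<le> ennreal (K * l ^ CARD('n) / \<nu>)" and K: "0 \<le> K"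
  shows "dphase \<in> class_A"
proof -
  obtain k where cmp: "comparable (conjugate dphase) D k" using comparable_conjugate by blast
  have "class_A_const dphase \<le> ennreal K"
    unfolding class_A_const_def
  proof (rule SUP_least)
    fix Q :: "(real ^ 'n) set" assume "Q \<in> cubes"
    then obtain c l where Q: "Q = cube c l" "0 < l" by (auto simp: cubes_eq)
    define m where "m = l ^ CARD('n)"
    have m: "0 < m" using Q by (simp add: m_def)
    have em: "emeasure lebesgue Q = ennreal m" unfolding m_def Q(1) by (rule emeasure_cube) (use Q in simp)
    obtain \<nu> where \<nu>: "0 < \<nu>" "lux_norm (conjugate dphase) (indicator Q) = ennreal \<nu>"
      unfolding Q(1) by (rule conjugate_cube_norm[OF cmp Q(2)])
    have "lux_norm dphase (indicator Q) * ennreal \<nu> / ennreal m \<le> ennreal (K * m / \<nu>) * ennreal \<nu> / ennreal m"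
      using le[OF Q(2) \<nu>[unfolded Q(1)]] unfolding Q(1) m_def by (intro divide_right_mono_ennreal mult_right_mono) auto
    also have "\<dots> = ennreal K" using K m \<nu>(1) by (simp add: ennreal_mult[symmetric] divide_ennreal)
    finally show "lux_norm dphase (indicator Q) * lux_norm (conjugate dphase) (indicator Q) / emeasure lebesgue Q \<le> ennreal K"
      unfolding \<nu>(2) em .
  qed
  then show ?thesis unfolding class_A_def by (simp add: order.strict_trans1)
qed

text \<open>The test functions are the extremals of Young's inequality between \<open>dphase\<close> and its conjugate.\<close>

lemma bounded_imp_class_A:
  assumes bd: "maximal_bounded dphase"
  shows "dphase \<in> class_A"
proof -
  obtain k where cmp: "comparable (conjugate dphase) D k" using comparable_conjugate by blast
  have k: "1 \<le> k" using cmp by (simp add: comparable_def)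
  obtain B where B: "0 \<le> B" "\<And>f. f \<in> L_space dphase \<Longrightarrow> lux_norm dphase (maximal f) \<le> ennreal B * lux_norm dphase (\<lambda>x. ennreal \<bar>f x\<bar>)"
    using bd unfolding maximal_bounded_def by blast
  define M where "M = 2 * (4 powr (p / (p - 1)) * k)"
  have M: "0 \<le> M" using k by (simp add: M_def)
  define K where "K = (q * M + 1) powr (1 / p)"
  show ?thesis
  proof (rule class_AI)
    show "0 \<le> (B * K + 1) * (2 * k)" using B(1) k by (simp add: K_def)
    fix c :: "real ^ 'n" and l \<nu>0 :: real
    assume l: "0 < l" and "0 < \<nu>0" and \<nu>0: "lux_norm (conjugate dphase) (indicator (cube c l)) = ennreal \<nu>0"
    let ?Q = "cube c l"
    define m where "m = l ^ CARD('n)"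
    have m: "0 < m" using l by (simp add: m_def)
    obtain \<nu> where \<nu>: "0 < \<nu>" "lux_norm (conjugate dphase) (indicator ?Q) = ennreal \<nu>"
      "(\<integral>\<^sup>+x\<in>?Q. ennreal (D x (2 / \<nu>)) \<partial>lebesgue) \<le> ennreal (4 powr (p / (p - 1)) * k)"
      "ennreal (1 / k) \<le> (\<integral>\<^sup>+x\<in>?Q. ennreal (D x (2 / \<nu>)) \<partial>lebesgue)"
      by (rule conjugate_cube_norm[OF cmp l])
    have \<nu>\<nu>0: "\<nu>0 = \<nu>" using \<nu>(1,2) \<nu>0 \<open>0 < \<nu>0\<close> by simp
    \<comment> \<open>At this argument the modular of \<open>D\<close> on the cube lies between
      \<open>1 / k\<close> and a constant: the upper bound controls the norm of the test function,
      the lower one its average.\<close>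
    define s where "s = 2 / \<nu>"
    have s: "0 < s" using \<nu>(1) by (simp add: s_def)
    \<comment> \<open>On the cube \<open>s * f x = D x s\<close> while
      \<open>H x (f x) \<le> 2 * D x s\<close>, which is equality up to constants in Young's
      inequality at slope \<open>s\<close>.\<close>
    define f where "f x = s powr b * V s x * indicator ?Q x" for x
    have f_meas [measurable]: "f \<in> borel_measurable lebesgue" unfolding f_def by measurable
    have fnn: "0 \<le> f x" for x using V_pos[OF s, of x] by (simp add: f_def)
    have D_meas [measurable]: "(\<lambda>x. D x s) \<in> borel_measurable lebesgue" unfolding D_def by measurable
    have "modular (\<lambda>x t. ennreal (H x t)) (\<lambda>x. ennreal \<bar>f x\<bar>) \<le> (\<integral>\<^sup>+x. ennreal 2 * (ennreal (D x s) * indicator ?Q x) \<partial>lebesgue)"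
      unfolding modular_abs
    proof (rule nn_integral_mono)
      fix x
      show "ennreal (H x \<bar>f x\<bar>) \<le> ennreal 2 * (ennreal (D x s) * indicator ?Q x)"
      proof (cases "x \<in> ?Q")
        case True
        then have "H x \<bar>f x\<bar> \<le> 2 * D x s" using H_F_le[OF s, of x] fnn[of x] by (simp add: f_def)
        then have "ennreal (H x \<bar>f x\<bar>) \<le> ennreal 2 * ennreal (D x s)"
          unfolding ennreal_mult''[OF D_nonneg, symmetric] by (rule ennreal_leI)
        then show ?thesis using True by simp
      next
        case False
        then show ?thesis by (simp add: f_def H_def)
      qed
    qed
    also have "\<dots> = ennreal 2 * (\<integral>\<^sup>+x\<in>?Q. ennreal (D x s) \<partial>lebesgue)" by (rule nn_integral_cmult) measurable
    also have "\<dots> \<le> ennreal 2 * ennreal (4 powr (p / (p - 1)) * k)"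
      using \<nu>(3) by (intro mult_left_mono) (auto simp: s_def)
    also have "\<dots> = ennreal M" using k unfolding M_def by (intro ennreal_mult[symmetric]) auto
    finally have "lux_norm dphase (\<lambda>x. ennreal \<bar>f x\<bar>) \<le> ennreal K"
      unfolding K_def by (intro lux_norm_le_of_modular[OF comparable_H H_growth H_caratheodory _ M]) measurable
    moreover have "ennreal (\<nu> / (2 * k * m) * l ^ CARD('n)) \<le> (\<integral>\<^sup>+y\<in>?Q. ennreal \<bar>f y\<bar> \<partial>lebesgue)"
    proof -
      have "ennreal (\<nu> / (2 * k * m) * l ^ CARD('n)) = ennreal (1 / s) * ennreal (1 / k)"
        using k s \<nu>(1) m by (simp add: ennreal_mult[symmetric] m_def[symmetric]) (simp add: s_def)
      also have "\<dots> \<le> ennreal (1 / s) * (\<integral>\<^sup>+x\<in>?Q. ennreal (D x s) \<partial>lebesgue)"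
        using \<nu>(4) by (intro mult_left_mono) (auto simp: s_def)
      also have "\<dots> = (\<integral>\<^sup>+x. ennreal (1 / s) * (ennreal (D x s) * indicator ?Q x) \<partial>lebesgue)"
        by (rule nn_integral_cmult[symmetric]) measurable
      also have "\<dots> = (\<integral>\<^sup>+y\<in>?Q. ennreal \<bar>f y\<bar> \<partial>lebesgue)"
      proof (rule nn_integral_cong)
        fix x
        have "ennreal (1 / s) * ennreal (D x s) = ennreal (s powr b * V s x)"
          using D_eq[of s x] s unfolding ennreal_mult''[OF D_nonneg, symmetric] by simp
        then show "ennreal (1 / s) * (ennreal (D x s) * indicator ?Q x) = ennreal \<bar>f x\<bar> * indicator ?Q x"
          using fnn[of x] by (simp add: f_def indicator_def)
      qed
      finally show ?thesis .
    qed
    ultimately have "lux_norm dphase (indicator ?Q) \<le> ennreal ((B * K + 1) / (\<nu> / (2 * k * m)))"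
      by (intro lux_norm_indicator_le[OF mono_phi B(2,1) f_meas _ _ l]) (use \<nu>(1) k m in \<open>auto simp: K_def\<close>)
    also have "(B * K + 1) / (\<nu> / (2 * k * m)) = (B * K + 1) * (2 * k) * l ^ CARD('n) / \<nu>0"
      by (simp add: m_def \<nu>\<nu>0)
    finally show "lux_norm dphase (indicator ?Q) \<le> ennreal ((B * K + 1) * (2 * k) * l ^ CARD('n) / \<nu>0)" .
  qed
qed

text \<open>Since \<open>\<phi>r u / u\<close> increases, the line of slope
  \<open>\<phi>r t / t\<close> through 0 stays below \<open>\<phi>r u\<close> for
  \<open>u > t\<close>, and for \<open>u \<le> t\<close> it is at most
  \<open>\<phi>r t\<close>.\<close>

lemma conjugate_phi_div:
  fixes x :: "real ^ 'n" and t :: real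
  assumes t: "0 < t"
  defines "\<phi>r \<equiv> \<lambda>u. 1 / p * u powr p + 1 / q * a x * u powr q"
  shows "conjugate dphase x (\<phi>r t / t) \<le> dphase x t"
  unfolding conjugate_def
proof (rule SUP_least)
  fix u :: real assume "u \<in> {0..}"
  then have u: "0 \<le> u" by simp
  have nn: "0 \<le> \<phi>r v" for v using p q a_nonneg[of x] by (simp add: \<phi>r_def)
  have ph: "dphase x v = ennreal (\<phi>r v)" for v by (simp add: double_phase_def \<phi>r_def)
  have "\<phi>r t / t * u - \<phi>r u \<le> \<phi>r t"
  proof (cases "u \<le> t")
    case True
    then have "\<phi>r t * (u / t) \<le> \<phi>r t * 1" using t nn by (intro mult_left_mono) auto
    then show ?thesis using nn[of u] by simp
  next
    case False
    then have ut: "t \<le> u" "0 < u" using t by auto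
    have "t powr (p - 1) \<le> u powr (p - 1)" "t powr (q - 1) \<le> u powr (q - 1)"
      using ut t p q by (auto intro!: powr_mono2)
    then have "1 / p * t powr (p - 1) + 1 / q * a x * t powr (q - 1) \<le> 1 / p * u powr (p - 1) + 1 / q * a x * u powr (q - 1)"
      using p q a_nonneg[of x] by (intro add_mono mult_left_mono) auto
    then have "(1 / p * t powr (p - 1) + 1 / q * a x * t powr (q - 1)) * u \<le> (1 / p * u powr (p - 1) + 1 / q * a x * u powr (q - 1)) * u"
      using u by (rule mult_right_mono)
    moreover have "\<phi>r t / t = 1 / p * t powr (p - 1) + 1 / q * a x * t powr (q - 1)"
      using t by (simp add: \<phi>r_def powr_diff add_divide_distrib)
    moreover have "\<phi>r u = (1 / p * u powr (p - 1) + 1 / q * a x * u powr (q - 1)) * u"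
      using ut by (simp add: \<phi>r_def powr_diff distrib_right)
    ultimately show ?thesis using nn[of t] by simp
  qed
  then show "ennreal (\<phi>r t / t * u) - dphase x u \<le> dphase x t"
    unfolding ph using nn[of u] by (simp add: ennreal_minus ennreal_leI)
qed

text \<open>If \<open>a\<close> were not integrable on the cube, its indicator would have infinite
  norm and could not be used to normalise a test function. The test functions therefore live on the
  sets \<open>S j\<close> where \<open>a\<close> is at most \<open>j\<close>; the bound obtained is
  uniform in \<open>j\<close> and passes to the cube by monotone convergence.\<close>

lemma conjugate_bounded_imp_class_A:
  assumes bd: "maximal_bounded (conjugate dphase)"
  shows "dphase \<in> class_A"
proof -
  obtain k where cmp: "comparable (conjugate dphase) D k" using comparable_conjugate by blast
  have k: "1 \<le> k" using cmp by (simp add: comparable_def)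
  obtain B where B: "0 \<le> B" "\<And>f. f \<in> L_space (conjugate dphase) \<Longrightarrow>
      lux_norm (conjugate dphase) (maximal f) \<le> ennreal B * lux_norm (conjugate dphase) (\<lambda>x. ennreal \<bar>f x\<bar>)"
    using bd unfolding maximal_bounded_def by blast
  define M where "M = k * (q * (4 powr q * q))"
  have M: "0 \<le> M" using k q by (simp add: M_def)
  define K where "K = (k * M + 1) powr (1 / (1 + b))"
  define L where "L = (B * K + 1) * (2 * q * q)"
  have L: "0 \<le> L" using B(1) q by (simp add: L_def K_def)
  show ?thesis
  proof (rule class_AI)
    show "0 \<le> L + 1" using L by simp
    fix c :: "real ^ 'n" and l \<nu> :: real
    assume l: "0 < l" and \<nu>: "0 < \<nu>" "lux_norm (conjugate dphase) (indicator (cube c l)) = ennreal \<nu>"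
    let ?Q = "cube c l"
    define m where "m = l ^ CARD('n)"
    have m: "0 < m" using l by (simp add: m_def)
    have em: "emeasure lebesgue ?Q = ennreal m" unfolding m_def by (rule emeasure_cube) (use l in simp)
    define S where "S j = ?Q \<inter> {x \<in> space lebesgue. a x \<le> real j}" for j :: nat
    have [measurable]: "S j \<in> sets lebesgue" for j unfolding S_def by measurable
    have ind: "modular dphase (\<lambda>x. indicator X x / ennreal u) = (\<integral>\<^sup>+x\<in>X. dphase x (1 / u) \<partial>lebesgue)" if "0 < u" for X u
      by (rule modular_indicator) (use that in \<open>simp_all add: double_phase_def\<close>)
    have piece: "lux_norm dphase (indicator (S j)) \<le> ennreal (L * m / \<nu>)" for j
    proof -
      have [measurable]: "(\<lambda>x. H x 1) \<in> borel_measurable lebesgue" unfolding H_def by measurable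
      have "(\<integral>\<^sup>+x\<in>S j. ennreal (H x 1) \<partial>lebesgue) \<le> (\<integral>\<^sup>+x\<in>?Q. ennreal (1 + real j) \<partial>lebesgue)"
      proof (rule nn_integral_mono)
        fix x
        show "ennreal (H x 1) * indicator (S j) x \<le> ennreal (1 + real j) * indicator ?Q x"
          by (cases "x \<in> S j") (auto simp: S_def H_def intro!: ennreal_leI simp del: ennreal_plus)
      qed
      also have "\<dots> = ennreal ((1 + real j) * m)"
        using m by (subst nn_integral_cmult_indicator) (simp_all add: em ennreal_mult del: ennreal_plus)
      finally obtain i where i: "(\<integral>\<^sup>+x\<in>S j. ennreal (H x 1) \<partial>lebesgue) = ennreal i" "0 \<le> i"
        by (cases "\<integral>\<^sup>+x\<in>S j. ennreal (H x 1) \<partial>lebesgue") (auto simp: top_unique)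
      show ?thesis
      proof (cases "i = 0")
        \<comment> \<open>Here \<open>S j\<close> is a null set and its norm is 0;
          \<open>lux_norm_indicator\<close> requires a positive modular and does not cover this
          case.\<close>
        case True
        then have "AE x in lebesgue. ennreal (H x 1) * indicator (S j) x = 0"
          using i(1) by (subst nn_integral_0_iff_AE[symmetric]) auto
        then have ae: "AE x in lebesgue. x \<notin> S j"
        proof eventually_elim
          case (elim x)
          then show ?case using growth_pos[OF H_growth, of 1 x] by (auto simp: indicator_def ennreal_eq_0_iff)
        qed
        have small: "lux_norm dphase (indicator (S j)) \<le> ennreal r" if "0 < r" for r
        proof (rule lux_norm_le[OF that])
          have "AE x in lebesgue. dphase x (1 / r) * indicator (S j) x = 0"
            using ae by eventually_elim simp
          then have "(\<integral>\<^sup>+x\<in>S j. dphase x (1 / r) \<partial>lebesgue) = (\<integral>\<^sup>+x. 0 \<partial>(lebesgue :: (real ^ 'n) measure))"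
            by (rule nn_integral_cong_AE)
          then show "modular dphase (\<lambda>x. indicator (S j) x / ennreal r) \<le> 1"
            by (subst ind[OF that]) simp
        qed
        have "lux_norm dphase (indicator (S j)) \<le> 0"
          by (rule ennreal_le_epsilon) (use small in simp)
        then show ?thesis by simp
      next
        case False
        then have i0: "0 < i" using i(2) by simp
        obtain \<rho> where \<rho>: "0 < \<rho>" "lux_norm dphase (indicator (S j)) = ennreal \<rho>"
          "(\<integral>\<^sup>+x\<in>S j. ennreal (H x (2 / \<rho>)) \<partial>lebesgue) \<le> ennreal (4 powr q * q)"
          "ennreal (1 / q) \<le> (\<integral>\<^sup>+x\<in>S j. ennreal (H x (2 / \<rho>)) \<partial>lebesgue)"
          by (rule lux_norm_indicator[OF comparable_H H_growth H_caratheodory _ i(1) i0]) (simp, rule that)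
        define t where "t = 2 / \<rho>"
        have t: "0 < t" using \<rho>(1) by (simp add: t_def)
        define \<phi>r where "\<phi>r x = 1 / p * t powr p + 1 / q * a x * t powr q" for x
        have \<phi>r: "dphase x t = ennreal (\<phi>r x)" "0 \<le> \<phi>r x" for x
          using p q a_nonneg[of x] by (simp_all add: double_phase_def \<phi>r_def)
        \<comment> \<open>On \<open>S j\<close> this is the slope of the chord from 0 to
          \<open>t\<close>. Its conjugate modular is at most the modular of the constant
          \<open>t\<close>, by \<open>conjugate_phi_div\<close>, and \<open>t * g x\<close> is the
          integrand of that modular, whose lower bound gives \<open>g\<close> an average of order
          \<open>\<rho> / m\<close>.\<close>
        define g where "g x = \<phi>r x / t * indicator (S j) x" for x
        have g_meas [measurable]: "g \<in> borel_measurable lebesgue" unfolding g_def \<phi>r_def by measurable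
        have H_meas [measurable]: "(\<lambda>x. H x t) \<in> borel_measurable lebesgue" unfolding H_def by measurable
        have gnn: "0 \<le> g x" for x using \<phi>r(2)[of x] t by (simp add: g_def)
        have cmpH: "\<phi>r x \<le> q * H x t" "H x t / q \<le> \<phi>r x" for x
          using comparable_H t \<phi>r[of x] H_nonneg[of x t] q unfolding comparable_def
          by (auto simp: ennreal_le_iff dest!: spec[of _ x] spec[of _ t])
        have "modular (conjugate dphase) (\<lambda>x. ennreal \<bar>g x\<bar>) \<le> (\<integral>\<^sup>+x. ennreal q * (ennreal (H x t) * indicator (S j) x) \<partial>lebesgue)"
          unfolding modular_abs
        proof (rule nn_integral_mono)
          fix x
          show "conjugate dphase x \<bar>g x\<bar> \<le> ennreal q * (ennreal (H x t) * indicator (S j) x)"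
          proof (cases "x \<in> S j")
            case True
            then have "\<bar>g x\<bar> = \<phi>r x / t" using \<phi>r(2)[of x] t by (simp add: g_def)
            then have "conjugate dphase x \<bar>g x\<bar> \<le> ennreal (\<phi>r x)"
              using conjugate_phi_div[OF t, where x=x] unfolding \<phi>r(1)[symmetric] by (simp add: \<phi>r_def)
            also have "\<dots> \<le> ennreal q * ennreal (H x t)"
              unfolding ennreal_mult''[OF H_nonneg, symmetric] by (rule ennreal_leI[OF cmpH(1)])
            finally show ?thesis using True by simp
          next
            case False
            then show ?thesis using comparable_zero[OF cmp D_growth] by (simp add: g_def)
          qed
        qed
        also have "\<dots> = ennreal q * (\<integral>\<^sup>+x\<in>S j. ennreal (H x t) \<partial>lebesgue)" by (rule nn_integral_cmult) measurable
        also have "\<dots> \<le> ennreal q * ennreal (4 powr q * q)" using \<rho>(3) by (intro mult_left_mono) (auto simp: t_def)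
        finally have mg: "modular (conjugate dphase) (\<lambda>x. ennreal \<bar>g x\<bar>) \<le> ennreal q * ennreal (4 powr q * q)" .
        have "modular (\<lambda>x t. ennreal (D x t)) (\<lambda>x. ennreal \<bar>g x\<bar>) \<le> ennreal k * modular (conjugate dphase) (\<lambda>x. ennreal \<bar>g x\<bar>)"
          by (rule modular_comparable(2)[OF cmp D_growth D_caratheodory]) measurable
        also have "\<dots> \<le> ennreal k * (ennreal q * ennreal (4 powr q * q))" by (rule mult_left_mono[OF mg]) simp
        also have "\<dots> = ennreal M" using k q by (simp add: M_def ennreal_mult)
        finally have "lux_norm (conjugate dphase) (\<lambda>x. ennreal \<bar>g x\<bar>) \<le> ennreal K"
          unfolding K_def by (intro lux_norm_le_of_modular[OF cmp D_growth D_caratheodory _ M]) measurable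
        moreover have "ennreal (\<rho> / (2 * q * q * m) * l ^ CARD('n)) \<le> (\<integral>\<^sup>+y\<in>?Q. ennreal \<bar>g y\<bar> \<partial>lebesgue)"
        proof -
          have "ennreal (\<rho> / (2 * q * q * m) * l ^ CARD('n)) = ennreal (1 / (t * q)) * ennreal (1 / q)"
            using q t \<rho>(1) m by (simp add: ennreal_mult[symmetric] m_def[symmetric]) (simp add: t_def)
          also have "\<dots> \<le> ennreal (1 / (t * q)) * (\<integral>\<^sup>+x\<in>S j. ennreal (H x t) \<partial>lebesgue)"
            using \<rho>(4) by (intro mult_left_mono) (auto simp: t_def)
          also have "\<dots> = (\<integral>\<^sup>+x. ennreal (1 / (t * q)) * (ennreal (H x t) * indicator (S j) x) \<partial>lebesgue)"
            by (rule nn_integral_cmult[symmetric]) measurable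
          also have "\<dots> \<le> (\<integral>\<^sup>+y\<in>?Q. ennreal \<bar>g y\<bar> \<partial>lebesgue)"
          proof (rule nn_integral_mono)
            fix x
            show "ennreal (1 / (t * q)) * (ennreal (H x t) * indicator (S j) x) \<le> ennreal \<bar>g x\<bar> * indicator ?Q x"
            proof (cases "x \<in> S j")
              case True
              have "1 / (t * q) * H x t \<le> \<bar>g x\<bar>"
                using divide_right_mono[OF cmpH(2)[of x], of t] t True \<phi>r(2)[of x] by (simp add: g_def mult.commute)
              then have "ennreal (1 / (t * q)) * ennreal (H x t) \<le> ennreal \<bar>g x\<bar>"
                unfolding ennreal_mult''[OF H_nonneg, symmetric] by (rule ennreal_leI)
              then show ?thesis using True by (simp add: S_def)
            qed simp
          qed
          finally show ?thesis .
        qed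
        ultimately have "lux_norm (conjugate dphase) (indicator ?Q) \<le> ennreal ((B * K + 1) / (\<rho> / (2 * q * q * m)))"
          by (intro lux_norm_indicator_le[OF mono_conjugate B(2,1) g_meas _ _ l]) (use \<rho>(1) q m in \<open>auto simp: K_def\<close>)
        \<comment> \<open>Testing bounds the conjugate norm \<open>\<nu>\<close> of the whole cube
          by a multiple of \<open>m / \<rho>\<close>. The relation is symmetric in both norms and is
          now read as a bound for \<open>\<rho>\<close>.\<close>
        then have "\<nu> \<le> (B * K + 1) / (\<rho> / (2 * q * q * m))"
          unfolding \<nu>(2) using B(1) \<rho>(1) q m by (subst (asm) ennreal_le_iff) (auto simp: K_def)
        then have "\<nu> * \<rho> \<le> L * m" using \<rho>(1) by (simp add: L_def field_simps)
        then have "\<rho> \<le> L * m / \<nu>" using \<nu>(1) by (simp add: field_simps)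
        then show ?thesis unfolding \<rho>(2) by (rule ennreal_leI)
      qed
    qed
    define r where "r = (L + 1) * m / \<nu>"
    have r: "0 < r" using L m \<nu>(1) by (simp add: r_def)
    have [measurable]: "(\<lambda>x. dphase x (1 / r)) \<in> borel_measurable lebesgue" unfolding double_phase_def by measurable
    have S1: "(\<integral>\<^sup>+x\<in>S j. dphase x (1 / r) \<partial>lebesgue) \<le> 1" for j
    proof -
      have "L * m / \<nu> < r" using m \<nu>(1) by (simp add: r_def divide_strict_right_mono)
      then have "lux_norm dphase (indicator (S j)) < ennreal r"
        using L m \<nu>(1) by (intro order.strict_trans1[OF piece]) (simp add: ennreal_less_iff)
      then obtain r' where r': "0 < r'" "ennreal r' < ennreal r" "modular dphase (\<lambda>x. indicator (S j) x / ennreal r') \<le> 1"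
        by (rule lux_norm_lessD)
      have "(\<integral>\<^sup>+x\<in>S j. dphase x (1 / r) \<partial>lebesgue) \<le> (\<integral>\<^sup>+x\<in>S j. dphase x (1 / r') \<partial>lebesgue)"
        using r r' by (intro nn_integral_mono mult_right_mono mono_phi divide_left_mono) (auto simp: ennreal_less_iff)
      also have "\<dots> = modular dphase (\<lambda>x. indicator (S j) x / ennreal r')"
        by (rule ind[OF r'(1), symmetric])
      finally show ?thesis using r'(3) by simp
    qed
    have "(\<integral>\<^sup>+x\<in>?Q. dphase x (1 / r) \<partial>lebesgue) = (\<integral>\<^sup>+x. (SUP j. dphase x (1 / r) * indicator (S j) x) \<partial>lebesgue)"
    proof (rule nn_integral_cong)
      fix x
      show "dphase x (1 / r) * indicator ?Q x = (SUP j. dphase x (1 / r) * indicator (S j) x)"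
      proof (cases "x \<in> ?Q")
        case True
        obtain j :: nat where j: "a x \<le> real j" using real_arch_simple by blast
        show ?thesis
        proof (rule antisym)
          show "dphase x (1 / r) * indicator ?Q x \<le> (SUP j. dphase x (1 / r) * indicator (S j) x)"
            by (rule SUP_upper2[of j]) (use j True in \<open>simp_all add: S_def\<close>)
          show "(SUP j. dphase x (1 / r) * indicator (S j) x) \<le> dphase x (1 / r) * indicator ?Q x"
            by (rule SUP_least) (use True in \<open>auto simp: indicator_def\<close>)
        qed
      next
        case False
        then show ?thesis by (simp add: S_def)
      qed
    qed
    also have "\<dots> = (SUP j. \<integral>\<^sup>+x\<in>S j. dphase x (1 / r) \<partial>lebesgue)"
    proof (rule nn_integral_monotone_convergence_SUP)
      show "incseq (\<lambda>j x. dphase x (1 / r) * indicator (S j) x)"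
        unfolding incseq_def le_fun_def
      proof (intro allI impI mult_left_mono)
        fix i j :: nat and x assume "i \<le> j"
        then have "S i \<subseteq> S j" unfolding S_def by force
        then show "indicator (S i) x \<le> (indicator (S j) x :: ennreal)" by (auto simp: indicator_def)
      qed simp
    qed measurable
    also have "\<dots> \<le> 1" by (rule SUP_least) (rule S1)
    finally have "modular dphase (\<lambda>x. indicator ?Q x / ennreal r) \<le> 1"
      by (subst ind[OF r])
    then have "lux_norm dphase (indicator ?Q) \<le> ennreal r" by (rule lux_norm_le[OF r])
    then show "lux_norm dphase (indicator ?Q) \<le> ennreal ((L + 1) * l ^ CARD('n) / \<nu>)" by (simp add: r_def m_def)
  qed
qed

lemma class_A_imp_modular_bounded:
  assumes A: "dphase \<in> class_A"
  shows "maximal_modular_bounded dphase" "maximal_modular_bounded (conjugate dphase)"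
    "\<exists>s. 0 < s \<and> s < 1 \<and> maximal_bounded (power_rescale s dphase)"
proof -
  obtain C where C: "balanced C" using class_A_imp_balanced[OF A] by blast
  obtain \<tau> K where \<tau>: "0 < \<tau>" "\<tau> < 1" "0 \<le> K" and avg: "averaging (\<lambda>x t. H x (t powr \<tau>)) K"
    using averaging_H[OF C] by blast
  have "modular_strong_type H"
    unfolding modular_strong_type_def by (rule maximal_strong_type[OF H_growth H_caratheodory \<tau>(1,2) avg \<tau>(3)])
  then show "maximal_modular_bounded dphase"
    by (rule maximal_modular_boundedI[OF comparable_H H_growth H_caratheodory])
  obtain \<tau>' K' where \<tau>': "0 < \<tau>'" "\<tau>' < 1" "0 \<le> K'" and avg': "averaging (\<lambda>x t. D x (t powr \<tau>')) K'"
    using averaging_D[OF C] by blast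
  obtain k where cmp: "comparable (conjugate dphase) D k" using comparable_conjugate by blast
  have "modular_strong_type D"
    unfolding modular_strong_type_def by (rule maximal_strong_type[OF D_growth D_caratheodory \<tau>'(1,2) avg' \<tau>'(3)])
  then show "maximal_modular_bounded (conjugate dphase)"
    by (rule maximal_modular_boundedI[OF cmp D_growth D_caratheodory])
  \<comment> \<open>The gain is divided in two: as
    \<open>(t powr (\<tau> / s)) powr s = t powr \<tau>\<close>, averaging for \<open>H\<close> with
    exponent \<open>\<tau>\<close> is averaging for the rescaled function with exponent
    \<open>\<tau> / s\<close>, which is still below 1 because \<open>\<tau> < s\<close>.\<close>
  define s where "s = (1 + \<tau>) / 2"
  have s: "0 < s" "s < 1" "\<tau> < s" using \<tau> by (simp_all add: s_def)
  let ?G = "\<lambda>x t. H x (t powr s)"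
  have cmps: "comparable (power_rescale s dphase) ?G q"
    using comparable_H unfolding comparable_def power_rescale_def by simp
  have "averaging (\<lambda>x t. ?G x (t powr (\<tau> / s))) K"
    using avg s by (simp add: powr_powr)
  from maximal_strong_type[OF growth_powr[OF H_growth s(1)] caratheodory_powr[OF H_caratheodory] _ _ this \<tau>(3)]
  have "modular_strong_type ?G"
    unfolding modular_strong_type_def using s \<tau> by simp
  then have "maximal_modular_bounded (power_rescale s dphase)"
    by (rule maximal_modular_boundedI[OF cmps growth_powr[OF H_growth s(1)] caratheodory_powr[OF H_caratheodory]])
  then have "maximal_bounded (power_rescale s dphase)"
    by (rule maximal_modular_bounded_imp_bounded[OF cmps growth_powr[OF H_growth s(1)] caratheodory_powr[OF H_caratheodory]])
  then show "\<exists>s. 0 < s \<and> s < 1 \<and> maximal_bounded (power_rescale s dphase)" using s by blast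
qed

end

theorem theorem2p20:
  fixes p q :: real and a :: "real ^ 'n \<Rightarrow> real"
    and \<phi> :: "real ^ 'n \<Rightarrow> real \<Rightarrow> ennreal"
  assumes "1 < p" and "p < q"
    and "a \<in> borel_measurable lebesgue" and "\<And>x. 0 \<le> a x"
    and "\<phi> = double_phase p q a"
  shows "(\<phi> \<in> class_A \<longleftrightarrow> maximal_modular_bounded \<phi>) \<and>
         (maximal_modular_bounded \<phi> \<longleftrightarrow> maximal_bounded \<phi>) \<and>
         (maximal_bounded \<phi> \<longleftrightarrow> maximal_modular_bounded (conjugate \<phi>)) \<and>
         (maximal_modular_bounded (conjugate \<phi>) \<longleftrightarrow> maximal_bounded (conjugate \<phi>)) \<and>
         (maximal_bounded (conjugate \<phi>) \<longleftrightarrow>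
           (\<exists>s. 0 < s \<and> s < 1 \<and> maximal_bounded (power_rescale s \<phi>)))"
proof -
  interpret double_phase_setting p q a by unfold_locales (use assms in auto)
  note \<phi> = assms(5)
  obtain k where cmp: "comparable (conjugate \<phi>) D k" using comparable_conjugate unfolding \<phi> by blast
  have "maximal_modular_bounded \<phi> \<Longrightarrow> maximal_bounded \<phi>"
    unfolding \<phi> by (rule maximal_modular_bounded_imp_bounded[OF comparable_H H_growth H_caratheodory])
  moreover have "maximal_modular_bounded (conjugate \<phi>) \<Longrightarrow> maximal_bounded (conjugate \<phi>)"
    by (rule maximal_modular_bounded_imp_bounded[OF cmp D_growth D_caratheodory])
  moreover have "maximal_bounded \<phi>" if "0 < s" "s < 1" "maximal_bounded (power_rescale s \<phi>)" for s
  proof (rule power_rescale_bounded[OF _ that])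
    show "\<phi> x u \<le> \<phi> x t" if "0 \<le> u" "u \<le> t" for x u t
      unfolding \<phi> using that by (rule mono_phi)
  qed
  \<comment> \<open>Class A is the hub: it implies (b), (d) and (f). Conversely (b) and (f) lead to
    (c), (d) leads to (e), and each of (c) and (e) returns to class A.\<close>
  moreover note class_A_imp_modular_bounded[folded \<phi>] bounded_imp_class_A[folded \<phi>] conjugate_bounded_imp_class_A[folded \<phi>]
  ultimately show ?thesis by blast
qed

end
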